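(* Let $\psi\in\mathcal S(\mathbb R^n)$ with $\psi(0)=1$ and a weight $M$ be given, and put $\psi_k(\xi)=\psi(2^{-kM}\xi)$. Then for every $f\in\mathcal O_M(\mathbb R^n)$ and every $u\in\mathcal S'(\mathbb R^n)$, $$\mathcal F^{-1}(\psi_k\mathcal Ff)\cdot\mathcal F^{-1}(\psi_k\mathcal Fu)\longrightarrow fu\quad\text{in }\mathcal D'(\mathbb R^n)\text{ as }k\to\infty.$$ In particular $\pi(f,u)$ is defined and equal to $fu$.
   Context: A weight is $M=(m_1,\dots,m_n)$ with $m_j\ge1$ and $\min_j m_j=1$; $2^{-kM}x=(2^{-km_1}x_1,\dots,2^{-km_n}x_n)$. $\mathcal O_M(\mathbb R^n)$ (here the subscript is part of the standard name, unrelated to the weight) is the space of slowly increasing functions: $f\in C^\infty(\mathbb R^n)$ such that for every multi-index $\alpha$ there are $a,c>0$ with $|D^\alpha f(x)|\le c(1+|x|^2)^{a/2}$ for all $x$. For $f\in\mathcal O_M$ and $u\in\mathcal S'$, $fu$ denotes the usual product of a smooth function and a distribution. Product $\pi$ (for the given weight $M$). For $\psi\in C_0^\infty(\mathbb R^n)$ equal to $1$ in a neighbourhood of $0$, let $\psi_k(\xi)=\psi(2^{-kM}\xi)$ and, for $u,v\in\mathcal S'(\mathbb R^n)$, $\pi_\psi(u,v)=\lim_{k\to\infty}\mathcal F^{-1}(\psi_k\mathcal Fu)\cdot\mathcal F^{-1}(\psi_k\mathcal Fv)$ when the limit exists in $\mathcal D'(\mathbb R^n)$. $\pi(u,v):=\pi_\psi(u,v)$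 when $\pi_\psi(u,v)$ exists for all such $\psi$ and is independent of $\psi$. *)

theory Defs
  imports "HOL-Analysis.Analysis"
begin

text \<open>
  Functionals are total HOL functions on all of \<^typ>\<open>(real ^ 'n) \<Rightarrow> complex\<close>; a (tempered)
  distribution is a functional that is linear and continuous on the test (Schwartz) functions.
  Its values elsewhere are irrelevant, so equality of distributions is \<open>distr_eq\<close> below,
  not HOL equality.
\<close>

type_synonym 'n cfun = "(real ^ 'n) \<Rightarrow> complex"
type_synonym 'n functional = "'n cfun \<Rightarrow> complex"


subsection \<open>Smooth functions and function spaces\<close>

definition partial :: "'n::finite \<Rightarrow> 'n cfun \<Rightarrow> 'n cfun" where
  "partial j f = (\<lambda>x. vector_derivative (\<lambda>t. f (x + t *\<^sub>R axis j 1)) (at 0))"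

text \<open>
  Multi-indices are written as lists of coordinates: the list \<open>[j1, ..., jm]\<close> stands for
  the iterated derivative along \<open>j1\<close>, ..., \<open>jm\<close>, and its length is the order. Every
  multi-index arises this way; for smooth functions the order of the entries is immaterial.
\<close>

fun iter_partial :: "'n::finite list \<Rightarrow> 'n cfun \<Rightarrow> 'n cfun" where
  "iter_partial [] f = f"
| "iter_partial (j # js) f = partial j (iter_partial js f)"

definition smooth :: "'n::finite cfun \<Rightarrow> bool" where
  "smooth f \<longleftrightarrow> (\<forall>js x. iter_partial js f differentiable (at x))"

definition test_functions :: "'n::finite cfun set" where
  "test_functions = {\<phi>. smooth \<phi> \<and> compact (closure {x. \<phi> x \<noteq> 0})}"

definition schwartz :: "'n::finite cfun set" where
  "schwartz = {\<phi>. smooth \<phi> \<and>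
     (\<forall>m js. \<exists>C. \<forall>x. (1 + norm x) ^ m * norm (iter_partial js \<phi> x) \<le> C)}"

definition slowly_increasing :: "'n::finite cfun set" where
  "slowly_increasing = {f. smooth f \<and>
     (\<forall>js. \<exists>a>0. \<exists>c>0. \<forall>x.
        norm (iter_partial js f x) \<le> c * (1 + (norm x)\<^sup>2) powr (a / 2))}"


subsection \<open>Distributions\<close>

definition linear_on_funs :: "'n::finite cfun set \<Rightarrow> 'n functional \<Rightarrow> bool" where
  "linear_on_funs S u \<longleftrightarrow>
     (\<forall>\<phi>\<in>S. \<forall>\<eta>\<in>S. u (\<lambda>x. \<phi> x + \<eta> x) = u \<phi> + u \<eta>) \<and>
     (\<forall>c. \<forall>\<phi>\<in>S. u (\<lambda>x. c * \<phi> x) = c * u \<phi>)"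

text \<open>Continuity is expressed by the usual seminorm estimates.\<close>

definition distributions :: "'n::finite functional set" where
  "distributions = {u. linear_on_funs test_functions u \<and>
     (\<forall>K. compact K \<longrightarrow> (\<exists>C N. \<forall>\<phi>\<in>test_functions. closure {x. \<phi> x \<noteq> 0} \<subseteq> K \<longrightarrow>
        norm (u \<phi>) \<le> C * (\<Sum>js | length js \<le> N. SUP x. norm (iter_partial js \<phi> x))))}"

definition tempered :: "'n::finite functional set" where
  "tempered = {u. linear_on_funs schwartz u \<and>
     (\<exists>C N. \<forall>\<phi>\<in>schwartz.
        norm (u \<phi>) \<le> C * (\<Sum>js | length js \<le> N.
                             SUP x. (1 + norm x) ^ N * norm (iter_partial js \<phi> x)))}"

definition distr_eq :: "'n::finite functional \<Rightarrow> 'n functional \<Rightarrow> bool" where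
  "distr_eq u v \<longleftrightarrow> (\<forall>\<phi>\<in>test_functions. u \<phi> = v \<phi>)"

definition converges_distr :: "(nat \<Rightarrow> 'n::finite functional) \<Rightarrow> 'n functional \<Rightarrow> bool" where
  "converges_distr T w \<longleftrightarrow> (\<forall>k. T k \<in> distributions) \<and> w \<in> distributions \<and>
     (\<forall>\<phi>\<in>test_functions. (\<lambda>k. T k \<phi>) \<longlonglongrightarrow> w \<phi>)"

definition of_fun :: "'n::finite cfun \<Rightarrow> 'n functional" where
  "of_fun g = (\<lambda>\<phi>. LINT x|lborel. g x * \<phi> x)"

text \<open>
  The continuous function with which a distribution coincides (unique if it exists).
\<close>

definition fun_of :: "'n::finite functional \<Rightarrow> 'n cfun" where
  "fun_of u = (THE g. continuous_on UNIV g \<and> distr_eq u (of_fun g))"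

definition fun_mult :: "'n::finite cfun \<Rightarrow> 'n functional \<Rightarrow> 'n functional" where
  "fun_mult g u = (\<lambda>\<phi>. u (\<lambda>x. g x * \<phi> x))"


subsection \<open>Fourier transformation\<close>

definition fourier :: "'n::finite cfun \<Rightarrow> 'n cfun" where
  "fourier \<phi> = (\<lambda>\<xi>. LINT x|lborel. exp (- \<i> * of_real (x \<bullet> \<xi>)) * \<phi> x)"

definition inv_fourier :: "'n::finite cfun \<Rightarrow> 'n cfun" where
  "inv_fourier \<phi> = (\<lambda>x. of_real ((2 * pi) powr - real CARD('n)) *
     (LINT \<xi>|lborel. exp (\<i> * of_real (x \<bullet> \<xi>)) * \<phi> \<xi>))"

definition fourier_tempered :: "'n::finite functional \<Rightarrow> 'n functional" where
  "fourier_tempered u = (\<lambda>\<phi>. u (fourier \<phi>))"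

definition inv_fourier_tempered :: "'n::finite functional \<Rightarrow> 'n functional" where
  "inv_fourier_tempered u = (\<lambda>\<phi>. u (inv_fourier \<phi>))"


subsection \<open>The product\<close>

definition weight :: "('n::finite \<Rightarrow> real) \<Rightarrow> bool" where
  "weight M \<longleftrightarrow> (\<forall>j. 1 \<le> M j) \<and> Min (range M) = 1"

definition dilate :: "('n::finite \<Rightarrow> real) \<Rightarrow> nat \<Rightarrow> 'n cfun \<Rightarrow> 'n cfun" where
  "dilate M k \<psi> = (\<lambda>\<xi>. \<psi> (\<chi> j. 2 powr (- (real k * M j)) * \<xi> $ j))"

definition freq_cutoff ::
  "('n::finite \<Rightarrow> real) \<Rightarrow> 'n cfun \<Rightarrow> nat \<Rightarrow> 'n functional \<Rightarrow> 'n functional" where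
  "freq_cutoff M \<psi> k u =
     inv_fourier_tempered (fun_mult (dilate M k \<psi>) (fourier_tempered u))"

text \<open>
  For \<open>\<psi>\<close> a Schwartz function and tempered \<open>u\<close>, the distribution \<open>freq_cutoff M \<psi> k u\<close> is a
  smooth function, so that two such factors are multiplied pointwise.
\<close>

definition cutoff_product ::
  "('n::finite \<Rightarrow> real) \<Rightarrow> 'n cfun \<Rightarrow> 'n functional \<Rightarrow> 'n functional \<Rightarrow> nat \<Rightarrow> 'n functional" where
  "cutoff_product M \<psi> u v k =
     of_fun (\<lambda>x. fun_of (freq_cutoff M \<psi> k u) x * fun_of (freq_cutoff M \<psi> k v) x)"

definition pi_cutoffs :: "'n::finite cfun set" where
  "pi_cutoffs = {\<psi> \<in> test_functions. \<forall>\<^sub>F \<xi> in nhds 0. \<psi> \<xi> = 1}"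

definition pi_psi_exists ::
  "('n::finite \<Rightarrow> real) \<Rightarrow> 'n cfun \<Rightarrow> 'n functional \<Rightarrow> 'n functional \<Rightarrow> bool" where
  "pi_psi_exists M \<psi> u v \<longleftrightarrow> (\<exists>w. converges_distr (cutoff_product M \<psi> u v) w)"

definition pi_psi ::
  "('n::finite \<Rightarrow> real) \<Rightarrow> 'n cfun \<Rightarrow> 'n functional \<Rightarrow> 'n functional \<Rightarrow> 'n functional" where
  "pi_psi M \<psi> u v = (\<lambda>\<phi>. lim (\<lambda>k. cutoff_product M \<psi> u v k \<phi>))"

definition pi_defined ::
  "('n::finite \<Rightarrow> real) \<Rightarrow> 'n functional \<Rightarrow> 'n functional \<Rightarrow> bool" where
  "pi_defined M u v \<longleftrightarrow> u \<in> tempered \<and> v \<in> tempered \<and>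
     (\<forall>\<psi>\<in>pi_cutoffs. pi_psi_exists M \<psi> u v) \<and>
     (\<forall>\<psi>\<in>pi_cutoffs. \<forall>\<psi>'\<in>pi_cutoffs. distr_eq (pi_psi M \<psi> u v) (pi_psi M \<psi>' u v))"

text \<open>The common value of all \<open>pi_psi M \<psi> u v\<close>; meaningful only if \<open>pi_defined M u v\<close>.\<close>

definition pi_product ::
  "('n::finite \<Rightarrow> real) \<Rightarrow> 'n functional \<Rightarrow> 'n functional \<Rightarrow> 'n functional" where
  "pi_product M u v = (\<lambda>\<phi>. THE z. \<forall>\<psi>\<in>pi_cutoffs. pi_psi M \<psi> u v \<phi> = z)"

end

(*
  Writing h for the inverse Fourier transform of psi and A_k for the dilation by 2^(-kM), Fubini and a
  change of variables show that the smoothed f is x |-> INT f(x - A_k z) h(z) dz, and that pairing the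
  cut-off product with a test function phi gives u applied to x |-> INT (f_k phi)(x + A_k z) h(z) dz,
  f_k being the smoothed f. Since INT h = psi(0) = 1 and |A_k z| <= 2^(-k) |z|, the mean value theorem
  makes both averages converge at rate 2^(-k), the first with polynomial weights and the second in
  every Schwartz seminorm, so u carries the limit to u(f phi). The smoothed u is a continuous
  function because u commutes with integrals of translates, which is seen on Riemann sums.
*)

theory Submission
  imports Defs "HOL-Probability.Characteristic_Functions" "HOL-Probability.Sinc_Integral"
begin

subsection \<open>Calculus of iterated partial derivatives\<close>

text \<open>The obstacle is that both \<open>f\<close> and \<open>u\<close> may grow. The test
  function \<phi> confines the error \<open>f_k - f\<close> to a fixed ball, on which polynomial
  weights are constants; only then does the second average spread the product over the whole space,
  and the finite moments of \<open>h\<close> control its tails. Keeping the dilation in the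
  translations makes this uniform in \<open>k\<close>: every constant is a moment of the one
  function \<open>h\<close>, not of a kernel that changes with \<open>k\<close>. The identity
  \<open>INT h = \<psi> 0\<close> is Fourier inversion at a single point. It is obtained from a
  Gaussian, whose transform is the characteristic function of the normal distribution. Since
  \<open>fun_of\<close> and \<open>pi_product\<close> are definite descriptions, uniqueness of
  continuous representatives and existence of a cut-off have to be established too; both rest on an
  explicit smooth bump function.\<close>

lemma vec_eq_sum_axis: "(v :: real ^ 'n::finite) = (\<Sum>i\<in>UNIV. (v $ i) *\<^sub>R axis i 1)"
  by (simp add: vec_eq_iff axis_def if_distrib cong: if_cong)

text \<open>The chain rule along the line through \<open>x\<close> in direction \<open>j\<close>.
  \<open>partial\<close> is a one-dimensional derivative, whereas \<open>smooth\<close> asks for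
  Frechet differentiability; through this bridge the rules for \<open>partial\<close> are read off
  from those for \<open>has_derivative\<close>.\<close>

lemma partial_eqI:
  assumes "(f has_derivative D) (at x)"
  shows "partial j f x = D (axis j 1)"
proof -
  have "((\<lambda>t::real. x + t *\<^sub>R axis j 1) has_derivative (\<lambda>t. t *\<^sub>R axis j 1)) (at 0)"
    by (auto intro!: derivative_eq_intros)
  moreover have "(f has_derivative D) (at (x + 0 *\<^sub>R axis j 1) within range (\<lambda>t. x + t *\<^sub>R axis j 1))"
    using assms by (auto intro: has_derivative_at_withinI)
  ultimately have "((\<lambda>t. f (x + t *\<^sub>R axis j 1)) has_derivative (\<lambda>t. D (t *\<^sub>R axis j 1))) (at 0)"
    by (intro has_derivative_in_compose[where f="\<lambda>t. x + t *\<^sub>R axis j 1" and g=f]) auto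
  moreover have "D (t *\<^sub>R axis j 1) = t *\<^sub>R D (axis j 1)" for t
    using has_derivative_bounded_linear[OF assms] by (rule linear_simps)
  ultimately have "((\<lambda>t. f (x + t *\<^sub>R axis j 1)) has_vector_derivative D (axis j 1)) (at 0)"
    by (simp add: has_vector_derivative_def)
  then show ?thesis
    unfolding partial_def by (rule vector_derivative_at)
qed

lemma has_derivative_partial:
  fixes f :: "'n::finite cfun"
  assumes "f differentiable at x"
  shows "(f has_derivative (\<lambda>v. \<Sum>i\<in>UNIV. (v $ i) *\<^sub>R partial i f x)) (at x)"
proof -
  obtain D where D: "(f has_derivative D) (at x)"
    using assms by (auto simp: differentiable_def)
  interpret D: bounded_linear D
    using D by (rule has_derivative_bounded_linear)
  have "D v = (\<Sum>i\<in>UNIV. (v $ i) *\<^sub>R partial i f x)" for v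
    by (subst vec_eq_sum_axis[of v]) (simp add: D.sum D.scaleR partial_eqI[OF D])
  then show ?thesis using D by (metis (no_types, lifting) ext)
qed

lemma smooth_differentiable: "smooth f \<Longrightarrow> f differentiable at x"
  by (metis iter_partial.simps(1) smooth_def)

lemma smooth_iter_differentiable: "smooth f \<Longrightarrow> iter_partial js f differentiable at x"
  by (simp add: smooth_def)

lemma iter_partial_append: "iter_partial (js @ ks) f = iter_partial js (iter_partial ks f)"
  by (induction js) auto

lemma smooth_iter_partial: "smooth f \<Longrightarrow> smooth (iter_partial js f)"
  by (simp add: smooth_def flip: iter_partial_append)

lemma smooth_partial: "smooth f \<Longrightarrow> smooth (partial j f)"
  using smooth_iter_partial[of f "[j]"] by simp

lemma smooth_continuous_on: "smooth f \<Longrightarrow> continuous_on S f"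
  by (meson continuous_at_imp_continuous_on differentiable_imp_continuous_within smooth_differentiable)

lemma smooth_borel_measurable: "smooth f \<Longrightarrow> f \<in> borel_measurable borel"
  by (intro borel_measurable_continuous_onI smooth_continuous_on)

text \<open>\<open>smooth\<close> quantifies over all iterated derivatives, so closure properties
  are proved by computing these in closed form and checking that the resulting formulas are
  differentiable.\<close>

lemma smoothI_iter:
  assumes "\<And>js. iter_partial js f = F js" "\<And>js x. F js differentiable at x"
  shows "smooth f"
  using assms by (simp add: smooth_def)

lemma partial_add:
  assumes "f differentiable at x" "g differentiable at x"
  shows "partial j (\<lambda>x. f x + g x) x = partial j f x + partial j g x"
  using partial_eqI[OF has_derivative_add[OF has_derivative_partial[OF assms(1)] has_derivative_partial[OF assms(2)]], of j]
    partial_eqI[OF has_derivative_partial[OF assms(1)], of j]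
    partial_eqI[OF has_derivative_partial[OF assms(2)], of j]
  by simp

lemma partial_mult:
  assumes "f differentiable at x" "g differentiable at x"
  shows "partial j (\<lambda>x. f x * g x) x = partial j f x * g x + f x * partial j g x"
  using partial_eqI[OF has_derivative_mult[OF has_derivative_partial[OF assms(1)] has_derivative_partial[OF assms(2)]], of j]
    partial_eqI[OF has_derivative_partial[OF assms(1)], of j]
    partial_eqI[OF has_derivative_partial[OF assms(2)], of j]
  by simp

lemma partial_const: "partial j (\<lambda>x. c) = (\<lambda>x. 0)"
  by (intro ext) (simp add: partial_eqI[OF has_derivative_const])

lemma partial_cmult:
  assumes "f differentiable at x"
  shows "partial j (\<lambda>x. c * f x) x = c * partial j f x"
  using partial_mult[of "\<lambda>x. c" x f j] assms by (simp add: partial_const)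

lemma iter_partial_add:
  assumes "smooth f" "smooth g"
  shows "iter_partial js (\<lambda>x. f x + g x) = (\<lambda>x. iter_partial js f x + iter_partial js g x)"
  by (induction js) (use assms in \<open>auto simp: partial_add smooth_iter_differentiable\<close>)

lemma smooth_add: "smooth f \<Longrightarrow> smooth g \<Longrightarrow> smooth (\<lambda>x. f x + g x)"
  by (rule smoothI_iter[OF iter_partial_add])
    (auto intro!: differentiable_add simp: smooth_iter_differentiable)

lemma iter_partial_cmult:
  assumes "smooth f"
  shows "iter_partial js (\<lambda>x. c * f x) = (\<lambda>x. c * iter_partial js f x)"
  by (induction js) (use assms in \<open>auto simp: partial_cmult smooth_iter_differentiable\<close>)

lemma smooth_cmult: "smooth f \<Longrightarrow> smooth (\<lambda>x. c * f x)"
  by (rule smoothI_iter[OF iter_partial_cmult])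
    (auto intro!: differentiable_mult simp: smooth_iter_differentiable)

lemma iter_partial_diff:
  assumes "smooth f" "smooth g"
  shows "iter_partial js (\<lambda>x. f x - g x) = (\<lambda>x. iter_partial js f x - iter_partial js g x)"
  using iter_partial_add[OF assms(1) smooth_cmult[OF assms(2), of "-1"], of js]
    iter_partial_cmult[OF assms(2), of js "-1"] by simp

lemma smooth_diff: "smooth f \<Longrightarrow> smooth g \<Longrightarrow> smooth (\<lambda>x. f x - g x)"
  using smooth_add[OF _ smooth_cmult[of g "-1"], of f] by simp

lemma iter_partial_const: "iter_partial js (\<lambda>x. c) = (\<lambda>x. if js = [] then c else 0)"
  by (induction js) (auto simp: partial_const)

lemma smooth_const: "smooth (\<lambda>x. c)"
  by (rule smoothI_iter[OF iter_partial_const]) auto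

text \<open>All ways of distributing the derivatives in a list over two factors. Repetitions in the
  resulting list take the place of the binomial coefficients in Leibniz' rule.\<close>

fun splits :: "'a list \<Rightarrow> ('a list \<times> 'a list) list" where
  "splits [] = [([], [])]"
| "splits (j # js) = map (\<lambda>(a, b). (j # a, b)) (splits js) @ map (\<lambda>(a, b). (a, j # b)) (splits js)"

lemma length_splits: "(a, b) \<in> set (splits js) \<Longrightarrow> length a + length b = length js"
  by (induction js arbitrary: a b) auto

lemma partial_sum_list:
  assumes "\<And>p. p \<in> set ps \<Longrightarrow> F p differentiable at x"
  shows "partial j (\<lambda>x. \<Sum>p\<leftarrow>ps. F p x) x = (\<Sum>p\<leftarrow>ps. partial j (F p) x)"
    and "(\<lambda>x. \<Sum>p\<leftarrow>ps. F p x) differentiable at x"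
  using assms
proof (induction ps)
  case Nil
  { case 1 show ?case by (simp add: partial_const) }
  { case 2 show ?case by simp }
next
  case (Cons p ps)
  { case 1 then show ?case using Cons by (simp add: partial_add) }
  { case 2 then show ?case using Cons by (auto intro!: differentiable_add) }
qed

lemma iter_partial_mult:
  assumes "smooth f" "smooth g"
  shows "iter_partial js (\<lambda>x. f x * g x) =
    (\<lambda>x. \<Sum>p\<leftarrow>splits js. iter_partial (fst p) f x * iter_partial (snd p) g x)"
proof (induction js)
  case (Cons j js)
  have d: "(\<lambda>x. iter_partial a f x * iter_partial b g x) differentiable at x" for a b x
    using assms by (auto intro!: differentiable_mult simp: smooth_iter_differentiable)
  show ?case
    using assms
    by (simp add: Cons partial_sum_list(1)[OF d] partial_mult smooth_iter_differentiable
        sum_list_addf case_prod_unfold comp_def)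
qed simp

lemma smooth_mult: "smooth f \<Longrightarrow> smooth g \<Longrightarrow> smooth (\<lambda>x. f x * g x)"
  by (rule smoothI_iter[OF iter_partial_mult])
    (auto intro!: partial_sum_list(2) differentiable_mult simp: smooth_iter_differentiable)

text \<open>Translations, reflections and anisotropic dilations all have a diagonal linear part, and
  for such maps a derivative along \<open>j\<close> merely brings out the factor
  \<open>d j\<close>.\<close>

lemma partial_affine:
  fixes f :: "'n::finite cfun"
  assumes "f differentiable at (t + (\<chi> i. d i * x $ i))"
  shows "partial j (\<lambda>x. f (t + (\<chi> i. d i * x $ i))) x = d j * partial j f (t + (\<chi> i. d i * x $ i))"
    and "(\<lambda>x. f (t + (\<chi> i. d i * x $ i))) differentiable at x"
proof -
  have "bounded_linear (\<lambda>x :: real ^ 'n. \<chi> i. d i * x $ i)"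
    by (intro linear_conv_bounded_linear[THEN iffD1] linearI) (auto simp: vec_eq_iff algebra_simps)
  then have "((\<lambda>x. t + (\<chi> i. d i * x $ i)) has_derivative (\<lambda>x. \<chi> i. d i * x $ i)) (at x)"
    using has_derivative_add[OF has_derivative_const bounded_linear.has_derivative[OF _ has_derivative_ident]] by fastforce
  note D = has_derivative_compose[OF this has_derivative_partial[OF assms]]
  show "partial j (\<lambda>x. f (t + (\<chi> i. d i * x $ i))) x = d j * partial j f (t + (\<chi> i. d i * x $ i))"
    unfolding partial_eqI[OF D]
    by (simp add: axis_def if_distrib[where f="\<lambda>z. _ * z"] if_distrib[where f=complex_of_real] if_distrib[where f="\<lambda>z. z * _"] scaleR_conv_of_real cong: if_cong)
  show "(\<lambda>x. f (t + (\<chi> i. d i * x $ i))) differentiable at x"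
    using D by (auto simp: differentiable_def)
qed

lemma iter_partial_affine:
  fixes f :: "'n::finite cfun"
  assumes "smooth f"
  shows "iter_partial js (\<lambda>x. f (t + (\<chi> i. d i * x $ i))) =
    (\<lambda>x. of_real (prod_list (map d js)) * iter_partial js f (t + (\<chi> i. d i * x $ i)))"
  by (induction js)
    (use assms in \<open>auto simp: partial_affine partial_cmult smooth_iter_differentiable mult_ac\<close>)

lemma smooth_affine: "smooth f \<Longrightarrow> smooth (\<lambda>x. f (t + (\<chi> i. d i * x $ i)))"
  by (rule smoothI_iter[OF iter_partial_affine])
    (auto intro!: differentiable_mult partial_affine simp: smooth_iter_differentiable)

text \<open>Differentiability of all iterated derivatives of order below the given number. In
  contrast to \<open>iter_partial\<close>, the recursion removes the innermost derivative, which
  suits functions whose first derivative is known but whose higher derivatives have no convenient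
  closed form.\<close>

fun times_diff :: "nat \<Rightarrow> 'n::finite cfun \<Rightarrow> bool" where
  "times_diff 0 f \<longleftrightarrow> True"
| "times_diff (Suc m) f \<longleftrightarrow> (\<forall>x. f differentiable at x) \<and> (\<forall>j. times_diff m (partial j f))"

lemma smooth_iff_times_diff: "smooth f \<longleftrightarrow> (\<forall>m. times_diff m f)"
proof -
  have *: "times_diff m f \<longleftrightarrow> (\<forall>js x. length js < m \<longrightarrow> iter_partial js f differentiable at x)" for m
  proof (induction m arbitrary: f)
    case (Suc m)
    show ?case
    proof
      assume L: "times_diff (Suc m) f"
      show "\<forall>js x. length js < Suc m \<longrightarrow> iter_partial js f differentiable at x"
      proof (intro allI impI)
        fix js :: "'a list" and x assume "length js < Suc m"
        then show "iter_partial js f differentiable at x"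
          using L by (cases js rule: rev_cases) (auto simp: Suc iter_partial_append)
      qed
    next
      assume R: "\<forall>js x. length js < Suc m \<longrightarrow> iter_partial js f differentiable at x"
      have "iter_partial js (partial j f) differentiable at x" if "length js < m" for js j x
        using R[rule_format, of "js @ [j]" x] that by (simp add: iter_partial_append)
      moreover have "f differentiable at x" for x
        using R[rule_format, of "[]" x] by simp
      ultimately show "times_diff (Suc m) f"
        by (simp add: Suc)
    qed
  qed simp
  show ?thesis
    unfolding smooth_def * by auto
qed

text \<open>\<open>G n\<close> is the \<open>n\<close>-th derivative of \<open>G 0\<close>. A
  partial derivative of \<open>G n\<close> composed with \<open>q\<close> is
  \<open>G (Suc n)\<close> composed with \<open>q\<close>, times a derivative of \<open>q\<close>;
  since a member of the family appears again, the induction over the order, for all \<open>n\<close>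
  at once, closes.\<close>

lemma smooth_compose_real:
  fixes q :: "real ^ 'n::finite \<Rightarrow> real"
  assumes q: "smooth (\<lambda>x. of_real (q x))"
    and G: "\<And>n t. (G n has_real_derivative G (Suc n) t) (at t)"
  shows "smooth (\<lambda>x. of_real (G n (q x)))"
proof -
  let ?q = "\<lambda>x. complex_of_real (q x)"
  have q': "(q has_derivative (\<lambda>v. Re (\<Sum>i\<in>UNIV. (v $ i) *\<^sub>R partial i ?q x))) (at x)" for x
    using bounded_linear.has_derivative[OF bounded_linear_Re has_derivative_partial[OF smooth_differentiable[OF q]]]
    by simp
  have "partial i ?q x = of_real (Re (partial i ?q x))" for i x
  proof -
    have "((\<lambda>x. of_real (q x)) has_derivative (\<lambda>v. complex_of_real (Re (\<Sum>i\<in>UNIV. (v $ i) *\<^sub>R partial i ?q x)))) (at x)"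
      by (rule bounded_linear.has_derivative[OF bounded_linear_of_real q'])
    from partial_eqI[OF this, of i] show ?thesis
      by (metis complex_of_real_def complex.sel(1) of_real_def of_real_Re Reals_of_real)
  qed
  then have D: "((\<lambda>x. complex_of_real (G n (q x))) has_derivative
      (\<lambda>v. of_real (G (Suc n) (q x)) * (\<Sum>i\<in>UNIV. (v $ i) *\<^sub>R partial i ?q x))) (at x)" for n x
  proof -
    have "((\<lambda>x. G n (q x)) has_derivative (\<lambda>v. G (Suc n) (q x) * Re (\<Sum>i\<in>UNIV. (v $ i) *\<^sub>R partial i ?q x))) (at x)"
      using has_derivative_compose[OF q' G[unfolded has_field_derivative_def]] .
    from bounded_linear.has_derivative[OF bounded_linear_of_real this]
    have "((\<lambda>x. complex_of_real (G n (q x))) has_derivative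
      (\<lambda>v. of_real (G (Suc n) (q x) * Re (\<Sum>i\<in>UNIV. (v $ i) *\<^sub>R partial i ?q x)))) (at x)" .
    moreover have "complex_of_real (Re (\<Sum>i\<in>UNIV. (v $ i) *\<^sub>R partial i ?q x)) = (\<Sum>i\<in>UNIV. (v $ i) *\<^sub>R partial i ?q x)" for v
      using \<open>\<And>i x. partial i ?q x = of_real (Re (partial i ?q x))\<close>
      by (subst of_real_Re) (auto simp: scaleR_conv_of_real intro!: sum_in_Reals Reals_mult, metis Reals_of_real)
    ultimately show ?thesis by simp
  qed
  have P: "partial j (\<lambda>x. complex_of_real (G n (q x))) = (\<lambda>x. of_real (G (Suc n) (q x)) * partial j ?q x)" for n j
  proof
    fix x
    show "partial j (\<lambda>x. complex_of_real (G n (q x))) x = of_real (G (Suc n) (q x)) * partial j ?q x"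
      using partial_eqI[OF D, of j n x] partial_eqI[OF has_derivative_partial[OF smooth_differentiable[OF q]], of j x]
      by simp
  qed
  \<comment> \<open>Products are handled at a fixed order, because the induction that follows knows
    only \<open>times_diff m\<close> of its first factor.\<close>
  have mult: "times_diff m (\<lambda>x. f x * g x)" if "times_diff m f" "times_diff m g" for m and f g :: "'n cfun"
    using that
  proof (induction m arbitrary: f g)
    case (Suc m)
    have add: "times_diff k (\<lambda>x. f x + g x)" if "times_diff k f" "times_diff k g" for k and f g :: "'n cfun"
      using that
    proof (induction k arbitrary: f g)
      case (Suc k)
      then have "partial j (\<lambda>x. f x + g x) = (\<lambda>x. partial j f x + partial j g x)" for j
        by (intro ext partial_add) auto
      with Suc show ?case by (auto intro!: differentiable_add)
    qed simp
    have less: "times_diff k f" if "times_diff (Suc k) f" for k and f :: "'n cfun"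
      using that by (induction k arbitrary: f) auto
    have "partial j (\<lambda>x. f x * g x) = (\<lambda>x. partial j f x * g x + f x * partial j g x)" for j
      using Suc by (intro ext partial_mult) auto
    with Suc less show ?case by (auto intro!: differentiable_mult add)
  qed simp
  have "times_diff m (\<lambda>x. complex_of_real (G n (q x)))" for m n
  proof (induction m arbitrary: n)
    case (Suc m)
    have "times_diff m (\<lambda>x. of_real (G (Suc n) (q x)) * partial j ?q x)" for j
      using Suc smooth_partial[OF q] by (intro mult) (auto simp: smooth_iff_times_diff)
    moreover have "(\<lambda>x. complex_of_real (G n (q x))) differentiable at x" for x
      using D[of n x] by (auto simp: differentiable_def)
    ultimately show ?case by (simp add: P)
  qed simp
  then show ?thesis by (simp add: smooth_iff_times_diff)
qed

section \<open>Coordinate functions, characters and supports\<close>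

lemma iter_partial_coord:
  "iter_partial js (\<lambda>x. complex_of_real (x $ i)) =
    (\<lambda>x. case js of [] \<Rightarrow> of_real (x $ i) | [j] \<Rightarrow> (if j = i then 1 else 0) | _ \<Rightarrow> 0)"
proof -
  have P: "partial j (\<lambda>x. complex_of_real (x $ i)) = (\<lambda>x. if j = i then 1 else 0)" for j
  proof
    fix x
    have "((\<lambda>x. complex_of_real (x $ i)) has_derivative (\<lambda>v. of_real (v $ i))) (at x)"
      by (intro bounded_linear.has_derivative[OF bounded_linear_of_real]
          bounded_linear.has_derivative[OF bounded_linear_vec_nth] has_derivative_ident)
    from partial_eqI[OF this, of j] show "partial j (\<lambda>x. complex_of_real (x $ i)) x = (if j = i then 1 else 0)"
      by (simp add: axis_def)
  qed
  show ?thesis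
  proof (cases js rule: rev_cases)
    case (snoc ks j)
    then show ?thesis
      by (auto simp: iter_partial_append P iter_partial_const fun_eq_iff split: list.splits)
  qed simp
qed

lemma smooth_coord: "smooth (\<lambda>x. complex_of_real (x $ i))"
proof (rule smoothI_iter[OF iter_partial_coord])
  fix js :: "'a list" and x :: "real ^ 'a"
  have "(\<lambda>x. complex_of_real (x $ i)) differentiable at x"
    by (intro bounded_linear_imp_differentiable bounded_linear_compose[OF bounded_linear_of_real bounded_linear_vec_nth])
  then show "(\<lambda>x. case js of [] \<Rightarrow> complex_of_real (x $ i) | [j] \<Rightarrow> if j = i then 1 else 0
      | j # a # list \<Rightarrow> 0) differentiable at x"
    by (cases js) (auto split: list.split)
qed

lemma has_derivative_expi:
  "((\<lambda>\<xi>. c * exp (\<i> * of_real (y \<bullet> \<xi>))) has_derivative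
     (\<lambda>v. c * (exp (\<i> * of_real (y \<bullet> \<xi>)) * (\<i> * of_real (y \<bullet> v))))) (at \<xi>)"
proof -
  have "((\<lambda>\<xi>. \<i> * complex_of_real (y \<bullet> \<xi>)) has_derivative (\<lambda>v. \<i> * of_real (y \<bullet> v))) (at \<xi>)"
    by (intro has_derivative_mult_right bounded_linear.has_derivative[OF bounded_linear_of_real]
        bounded_linear.has_derivative[OF bounded_linear_inner_right] has_derivative_ident)
  from has_derivative_compose[OF this DERIV_exp[unfolded has_field_derivative_def]]
  show ?thesis
    by (intro has_derivative_mult_right)
qed

lemma iter_partial_expi:
  "iter_partial js (\<lambda>\<xi>. exp (\<i> * of_real (y \<bullet> \<xi>))) =
    (\<lambda>\<xi>. (\<Prod>j\<leftarrow>js. \<i> * of_real (y $ j)) * exp (\<i> * of_real (y \<bullet> \<xi>)))"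
proof (induction js)
  case (Cons j js)
  show ?case
    by (intro ext) (simp add: Cons partial_eqI[OF has_derivative_expi] inner_axis)
qed simp

lemma smooth_expi: "smooth (\<lambda>\<xi>. exp (\<i> * of_real (y \<bullet> \<xi>)))"
proof (rule smoothI_iter[OF iter_partial_expi])
  show "(\<lambda>\<xi>. (\<Prod>j\<leftarrow>js. \<i> * of_real (y $ j)) * exp (\<i> * of_real (y \<bullet> \<xi>))) differentiable at x" for js x
    using has_derivative_expi by (auto simp: differentiable_def)
qed

lemma iter_partial_eq_0:
  assumes "closed K" "\<And>y. y \<notin> K \<Longrightarrow> f y = 0" "x \<notin> K"
  shows "iter_partial js f x = 0"
  using assms(3)
proof (induction js arbitrary: x)
  case (Cons j js)
  have "eventually (\<lambda>y. y \<in> - K) (nhds x)"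
    using assms(1) Cons(2) by (intro eventually_nhds_in_open) auto
  then have "eventually (\<lambda>y. 0 = iter_partial js f y) (nhds x)"
    by eventually_elim (use Cons(1) in auto)
  then have "eventually (\<lambda>y. 0 = iter_partial js f y) (at x)"
    by (auto simp: eventually_nhds_conv_at)
  from has_derivative_transform_eventually[OF has_derivative_const this] Cons
  have "(iter_partial js f has_derivative (\<lambda>x. 0)) (at x)"
    by auto
  from partial_eqI[OF this, of j] show ?case by simp
qed (use assms(2) in simp)

subsection \<open>Functions of polynomial growth\<close>

text \<open>The real exponent covers growth and decay alike: Schwartz functions satisfy this for
  every \<open>a\<close>, slowly increasing ones for some \<open>a\<close>, and exponents simply add
  under multiplication.\<close>

definition poly_bounded :: "real \<Rightarrow> ('a::real_normed_vector \<Rightarrow> 'b::real_normed_vector) \<Rightarrow> bool" where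
  "poly_bounded a f \<longleftrightarrow> (\<exists>C. \<forall>x. norm (f x) \<le> C * (1 + norm x) powr a)"

lemma one_plus_norm_neq_0 [simp]: "1 + norm x \<noteq> 0" "0 < 1 + norm x"
  by (auto simp: add_nonneg_eq_0_iff add_pos_nonneg)

lemma poly_boundedE:
  assumes "poly_bounded a f"
  obtains C where "0 \<le> C" "\<And>x. norm (f x) \<le> C * (1 + norm x) powr a"
proof -
  obtain C where C: "\<And>x. norm (f x) \<le> C * (1 + norm x) powr a"
    using assms by (auto simp: poly_bounded_def)
  have "norm (f x) \<le> \<bar>C\<bar> * (1 + norm x) powr a" for x
    by (rule order_trans[OF C mult_right_mono]) auto
  then show ?thesis using that[of "\<bar>C\<bar>"] by auto
qed

lemma poly_boundedI: "(\<And>x. norm (f x) \<le> C * (1 + norm x) powr a) \<Longrightarrow> poly_bounded a f"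
  by (auto simp: poly_bounded_def)

lemma poly_bounded_mono:
  assumes "poly_bounded a f" "a \<le> b"
  shows "poly_bounded b f"
  using assms(1)
proof (rule poly_boundedE)
  fix C assume C: "0 \<le> C" "\<And>x. norm (f x) \<le> C * (1 + norm x) powr a"
  show ?thesis
    by (rule poly_boundedI[of _ C], rule order_trans[OF C(2)])
      (use C assms(2) in \<open>auto intro!: mult_left_mono powr_mono\<close>)
qed

lemma poly_bounded_add:
  assumes "poly_bounded a f" "poly_bounded a g"
  shows "poly_bounded a (\<lambda>x. f x + g x)"
proof -
  obtain C D where "\<And>x. norm (f x) \<le> C * (1 + norm x) powr a" "\<And>x. norm (g x) \<le> D * (1 + norm x) powr a"
    using assms by (auto simp: poly_bounded_def)
  then show ?thesis
    by (intro poly_boundedI[of _ "C + D"])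
      (auto simp: algebra_simps intro!: norm_triangle_le add_mono)
qed

lemma poly_bounded_mult:
  fixes f g :: "'a::real_normed_vector \<Rightarrow> 'b::real_normed_algebra"
  assumes "poly_bounded a f" "poly_bounded b g"
  shows "poly_bounded (a + b) (\<lambda>x. f x * g x)"
  using assms(1)
proof (rule poly_boundedE)
  fix C assume C: "0 \<le> C" "\<And>x. norm (f x) \<le> C * (1 + norm x) powr a"
  show ?thesis using assms(2)
  proof (rule poly_boundedE)
    fix D assume D: "0 \<le> D" "\<And>x. norm (g x) \<le> D * (1 + norm x) powr b"
    have "norm (f x * g x) \<le> (C * (1 + norm x) powr a) * (D * (1 + norm x) powr b)" for x
      by (rule order_trans[OF norm_mult_ineq mult_mono]) (use C D in auto)
    then show ?thesis
      by (intro poly_boundedI[of _ "C * D"]) (simp add: powr_add mult_ac)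
  qed
qed

lemma poly_bounded_const: "poly_bounded 0 (\<lambda>x. c)"
  by (rule poly_boundedI[of _ "norm c"]) (auto simp: add_nonneg_eq_0_iff)

lemma poly_bounded_zero: "poly_bounded a (\<lambda>x. 0)"
  by (rule poly_boundedI[of _ 0]) auto

lemma poly_bounded_cmult:
  fixes f :: "'a::real_normed_vector \<Rightarrow> 'b::real_normed_algebra"
  shows "poly_bounded a f \<Longrightarrow> poly_bounded a (\<lambda>x. c * f x)"
  using poly_bounded_mult[OF poly_bounded_const] by fastforce

lemma poly_bounded_sum_list:
  "(\<And>p. p \<in> set ps \<Longrightarrow> poly_bounded a (F p)) \<Longrightarrow> poly_bounded a (\<lambda>x. \<Sum>p\<leftarrow>ps. F p x)"
  by (induction ps) (auto intro!: poly_bounded_add poly_bounded_zero)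

text \<open>Peetre's inequality. It comes from \<open>1 + |y + v| \<le> (1 + |y|) (1 + |v|)\<close>;
  for negative \<open>a\<close> this is applied to \<open>x + w\<close> and \<open>- w\<close>,
  which reverses the roles of \<open>x\<close> and \<open>x + w\<close>.\<close>

lemma powr_norm_add_le:
  "(1 + norm (x + w)) powr a \<le> (1 + norm x) powr a * (1 + norm w) powr \<bar>a\<bar>"
proof -
  have le: "1 + norm (y + v) \<le> (1 + norm y) * (1 + norm v)" for y v :: 'a
  proof -
    have "norm (y + v) \<le> norm y + norm v" "0 \<le> norm y * norm v"
      by (auto simp: norm_triangle_ineq)
    then show ?thesis unfolding distrib_left distrib_right by linarith
  qed
  show ?thesis
  proof (cases "0 \<le> a")
    case True
    then show ?thesis
      using powr_mono2[OF True _ le[of x w]] by (simp add: powr_mult)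
  next
    case False
    have "((1 + norm (x + w)) * (1 + norm w)) powr a \<le> (1 + norm x) powr a"
      using le[of "x + w" "- w"] False by (intro powr_mono2') (auto simp: add_pos_nonneg)
    then have "(1 + norm (x + w)) powr a * (1 + norm w) powr a \<le> (1 + norm x) powr a"
      by (simp add: powr_mult)
    moreover have "(1 + norm w) powr \<bar>a\<bar> = inverse ((1 + norm w) powr a)" "0 < (1 + norm w) powr a"
      using False by (auto simp flip: powr_minus)
    ultimately show ?thesis
      by (simp only: divide_inverse[symmetric] pos_le_divide_eq)
  qed
qed

lemma one_plus_norm_powr_mono: "norm w \<le> norm v \<Longrightarrow> (1 + norm w) powr \<bar>a\<bar> \<le> (1 + norm v) powr \<bar>a\<bar>"
  by (intro powr_mono2) auto

lemma onorm_coordinates: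
  "onorm (\<lambda>v :: real ^ 'n::finite. \<Sum>i\<in>UNIV. (v $ i) *\<^sub>R (p i :: 'b::real_normed_vector)) \<le> (\<Sum>i\<in>UNIV. norm (p i))"
proof (rule onorm_le)
  fix v :: "real ^ 'n"
  have "norm (\<Sum>i\<in>UNIV. (v $ i) *\<^sub>R p i) \<le> (\<Sum>i\<in>UNIV. norm (p i) * norm v)"
    by (intro sum_norm_le) (auto simp: mult.commute[of "norm (p _)"] intro!: mult_right_mono component_le_norm_cart)
  then show "norm (\<Sum>i\<in>UNIV. (v $ i) *\<^sub>R p i) \<le> (\<Sum>i\<in>UNIV. norm (p i)) * norm v"
    by (simp add: sum_distrib_right)
qed

lemma closed_segment_plusE:
  assumes "y \<in> closed_segment x (x + v)"
  obtains w where "y = x + w" "norm w \<le> norm v"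
proof -
  obtain t where "0 \<le> t" "t \<le> 1" "y = (1 - t) *\<^sub>R x + t *\<^sub>R (x + v)"
    using assms by (auto simp: closed_segment_def)
  then show ?thesis
    by (intro that[of "t *\<^sub>R v"]) (auto simp: algebra_simps mult_left_le_one_le)
qed

text \<open>The mean value inequality on the segment from \<open>x\<close> to \<open>x + v\<close>.
  Peetre's inequality moves the weight from the intermediate point to \<open>x\<close> at the cost
  of \<open>(1 + |v|)^|a|\<close>; \<open>CARD('n)\<close> arises from bounding an operator norm by
  the sum over the partial derivatives.\<close>

lemma norm_diff_le_partial:
  fixes g :: "'n::finite cfun" and c :: real
  assumes g: "\<And>y. g differentiable at y"
    and B: "\<And>j y. norm (partial j g y) \<le> c * (1 + norm y) powr a"
  shows "norm (g (x + v) - g x) \<le> CARD('n) * c * (1 + norm x) powr a * (1 + norm v) powr \<bar>a\<bar> * norm v"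
proof -
  \<comment> \<open>The index is arbitrary, and at the origin the weight equals 1.\<close>
  have "0 \<le> c"
    using order_trans[OF norm_ge_zero B[of undefined 0]] by simp
  have "onorm (\<lambda>v. \<Sum>i\<in>UNIV. (v $ i) *\<^sub>R partial i g y) \<le> CARD('n) * (c * ((1 + norm x) powr a * (1 + norm v) powr \<bar>a\<bar>))"
    if "y \<in> closed_segment x (x + v)" for y
    using that
  proof (rule closed_segment_plusE)
    fix w assume w: "y = x + w" "norm w \<le> norm v"
    have "norm (partial i g y) \<le> c * ((1 + norm x) powr a * (1 + norm v) powr \<bar>a\<bar>)" for i
    proof -
      have "(1 + norm y) powr a \<le> (1 + norm x) powr a * (1 + norm w) powr \<bar>a\<bar>"
        unfolding w(1) by (rule powr_norm_add_le)
      also have "\<dots> \<le> (1 + norm x) powr a * (1 + norm v) powr \<bar>a\<bar>"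
        using w by (intro mult_left_mono one_plus_norm_powr_mono) auto
      finally show ?thesis
        using B[of i y] \<open>0 \<le> c\<close> by (meson mult_left_mono order_trans)
    qed
    then have "(\<Sum>i\<in>UNIV. norm (partial i g y)) \<le> CARD('n) * (c * ((1 + norm x) powr a * (1 + norm v) powr \<bar>a\<bar>))"
      by (rule sum_bounded_above)
    then show ?thesis
      by (rule order_trans[OF onorm_coordinates])
  qed
  moreover have "(g has_derivative (\<lambda>v. \<Sum>i\<in>UNIV. (v $ i) *\<^sub>R partial i g y)) (at y within closed_segment x (x + v))" for y
    by (rule has_derivative_at_withinI[OF has_derivative_partial[OF g(1)]])
  ultimately have "norm (g (x + v) - g x) \<le> CARD('n) * (c * ((1 + norm x) powr a * (1 + norm v) powr \<bar>a\<bar>)) * norm ((x + v) - x)"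
    by (intro differentiable_bound[where S="closed_segment x (x + v)"]) auto
  then show ?thesis by (simp add: mult_ac)
qed

text \<open>First-order Taylor remainder: the mean value estimate applied to each first derivative
  yields one factor \<open>CARD('n) * norm v\<close>, and the linearized mean value inequality
  yields the second.\<close>

lemma norm_remainder_le_partial:
  fixes g :: "'n::finite cfun" and c :: real
  assumes g: "\<And>y. g differentiable at y" "\<And>i y. partial i g differentiable at y"
    and B: "\<And>i j y. norm (partial j (partial i g) y) \<le> c * (1 + norm y) powr a"
  shows "norm (g (x + v) - g x - (\<Sum>i\<in>UNIV. (v $ i) *\<^sub>R partial i g x))
    \<le> CARD('n)\<^sup>2 * c * (1 + norm x) powr a * (1 + norm v) powr \<bar>a\<bar> * (norm v)\<^sup>2"
proof -
  define D where "D y v = (\<Sum>i\<in>UNIV. (v $ i) *\<^sub>R partial i g y)" for y and v :: "real ^ 'n"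
  let ?K = "CARD('n) * c * (1 + norm x) powr a * (1 + norm v) powr \<bar>a\<bar> * norm v"
  have "0 \<le> c"
    using order_trans[OF norm_ge_zero B[of undefined undefined 0]] by simp
  have O: "onorm (D y - D x) \<le> CARD('n) * ?K"
    if "y \<in> closed_segment x (x + v)" for y
    using that
  proof (rule closed_segment_plusE)
    fix w assume w: "y = x + w" "norm w \<le> norm v"
    have "norm (partial i g y - partial i g x) \<le> ?K" for i
    proof -
      have "norm (partial i g y - partial i g x) \<le> CARD('n) * c * (1 + norm x) powr a * (1 + norm w) powr \<bar>a\<bar> * norm w"
        unfolding w(1) using g B by (intro norm_diff_le_partial) auto
      also have "\<dots> \<le> ?K"
        using w \<open>0 \<le> c\<close> by (intro mult_mono mult_left_mono one_plus_norm_powr_mono) auto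
      finally show ?thesis .
    qed
    then have "(\<Sum>i\<in>UNIV. norm (partial i g y - partial i g x)) \<le> CARD('n) * ?K"
      by (rule sum_bounded_above)
    then have "onorm (\<lambda>v :: real ^ 'n. \<Sum>i\<in>UNIV. (v $ i) *\<^sub>R (partial i g y - partial i g x)) \<le> CARD('n) * ?K"
      by (rule order_trans[OF onorm_coordinates])
    moreover have "D y - D x = (\<lambda>v. \<Sum>i\<in>UNIV. (v $ i) *\<^sub>R (partial i g y - partial i g x))"
      by (auto simp: D_def scaleR_diff_right sum_subtractf)
    ultimately show ?thesis by simp
  qed
  have "norm (g (x + v) - g x - D x ((x + v) - x)) \<le> norm ((x + v) - x) * (CARD('n) * ?K)"
  proof (rule differentiable_bound_linearization[where S="closed_segment x (x + v)"])
    show "x + t *\<^sub>R (x + v - x) \<in> closed_segment x (x + v)" if "t \<in> {0..1}" for t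
      using that by (auto simp: closed_segment_def algebra_simps intro!: exI[of _ t])
    show "(g has_derivative D y) (at y within closed_segment x (x + v))" for y
      unfolding D_def by (rule has_derivative_at_withinI[OF has_derivative_partial[OF g(1)]])
  qed (use O in auto)
  then show ?thesis
    by (simp add: D_def power2_eq_square mult_ac)
qed

section \<open>Schwartz functions and slowly increasing functions\<close>

lemma schwartz_iff:
  "\<phi> \<in> schwartz \<longleftrightarrow> smooth \<phi> \<and> (\<forall>a js. poly_bounded a (iter_partial js \<phi>))"
proof -
  have "poly_bounded a (iter_partial js \<phi>)" if "\<phi> \<in> schwartz" for a js
  proof -
    obtain C where C: "\<And>x. (1 + norm x) ^ nat \<lceil>-a\<rceil> * norm (iter_partial js \<phi> x) \<le> C"
      using \<open>\<phi> \<in> schwartz\<close> unfolding schwartz_def by blast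
    \<comment> \<open>The real exponent is rounded to a natural power of the weight; for nonnegative
      \<open>a\<close> this power is 0, and boundedness suffices.\<close>
    have "poly_bounded (- real (nat \<lceil>-a\<rceil>)) (iter_partial js \<phi>)"
    proof (rule poly_boundedI[of _ C])
      fix x :: "real ^ 'a"
      have "0 < (1 + norm x)" by (simp add: add_pos_nonneg)
      then show "norm (iter_partial js \<phi> x) \<le> C * (1 + norm x) powr - real (nat \<lceil>-a\<rceil>)"
        using C[of x] by (simp add: powr_minus powr_realpow field_simps)
    qed
    then show ?thesis by (rule poly_bounded_mono) linarith
  qed
  moreover have "\<exists>C. \<forall>x. (1 + norm x) ^ m * norm (iter_partial js \<phi> x) \<le> C"
    if *: "poly_bounded (- real m) (iter_partial js \<phi>)" for m js
  proof -
    obtain C where C: "\<And>x. norm (iter_partial js \<phi> x) \<le> C * (1 + norm x) powr (- real m)"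
      using * by (auto simp: poly_bounded_def)
    have "(1 + norm x) ^ m * norm (iter_partial js \<phi> x) \<le> C" for x
    proof -
      have "0 < (1 + norm x)" by (simp add: add_pos_nonneg)
      then show ?thesis using C[of x] by (simp add: powr_minus powr_realpow field_simps)
    qed
    then show ?thesis by auto
  qed
  ultimately show ?thesis by (auto simp: schwartz_def)
qed

text \<open>The two weights are comparable:
  \<open>1 + |x|^2 \<le> (1 + |x|)^2 \<le> 2 (1 + |x|^2)\<close>.\<close>

lemma slowly_increasing_iff:
  "f \<in> slowly_increasing \<longleftrightarrow> smooth f \<and> (\<forall>js. \<exists>a. poly_bounded a (iter_partial js f))"
proof -
  have "\<exists>a. poly_bounded a g" if "a > 0" "c > 0" "\<forall>x. norm (g x) \<le> c * (1 + (norm x)\<^sup>2) powr (a / 2)"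
    for a c and g :: "'a cfun"
  proof -
    have "(1 + (norm x)\<^sup>2) powr (a / 2) \<le> (1 + norm x) powr a" for x :: "real ^ 'a"
    proof -
      have "(1 + (norm x)\<^sup>2) powr (a / 2) \<le> ((1 + norm x)\<^sup>2) powr (a / 2)"
        using \<open>a > 0\<close> by (intro powr_mono2) (auto simp: power2_eq_square algebra_simps add_nonneg_nonneg)
      also have "((1 + norm x)\<^sup>2) powr (a / 2) = (1 + norm x) powr a"
        by (simp add: powr_realpow[symmetric] add_pos_nonneg powr_powr del: powr_numeral)
      finally show ?thesis .
    qed
    then have "norm (g x) \<le> c * (1 + norm x) powr a" for x
      using that by (meson less_imp_le mult_left_mono order_trans)
    then show ?thesis using poly_boundedI by blast
  qed
  moreover have "\<exists>a>0. \<exists>c>0. \<forall>x. norm (g x) \<le> c * (1 + (norm x)\<^sup>2) powr (a / 2)"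
    if "poly_bounded a g" for a and g :: "'a cfun"
  proof -
    \<comment> \<open>The definition asks for a positive exponent and a positive constant; hence the
      added 1 here and the constant \<open>C + 1\<close> further down.\<close>
    define b where "b = \<bar>a\<bar> + 1"
    have "poly_bounded b g" using that by (rule poly_bounded_mono) (simp add: b_def)
    then obtain C where C: "0 \<le> C" "\<And>x. norm (g x) \<le> C * (1 + norm x) powr b"
      using poly_boundedE by blast
    have "b > 0" by (simp add: b_def add_nonneg_pos)
    have le: "(1 + norm x) powr b \<le> 2 powr (b / 2) * (1 + (norm x)\<^sup>2) powr (b / 2)" for x :: "real ^ 'a"
    proof -
      have "(1 + norm x) powr b = ((1 + norm x)\<^sup>2) powr (b / 2)"
        by (simp add: powr_realpow[symmetric] add_pos_nonneg powr_powr del: powr_numeral)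
      also have "\<dots> \<le> (2 * (1 + (norm x)\<^sup>2)) powr (b / 2)"
        using \<open>b > 0\<close> sum_squares_bound[of 1 "norm x"]
        by (intro powr_mono2) (auto simp: power2_eq_square algebra_simps)
      finally show ?thesis by (simp only: powr_mult)
    qed
    have "norm (g x) \<le> (C + 1) * 2 powr (b / 2) * (1 + (norm x)\<^sup>2) powr (b / 2)" for x
    proof -
      have "norm (g x) \<le> (C + 1) * (1 + norm x) powr b"
        by (rule order_trans[OF C(2)]) auto
      also have "\<dots> \<le> (C + 1) * (2 powr (b / 2) * (1 + (norm x)\<^sup>2) powr (b / 2))"
        using C le by (intro mult_left_mono) auto
      finally show ?thesis by simp
    qed
    moreover have "(C + 1) * 2 powr (b / 2) > 0" using C by simp
    ultimately show ?thesis using \<open>b > 0\<close> by blast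
  qed
  ultimately show ?thesis
    unfolding slowly_increasing_def by blast
qed

lemma schwartz_smooth: "\<phi> \<in> schwartz \<Longrightarrow> smooth \<phi>"
  by (simp add: schwartz_iff)

lemma slowly_increasing_smooth: "\<phi> \<in> slowly_increasing \<Longrightarrow> smooth \<phi>"
  by (simp add: slowly_increasing_iff)

lemma schwartz_poly_bounded: "\<phi> \<in> schwartz \<Longrightarrow> poly_bounded a \<phi>"
  by (metis iter_partial.simps(1) schwartz_iff)

lemma schwartz_imp_slowly_increasing: "\<phi> \<in> schwartz \<Longrightarrow> \<phi> \<in> slowly_increasing"
  by (auto simp: schwartz_iff slowly_increasing_iff)

lemma schwartz_iter_partial: "\<phi> \<in> schwartz \<Longrightarrow> iter_partial js \<phi> \<in> schwartz"
  by (auto simp: schwartz_iff smooth_iter_partial simp flip: iter_partial_append)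

lemma slowly_increasing_iter_partial: "\<phi> \<in> slowly_increasing \<Longrightarrow> iter_partial js \<phi> \<in> slowly_increasing"
  by (auto simp: slowly_increasing_iff smooth_iter_partial simp flip: iter_partial_append)

lemma schwartz_add: "\<phi> \<in> schwartz \<Longrightarrow> \<eta> \<in> schwartz \<Longrightarrow> (\<lambda>x. \<phi> x + \<eta> x) \<in> schwartz"
  by (simp add: schwartz_iff smooth_add iter_partial_add poly_bounded_add)

lemma schwartz_cmult: "\<phi> \<in> schwartz \<Longrightarrow> (\<lambda>x. c * \<phi> x) \<in> schwartz"
  by (simp add: schwartz_iff smooth_cmult iter_partial_cmult poly_bounded_cmult)

lemma schwartz_diff: "\<phi> \<in> schwartz \<Longrightarrow> \<eta> \<in> schwartz \<Longrightarrow> (\<lambda>x. \<phi> x - \<eta> x) \<in> schwartz"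
  using schwartz_add[OF _ schwartz_cmult[of \<eta> "-1"], of \<phi>] by simp

lemma schwartz_sum:
  "finite I \<Longrightarrow> (\<And>i. i \<in> I \<Longrightarrow> F i \<in> schwartz) \<Longrightarrow> (\<lambda>x. \<Sum>i\<in>I. F i x) \<in> schwartz"
proof (induction I rule: finite_induct)
  case empty
  show ?case
    by (simp add: schwartz_iff smooth_const iter_partial_const if_distrib poly_bounded_zero cong: if_cong)
qed (simp add: schwartz_add)

text \<open>In each Leibniz summand the growth \<open>b\<close> of the derivative of
  \<open>f\<close> is paid for by the decay \<open>a - b\<close> of the derivative of \<phi>, which
  is available for every exponent.\<close>

lemma schwartz_mult_slowly_increasing:
  assumes f: "f \<in> slowly_increasing" and \<phi>: "\<phi> \<in> schwartz"
  shows "(\<lambda>x. f x * \<phi> x) \<in> schwartz"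
proof -
  have "poly_bounded a (\<lambda>x. iter_partial js f x * iter_partial ks \<phi> x)" for a js ks
  proof -
    obtain b where "poly_bounded b (iter_partial js f)"
      using f by (auto simp: slowly_increasing_iff)
    then show ?thesis
      using poly_bounded_mult[of b "iter_partial js f" "a - b" "iter_partial ks \<phi>"] \<phi>
      by (simp add: schwartz_iff)
  qed
  then show ?thesis
    using f \<phi> by (auto simp: schwartz_iff slowly_increasing_iff smooth_mult iter_partial_mult
        intro!: poly_bounded_sum_list)
qed

lemma slowly_increasing_coord: "(\<lambda>x. complex_of_real (x $ i)) \<in> slowly_increasing"
proof -
  have "poly_bounded 1 (\<lambda>x :: real ^ 'a. complex_of_real (x $ i))"
    by (rule poly_boundedI[of _ 1]) (use component_le_norm_cart[of _ i] in \<open>auto intro: add_increasing\<close>)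
  then have "\<exists>a. poly_bounded a (iter_partial js (\<lambda>x :: real ^ 'a. complex_of_real (x $ i)))" for js
    using poly_bounded_const
    by (cases js) (auto simp: iter_partial_coord split: list.split)
  then show ?thesis by (simp add: slowly_increasing_iff smooth_coord)
qed

lemma slowly_increasing_expi: "(\<lambda>\<xi>. exp (\<i> * of_real (y \<bullet> \<xi>))) \<in> slowly_increasing"
proof -
  have "poly_bounded 0 (\<lambda>\<xi>. exp (\<i> * of_real (y \<bullet> \<xi>)))"
    by (rule poly_boundedI[of _ 1]) (auto simp: add_nonneg_eq_0_iff)
  then have "poly_bounded 0 (iter_partial js (\<lambda>\<xi>. exp (\<i> * of_real (y \<bullet> \<xi>))))" for js
    unfolding iter_partial_expi by (rule poly_bounded_cmult)
  then show ?thesis by (auto simp add: slowly_increasing_iff smooth_expi)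
qed

section \<open>Test functions and affine substitutions in Schwartz functions\<close>

lemma test_functions_smooth: "\<phi> \<in> test_functions \<Longrightarrow> smooth \<phi>"
  by (simp add: test_functions_def)

lemma test_functionsI:
  assumes "smooth \<phi>" "compact K" "\<And>x. x \<notin> K \<Longrightarrow> \<phi> x = 0"
  shows "\<phi> \<in> test_functions"
proof -
  have "closure {x. \<phi> x \<noteq> 0} \<subseteq> K"
    using assms by (intro closure_minimal compact_imp_closed) auto
  then show ?thesis
    using assms compact_Int_closed[of K "closure {x. \<phi> x \<noteq> 0}"]
    by (auto simp: test_functions_def Int_absorb1)
qed

lemma test_functions_compact_support: "\<phi> \<in> test_functions \<Longrightarrow> compact (closure {x. \<phi> x \<noteq> 0})"
  by (simp add: test_functions_def)

lemma iter_partial_outside_support: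
  assumes "x \<notin> closure {x. \<phi> x \<noteq> 0}"
  shows "iter_partial js \<phi> x = 0"
proof (rule iter_partial_eq_0[OF closed_closure _ assms])
  show "\<phi> y = 0" if "y \<notin> closure {x. \<phi> x \<noteq> 0}" for y
    using that closure_subset[of "{x. \<phi> x \<noteq> 0}"] by blast
qed

lemma test_functions_mult:
  assumes "smooth g" "\<phi> \<in> test_functions"
  shows "(\<lambda>x. g x * \<phi> x) \<in> test_functions"
proof (rule test_functionsI)
  show "compact (closure {x. \<phi> x \<noteq> 0})"
    using assms(2) by (rule test_functions_compact_support)
  show "smooth (\<lambda>x. g x * \<phi> x)"
    by (rule smooth_mult[OF assms(1) test_functions_smooth[OF assms(2)]])
  show "g x * \<phi> x = 0" if "x \<notin> closure {x. \<phi> x \<noteq> 0}" for x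
    using iter_partial_outside_support[OF that, of "[]"] by simp
qed

lemma test_functions_in_schwartz:
  assumes "\<phi> \<in> test_functions"
  shows "\<phi> \<in> schwartz"
proof -
  let ?K = "closure {x. \<phi> x \<noteq> 0}"
  have "poly_bounded a (iter_partial js \<phi>)" for a js
  proof -
    have "compact ((\<lambda>x. norm (iter_partial js \<phi> x) / (1 + norm x) powr a) ` ?K)"
      using assms test_functions_compact_support[OF assms]
      by (intro compact_continuous_image continuous_intros smooth_continuous_on smooth_iter_partial test_functions_smooth)
        (auto simp: add_nonneg_eq_0_iff)
    then obtain C where C: "\<And>x. x \<in> ?K \<Longrightarrow> norm (iter_partial js \<phi> x) / (1 + norm x) powr a \<le> C"
      by (meson bdd_above.E bounded_imp_bdd_above compact_imp_bounded image_eqI)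
    have "norm (iter_partial js \<phi> x) \<le> \<bar>C\<bar> * (1 + norm x) powr a" for x
    proof (cases "x \<in> ?K")
      case True
      have "norm (iter_partial js \<phi> x) \<le> C * (1 + norm x) powr a"
        using C[OF True] by (simp add: pos_divide_le_eq)
      also have "\<dots> \<le> \<bar>C\<bar> * (1 + norm x) powr a" by (rule mult_right_mono) auto
      finally show ?thesis .
    next
      case False
      from iter_partial_outside_support[OF this, of js] show ?thesis by simp
    qed
    then show ?thesis by (rule poly_boundedI)
  qed
  then show ?thesis using assms by (simp add: schwartz_iff test_functions_smooth)
qed

lemma schwartz_affine:
  fixes \<phi> :: "'n::finite cfun"
  assumes \<phi>: "\<phi> \<in> schwartz" and d: "\<And>i. d i \<noteq> 0"
  shows "(\<lambda>x. \<phi> (t + (\<chi> i. d i * x $ i))) \<in> schwartz"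
proof -
  define A where "A x = (\<chi> i. d i * x $ i)" for x :: "real ^ 'n"
  define c where "c = (\<Sum>i\<in>UNIV. 1 / \<bar>d i\<bar>)"
  have c: "0 \<le> c" by (simp add: c_def sum_nonneg)
  have le: "norm x \<le> c * norm (A x)" for x
  proof -
    have "norm x \<le> (\<Sum>i\<in>UNIV. \<bar>x $ i\<bar>)" by (rule norm_le_l1_cart)
    also have "\<dots> = (\<Sum>i\<in>UNIV. 1 / \<bar>d i\<bar> * \<bar>A x $ i\<bar>)"
      using d by (simp add: A_def abs_mult)
    also have "\<dots> \<le> (\<Sum>i\<in>UNIV. 1 / \<bar>d i\<bar> * norm (A x))"
      by (intro sum_mono mult_left_mono component_le_norm_cart) auto
    finally show ?thesis by (simp add: c_def sum_distrib_right)
  qed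
  \<comment> \<open>Here \<open>c\<close> bounds the inverse of the diagonal map, and
    \<open>c * norm t\<close> compensates the translation.\<close>
  define C where "C = 1 + c + c * norm t"
  have "C > 0" using c by (simp add: C_def add_pos_nonneg)
  have le': "1 + norm x \<le> C * (1 + norm (t + A x))" for x
  proof -
    have "norm (A x) \<le> norm (t + A x) + norm t"
      using norm_triangle_ineq4[of "t + A x" t] by simp
    then have "norm x \<le> c * (norm (t + A x) + norm t)"
      using le[of x] c by (meson mult_left_mono order_trans)
    moreover have "C * (1 + norm (t + A x)) =
        1 + norm (t + A x) + c + c * (norm (t + A x) + norm t) + c * norm t * norm (t + A x)"
      by (simp add: C_def algebra_simps)
    moreover have "0 \<le> c * norm t * norm (t + A x)" "0 \<le> norm (t + A x)" using c by auto
    ultimately show ?thesis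
      using c by linarith
  qed
  have pb: "poly_bounded a (\<lambda>x. g (t + A x))" if g: "\<And>a. poly_bounded a g" for a and g :: "'n cfun"
  proof -
    \<comment> \<open>The comparison bounds \<open>1 + |x|\<close> from above, so it helps only
      after raising it to a nonpositive power; a positive \<open>a\<close> is then reached by
      monotonicity.\<close>
    define b where "b = min a 0"
    obtain D where D: "0 \<le> D" "\<And>x. norm (g x) \<le> D * (1 + norm x) powr b"
      using poly_boundedE[OF g] by blast
    have "(1 + norm (t + A x)) powr b \<le> C powr (-b) * (1 + norm x) powr b" for x
    proof -
      have "(C * (1 + norm (t + A x))) powr b \<le> (1 + norm x) powr b"
        using le'[of x] by (intro powr_mono2') (auto simp: b_def)
      then have "C powr b * (1 + norm (t + A x)) powr b \<le> (1 + norm x) powr b"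
        using \<open>C > 0\<close> by (simp add: powr_mult)
      then show ?thesis
        using \<open>C > 0\<close> by (simp add: powr_minus field_simps)
    qed
    from mult_left_mono[OF this D(1)] have "norm (g (t + A x)) \<le> (D * C powr (-b)) * (1 + norm x) powr b" for x
      by (intro order_trans[OF D(2)]) (simp only: mult.assoc)
    then have "poly_bounded b (\<lambda>x. g (t + A x))" by (rule poly_boundedI)
    then show ?thesis by (rule poly_bounded_mono) (simp add: b_def)
  qed
  show ?thesis
    using \<phi> pb unfolding A_def
    by (auto simp: schwartz_iff smooth_affine iter_partial_affine intro!: poly_bounded_cmult)
qed

subsection \<open>Integration on \<open>real ^ 'n\<close>\<close>

text \<open>\<open>lborel\<close> is the image of a product measure indexed by \<open>Basis\<close>,
  for which the product formula holds; \<open>axis\<close> carries the index type to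
  \<open>Basis\<close>.\<close>

lemma
  fixes F :: "'n::finite \<Rightarrow> real \<Rightarrow> complex"
  assumes F: "\<And>i. integrable lborel (F i)"
  shows integrable_prod_coord: "integrable lborel (\<lambda>x :: real ^ 'n. \<Prod>i\<in>UNIV. F i (x $ i))"
    and integral_prod_coord: "(LINT x|lborel. (\<Prod>i\<in>UNIV. F i ((x :: real ^ 'n) $ i))) = (\<Prod>i\<in>UNIV. LINT t|lborel. F i t)"
proof -
  let ?B = "Basis :: (real ^ 'n) set"
  define G where "G b = F (axis_index b)" for b :: "real ^ 'n"
  interpret product_sigma_finite "\<lambda>b :: real ^ 'n. lborel :: real measure" ..
  have bij: "bij_betw (\<lambda>i. axis i 1) UNIV ?B"
    by (auto simp: bij_betw_def inj_on_def axis_eq_axis Basis_vec_def)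
  have eq: "(\<Prod>i\<in>UNIV. F i (x $ i)) = (\<Prod>b\<in>?B. G b (x \<bullet> b))" for x :: "real ^ 'n"
    by (subst prod.reindex_bij_betw[OF bij, symmetric]) (simp add: G_def inner_axis axis_index_axis)
  have eq': "(\<Prod>i\<in>UNIV. LINT t|lborel. F i t) = (\<Prod>b\<in>?B. LINT t|lborel. G b t)"
    by (subst prod.reindex_bij_betw[OF bij, symmetric]) (simp add: G_def axis_index_axis)
  have G: "integrable lborel (G b)" for b
    by (simp add: G_def F)
  note [measurable] = borel_measurable_integrable[OF G]
  have sum: "(\<Sum>b\<in>?B. f b *\<^sub>R b) \<bullet> c = f c" if "c \<in> ?B" for f c
    using that by (simp add: inner_sum_left_Basis)
  have I: "integrable (\<Pi>\<^sub>M b\<in>?B. lborel) (\<lambda>f. \<Prod>b\<in>?B. G b (f b))"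
    by (intro product_integrable_prod G) auto
  have M: "(\<lambda>f. \<Sum>b\<in>?B. f b *\<^sub>R b) \<in> (\<Pi>\<^sub>M b\<in>?B. lborel) \<rightarrow>\<^sub>M borel"
    by measurable
  have M': "(\<lambda>x :: real ^ 'n. \<Prod>b\<in>?B. G b (x \<bullet> b)) \<in> borel_measurable borel"
    by measurable
  show "integrable lborel (\<lambda>x :: real ^ 'n. \<Prod>i\<in>UNIV. F i (x $ i))"
    unfolding eq
    by (subst lborel_eq, subst integrable_distr_eq[OF M M'])
      (use I in \<open>simp add: sum cong: prod.cong\<close>)
  show "(LINT x|lborel. (\<Prod>i\<in>UNIV. F i ((x :: real ^ 'n) $ i))) = (\<Prod>i\<in>UNIV. LINT t|lborel. F i t)"
    unfolding eq eq'
    by (subst lborel_eq, subst integral_distr[OF M M'])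
      (simp add: sum product_integral_prod[OF _ G] cong: prod.cong)
qed

text \<open>The exponent allots two powers to each coordinate: the weight is dominated by the
  product of the one-dimensional functions \<open>1 / (1 + (x $ i)^2)\<close>, which is integrable
  by the product formula.\<close>

lemma integrable_one_plus_norm_powr:
  assumes "a \<le> - 2 * real CARD('n)"
  shows "integrable lborel (\<lambda>x :: real ^ 'n::finite. (1 + norm x) powr a)"
proof -
  have "set_integrable lborel (einterval (-\<infinity>) \<infinity>) (\<lambda>x. inverse (1 + x\<^sup>2))"
    using integrable_inverse_1_plus_square by simp
  then have "integrable lborel (\<lambda>t::real. inverse (1 + t\<^sup>2))"
    by (simp add: set_integrable_def)
  then have "integrable lborel (\<lambda>t. complex_of_real (inverse (1 + t\<^sup>2)))"
    by (rule integrable_of_real)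
  then have I: "integrable lborel (\<lambda>x :: real ^ 'n. \<Prod>i\<in>UNIV. complex_of_real (inverse (1 + (x $ i)\<^sup>2)))"
    by (rule integrable_prod_coord)
  have le: "(1 + norm x) powr a \<le> (\<Prod>i\<in>UNIV. inverse (1 + (x $ i)\<^sup>2))" for x :: "real ^ 'n"
  proof -
    have "(1 + norm x) powr a \<le> (1 + norm x) powr (- real (2 * CARD('n)))"
      using assms by (intro powr_mono) auto
    also have "\<dots> = inverse ((1 + norm x) ^ (2 * CARD('n)))"
      by (subst powr_minus, subst powr_realpow) (auto simp: add_pos_nonneg)
    also have "\<dots> = (\<Prod>i\<in>(UNIV :: 'n set). inverse ((1 + norm x)\<^sup>2))"
      by (simp add: power_mult power_inverse)
    also have "\<dots> \<le> (\<Prod>i\<in>UNIV. inverse (1 + (x $ i)\<^sup>2))"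
    proof (intro prod_mono conjI)
      fix i
      have "(x $ i)\<^sup>2 \<le> (norm x)\<^sup>2"
        using component_le_norm_cart[of x i] by (simp add: power2_le_iff_abs_le)
      then have "1 + (x $ i)\<^sup>2 \<le> (1 + norm x)\<^sup>2"
        by (simp add: power2_eq_square algebra_simps add_increasing2)
      then show "inverse ((1 + norm x)\<^sup>2) \<le> inverse (1 + (x $ i)\<^sup>2)"
        by (intro le_imp_inverse_le) (auto simp: add_pos_nonneg)
    qed auto
    finally show ?thesis .
  qed
  show ?thesis
  proof (rule Bochner_Integration.integrable_bound[OF I])
    show "AE x in lborel. norm ((1 + norm x) powr a) \<le> norm (\<Prod>i\<in>UNIV. complex_of_real (inverse (1 + ((x :: real ^ 'n) $ i)\<^sup>2)))"
      using le by (auto simp: prod_nonneg simp flip: of_real_prod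
          simp del: of_real_inverse of_real_add of_real_power)
  qed simp
qed

lemma integrable_poly_bounded:
  fixes g :: "'n::finite cfun"
  assumes "g \<in> borel_measurable borel" "poly_bounded a g" "a \<le> - 2 * real CARD('n)"
  shows "integrable lborel g"
  using assms(2)
proof (rule poly_boundedE)
  fix C assume "0 \<le> C" and C: "\<And>x. norm (g x) \<le> C * (1 + norm x) powr a"
  show ?thesis
    by (rule Bochner_Integration.integrable_bound[OF integrable_mult_right[OF integrable_one_plus_norm_powr[OF assms(3)], of C]])
      (use assms C \<open>0 \<le> C\<close> in \<open>auto simp: abs_mult\<close>)
qed

lemma schwartz_integrable: "\<phi> \<in> schwartz \<Longrightarrow> integrable lborel \<phi>"
  by (rule integrable_poly_bounded[OF _ schwartz_poly_bounded order_refl])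
    (auto intro: smooth_borel_measurable schwartz_smooth)

lemma schwartz_integrable_weighted:
  fixes \<phi> :: "'n::finite cfun"
  assumes "\<phi> \<in> schwartz"
  shows "integrable lborel (\<lambda>x. (1 + norm x) powr b * norm (\<phi> x))"
proof -
  have "poly_bounded b (\<lambda>x :: real ^ 'n. complex_of_real ((1 + norm x) powr b))"
    by (rule poly_boundedI[of _ 1]) auto
  then have "poly_bounded (- 2 * real CARD('n)) (\<lambda>x. complex_of_real ((1 + norm x) powr b) * \<phi> x)"
    using poly_bounded_mult[of b "\<lambda>x. complex_of_real ((1 + norm x) powr b)" "- 2 * real CARD('n) - b" \<phi>]
      schwartz_poly_bounded[OF assms]
    by auto
  then have "integrable lborel (\<lambda>x. complex_of_real ((1 + norm x) powr b) * \<phi> x)"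
    using smooth_borel_measurable[OF schwartz_smooth[OF assms]]
    by (intro integrable_poly_bounded[OF _ _ order_refl]) measurable
  from integrable_norm[OF this] show ?thesis by (simp add: norm_mult)
qed

lemma uniform_poly_bounded:
  assumes "finite J" "\<And>j. j \<in> J \<Longrightarrow> poly_bounded a (F j)"
  obtains C where "0 \<le> C" "\<And>j x. j \<in> J \<Longrightarrow> norm (F j x) \<le> C * (1 + norm x) powr a"
proof -
  have "\<forall>j\<in>J. \<exists>C\<ge>0. \<forall>x. norm (F j x) \<le> C * (1 + norm x) powr a"
    using poly_boundedE[OF assms(2)] by metis
  then obtain C where C: "\<And>j. j \<in> J \<Longrightarrow> 0 \<le> C j" "\<And>j x. j \<in> J \<Longrightarrow> norm (F j x) \<le> C j * (1 + norm x) powr a"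
    by metis
  show ?thesis
  proof
    show "0 \<le> sum C J" using C(1) by (rule sum_nonneg)
    fix j x assume j: "j \<in> J"
    have "norm (F j x) \<le> C j * (1 + norm x) powr a" using j by (rule C(2))
    also have "\<dots> \<le> sum C J * (1 + norm x) powr a"
      by (intro mult_right_mono member_le_sum) (use j C(1) assms(1) in auto)
    finally show "norm (F j x) \<le> sum C J * (1 + norm x) powr a" .
  qed
qed

lemma finite_multi_indices [simp]: "finite {js :: 'n::finite list. length js \<le> N}"
  using finite_lists_length_le[of "UNIV :: 'n set" N] by simp

lemma slowly_increasing_uniform:
  fixes f :: "'n::finite cfun"
  assumes "f \<in> slowly_increasing"
  obtains a C where "0 \<le> a" "0 \<le> C"
    "\<And>js x. length js \<le> N \<Longrightarrow> norm (iter_partial js f x) \<le> C * (1 + norm x) powr a"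
proof -
  let ?J = "{js :: 'n list. length js \<le> N}"
  obtain a where a: "\<And>js. poly_bounded (a js) (iter_partial js f)"
    using assms unfolding slowly_increasing_iff by metis
  have "poly_bounded (\<Sum>js\<in>?J. \<bar>a js\<bar>) (iter_partial js f)" if "js \<in> ?J" for js
    by (rule poly_bounded_mono[OF a], rule order_trans[OF abs_ge_self])
      (use that in \<open>auto intro!: member_le_sum[of js ?J "\<lambda>js. \<bar>a js\<bar>"]\<close>)
  then show ?thesis
  proof (rule uniform_poly_bounded[OF finite_multi_indices])
    fix C assume C: "0 \<le> C" and
      le: "\<And>js x. js \<in> ?J \<Longrightarrow> norm (iter_partial js f x) \<le> C * (1 + norm x) powr (\<Sum>js\<in>?J. \<bar>a js\<bar>)"
    show ?thesis
      by (rule that[OF _ C le]) (auto intro: sum_nonneg)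
  qed
qed

lemma schwartz_uniform:
  fixes \<phi> :: "'n::finite cfun"
  assumes "\<phi> \<in> schwartz"
  obtains C where "0 \<le> C" "\<And>js x. length js \<le> N \<Longrightarrow> norm (iter_partial js \<phi> x) \<le> C * (1 + norm x) powr a"
proof (rule uniform_poly_bounded[OF finite_multi_indices])
  show "poly_bounded a (iter_partial js \<phi>)" for js
    using assms by (simp add: schwartz_iff)
qed (rule that, auto)

lemma
  fixes g :: "'n::finite cfun" and d :: "'n \<Rightarrow> real"
  assumes g: "integrable lborel g" and d: "\<And>i. d i \<noteq> 0"
  shows integrable_affine: "integrable lborel (\<lambda>x. g (t + (\<chi> i. d i * x $ i)))"
    and integral_affine: "(LINT x|lborel. g x) = (\<Prod>i\<in>UNIV. \<bar>d i\<bar>) *\<^sub>R (LINT x|lborel. g (t + (\<chi> i. d i * x $ i)))"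
proof -
  let ?B = "Basis :: (real ^ 'n) set"
  define c where "c b = d (axis_index b)" for b :: "real ^ 'n"
  define T where "T x = t + (\<Sum>b\<in>?B. (c b * (x \<bullet> b)) *\<^sub>R b)" for x
  have bij: "bij_betw (\<lambda>i. axis i 1) UNIV ?B"
    by (auto simp: bij_betw_def inj_on_def axis_eq_axis Basis_vec_def)
  have T: "T x = t + (\<chi> i. d i * x $ i)" for x
    unfolding T_def
    by (subst sum.reindex_bij_betw[OF bij, symmetric], subst vec_eq_sum_axis[of "\<chi> i. d i * x $ i"])
      (simp add: c_def inner_axis axis_index_axis)
  have P: "(\<Prod>b\<in>?B. \<bar>c b\<bar>) = (\<Prod>i\<in>UNIV. \<bar>d i\<bar>)"
    by (subst prod.reindex_bij_betw[OF bij, symmetric]) (simp add: c_def axis_index_axis)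
  let ?p = "\<Prod>i\<in>UNIV. \<bar>d i\<bar>"
  have "0 < ?p" using d by (simp add: prod_pos)
  have [measurable]: "g \<in> borel_measurable borel" using borel_measurable_integrable[OF g] by simp
  have "(\<lambda>x. t + (\<Sum>b\<in>?B. (c b * (x \<bullet> b)) *\<^sub>R b)) \<in> lborel \<rightarrow>\<^sub>M borel"
    by measurable
  then have T_meas: "T \<in> lborel \<rightarrow>\<^sub>M borel"
    by (simp only: T_def[abs_def])
  have eq: "lborel = density (distr lborel borel T) (\<lambda>_. ennreal ?p)"
    using lborel_affine_euclidean[of c t] d unfolding T_def[abs_def] P by (simp add: c_def)
  have gm: "g \<in> borel_measurable (distr lborel borel T)" by simp
  have "integrable (density (distr lborel borel T) (\<lambda>_. ennreal ?p)) g"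
    using g eq by simp
  then have "integrable (distr lborel borel T) (\<lambda>x. ?p *\<^sub>R g x)"
    using \<open>0 < ?p\<close> by (subst (asm) integrable_density[OF gm]) auto
  then have I: "integrable lborel (\<lambda>x. ?p *\<^sub>R g (T x))"
    by (subst (asm) integrable_distr_eq[OF T_meas]) auto
  show "integrable lborel (\<lambda>x. g (t + (\<chi> i. d i * x $ i)))"
  proof -
    have "inverse ?p *\<^sub>R (?p *\<^sub>R g (T x)) = g (T x)" for x
      using \<open>0 < ?p\<close> by (simp only: scaleR_scaleR left_inverse less_imp_neq[symmetric] scaleR_one not_False_eq_True)
    then show ?thesis
      using integrable_scaleR_right[OF I, of "inverse ?p"] by (simp only: T)
  qed
  have "(LINT x|lborel. g x) = integral\<^sup>L (density (distr lborel borel T) (\<lambda>_. ennreal ?p)) g"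
    using eq by simp
  also have "\<dots> = integral\<^sup>L (distr lborel borel T) (\<lambda>x. ?p *\<^sub>R g x)"
    using \<open>0 < ?p\<close> by (subst integral_density[OF gm]) auto
  also have "\<dots> = (LINT x|lborel. ?p *\<^sub>R g (T x))"
    by (subst integral_distr[OF T_meas]) auto
  finally show "(LINT x|lborel. g x) = ?p *\<^sub>R (LINT x|lborel. g (t + (\<chi> i. d i * x $ i)))"
    by (simp add: T)
qed

text \<open>A quadratic remainder with an integrable constant can be integrated directly, and
  divided by \<open>norm v\<close> it still tends to 0. It is demanded only for
  \<open>norm v \<le> 1\<close>, so that weights depending on \<open>v\<close> stay bounded in the
  applications.\<close>

lemma has_derivative_integral:
  fixes F :: "real ^ 'n::finite \<Rightarrow> 'a::euclidean_space \<Rightarrow> complex" and B :: "'a \<Rightarrow> real"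
  assumes F: "\<And>y. integrable M (F y)" and P: "\<And>i. integrable M (P i)" and B: "integrable M B"
    and le: "\<And>v z. norm v \<le> 1 \<Longrightarrow>
      norm (F (x + v) z - F x z - (\<Sum>i\<in>UNIV. (v $ i) *\<^sub>R P i z)) \<le> B z * (norm v)\<^sup>2"
  shows "((\<lambda>x. LINT z|M. F x z) has_derivative (\<lambda>v. \<Sum>i\<in>UNIV. (v $ i) *\<^sub>R (LINT z|M. P i z))) (at x)"
  unfolding has_derivative_at
proof (intro conjI)
  show "bounded_linear (\<lambda>v. \<Sum>i\<in>UNIV. (v $ i) *\<^sub>R (LINT z|M. P i z))"
    by (intro bounded_linear_sum bounded_linear_scaleR_const bounded_linear_vec_nth)
  have *: "norm ((LINT z|M. F (x + v) z) - (LINT z|M. F x z) - (\<Sum>i\<in>UNIV. (v $ i) *\<^sub>R (LINT z|M. P i z)))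
      \<le> (LINT z|M. B z) * (norm v)\<^sup>2" if "norm v \<le> 1" for v
  proof -
    have S: "integrable M (\<lambda>z. \<Sum>i\<in>UNIV. (v $ i) *\<^sub>R P i z)"
      by (intro Bochner_Integration.integrable_sum integrable_scaleR_right P)
    have "(LINT z|M. F (x + v) z) - (LINT z|M. F x z) - (\<Sum>i\<in>UNIV. (v $ i) *\<^sub>R (LINT z|M. P i z)) =
        (LINT z|M. F (x + v) z - F x z - (\<Sum>i\<in>UNIV. (v $ i) *\<^sub>R P i z))"
      using F P S by simp
    also have "norm \<dots> \<le> (LINT z|M. B z * (norm v)\<^sup>2)"
      by (intro Bochner_Integration.integral_norm_bound_integral)
        (use F S B le[OF that] in auto)
    finally show ?thesis by simp
  qed
  have "\<forall>\<^sub>F v in at (0 :: real ^ 'n). norm v < 1"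
    using eventually_at_ball[of 1 "0 :: real ^ 'n" UNIV] by (simp add: dist_norm)
  then have "\<forall>\<^sub>F v in at 0. norm (norm ((LINT z|M. F (x + v) z) - (LINT z|M. F x z) -
      (\<Sum>i\<in>UNIV. (v $ i) *\<^sub>R (LINT z|M. P i z))) / norm v) \<le> (LINT z|M. B z) * norm v"
  proof eventually_elim
    case (elim v)
    then show ?case
      using *[of v] by (cases "v = 0") (auto simp: divide_le_eq power2_eq_square mult.assoc)
  qed
  moreover have "((\<lambda>v :: real ^ 'n. (LINT z|M. B z) * norm v) \<longlongrightarrow> 0) (at 0)"
    by (auto intro!: tendsto_eq_intros)
  ultimately show "((\<lambda>v. norm ((LINT z|M. F (x + v) z) - (LINT z|M. F x z) -
      (\<Sum>i\<in>UNIV. (v $ i) *\<^sub>R (LINT z|M. P i z))) / norm v) \<longlongrightarrow> 0) (at 0)"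
    by (rule Lim_null_comparison)
qed

subsection \<open>Mollification\<close>

text \<open>A convolution written so that the kernel \<open>h\<close> stays fixed while
  \<open>A\<close> carries scale and orientation. The kernel is complex valued and in general not
  positive, so only absolute moments and the value of its integral are available.\<close>

definition mollify :: "(real ^ 'n \<Rightarrow> real ^ 'n) \<Rightarrow> 'n::finite cfun \<Rightarrow> 'n cfun \<Rightarrow> 'n cfun" where
  "mollify A h g = (\<lambda>x. LINT z|lborel. g (x + A z) * h z)"

text \<open>The constants of the estimates below: the weight absorbs the factor
  \<open>(1 + |z|)^|a|\<close> that Peetre's inequality leaves behind.\<close>

definition moment :: "real \<Rightarrow> 'n::finite cfun \<Rightarrow> real" where
  "moment a h = (LINT z|lborel. (1 + norm z) powr a * norm (h z))"

lemma moment_nonneg: "0 \<le> moment a h"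
  unfolding moment_def by (intro integral_nonneg_AE) auto

context
  fixes A :: "real ^ 'n::finite \<Rightarrow> real ^ 'n" and h :: "'n cfun"
  assumes A [measurable]: "A \<in> borel_measurable borel"
    and A_le: "\<And>z. norm (A z) \<le> norm z"
    and h: "h \<in> schwartz"
begin

lemma schwartz_borel_measurable [measurable]: "h \<in> borel_measurable borel"
  using h by (intro smooth_borel_measurable schwartz_smooth)

lemma norm_shift_le:
  assumes "\<And>x. norm (g x) \<le> C * (1 + norm x) powr a" "0 \<le> C"
  shows "norm (g (x + A z)) \<le> C * (1 + norm x) powr a * (1 + norm z) powr \<bar>a\<bar>"
proof -
  have "norm (g (x + A z)) \<le> C * ((1 + norm x) powr a * (1 + norm (A z)) powr \<bar>a\<bar>)"
    by (rule order_trans[OF assms(1)]) (intro mult_left_mono powr_norm_add_le assms(2))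
  also have "\<dots> \<le> C * ((1 + norm x) powr a * (1 + norm z) powr \<bar>a\<bar>)"
    by (intro mult_left_mono one_plus_norm_powr_mono A_le) (use assms(2) in auto)
  finally show ?thesis by (simp add: mult_ac)
qed

lemma
  fixes g :: "'n cfun"
  assumes g [measurable]: "g \<in> borel_measurable borel"
    and C: "\<And>x. norm (g x) \<le> C * (1 + norm x) powr a" "0 \<le> C"
  shows integrable_mollify: "integrable lborel (\<lambda>z. g (x + A z) * h z)"
    and norm_mollify_le: "norm (mollify A h g x) \<le> C * moment \<bar>a\<bar> h * (1 + norm x) powr a"
proof -
  let ?B = "\<lambda>z. C * (1 + norm x) powr a * ((1 + norm z) powr \<bar>a\<bar> * norm (h z))"
  have B: "integrable lborel ?B"
    by (intro integrable_mult_right schwartz_integrable_weighted h)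
  have le: "norm (g (x + A z) * h z) \<le> ?B z" for z
    unfolding norm_mult using mult_right_mono[OF norm_shift_le[OF C, of x z], of "norm (h z)"]
    by (simp add: mult_ac)
  show I: "integrable lborel (\<lambda>z. g (x + A z) * h z)"
    by (rule Bochner_Integration.integrable_bound[OF B])
      (use le in \<open>auto intro: order_trans[OF _ abs_ge_self]\<close>)
  have "norm (mollify A h g x) \<le> (LINT z|lborel. ?B z)"
    unfolding mollify_def using I B le by (intro Bochner_Integration.integral_norm_bound_integral) auto
  then show "norm (mollify A h g x) \<le> C * moment \<bar>a\<bar> h * (1 + norm x) powr a"
    by (simp only: moment_def integral_mult_right_zero) (simp add: mult_ac)
qed

lemma integrable_mollify_slowly_increasing:
  assumes "g \<in> slowly_increasing"
  shows "integrable lborel (\<lambda>z. g (x + A z) * h z)"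
  using slowly_increasing_uniform[OF assms, of 0]
proof cases
  case (1 a C)
  from 1(3)[of "[]"] show ?thesis
    by (intro integrable_mollify[OF _ _ 1(2)] smooth_borel_measurable slowly_increasing_smooth assms) simp
qed

lemma has_derivative_mollify:
  assumes g: "g \<in> slowly_increasing"
  shows "(mollify A h g has_derivative (\<lambda>v. \<Sum>i\<in>UNIV. (v $ i) *\<^sub>R mollify A h (partial i g) x)) (at x)"
  using slowly_increasing_uniform[OF g, of 2]
proof cases
  case (1 a C)
  have g': "partial i g \<in> slowly_increasing" for i
    using slowly_increasing_iter_partial[OF g, of "[i]"] by simp
  \<comment> \<open>\<open>CARD('n)^2 * C\<close> is the constant of the Taylor remainder,
    \<open>2 powr \<bar>a\<bar>\<close> bounds the weight of an increment of length at most 1, and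
    the weight at \<open>x\<close> is what Peetre's inequality leaves of the weight at
    \<open>x + A z\<close>.\<close>
  let ?K = "CARD('n)\<^sup>2 * C * 2 powr \<bar>a\<bar> * (1 + norm x) powr a"
  have *: "norm (g (x + v + A z) * h z - g (x + A z) * h z - (\<Sum>i\<in>UNIV. (v $ i) *\<^sub>R (partial i g (x + A z) * h z)))
    \<le> ?K * ((1 + norm z) powr \<bar>a\<bar> * norm (h z)) * (norm v)\<^sup>2" if v: "norm v \<le> 1" for v z
  proof -
    let ?y = "x + A z"
    have "norm (g (?y + v) - g ?y - (\<Sum>i\<in>UNIV. (v $ i) *\<^sub>R partial i g ?y))
      \<le> CARD('n)\<^sup>2 * C * (1 + norm ?y) powr a * (1 + norm v) powr \<bar>a\<bar> * (norm v)\<^sup>2"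
      using 1(3)[of "[j, i]" for i j] slowly_increasing_smooth[OF g] slowly_increasing_smooth[OF g']
      by (intro norm_remainder_le_partial) (auto simp: smooth_differentiable)
    also have "\<dots> \<le> CARD('n)\<^sup>2 * C * ((1 + norm x) powr a * (1 + norm z) powr \<bar>a\<bar>) * 2 powr \<bar>a\<bar> * (norm v)\<^sup>2"
    proof -
      have "(1 + norm v) powr \<bar>a\<bar> \<le> 2 powr \<bar>a\<bar>"
        using v by (intro powr_mono2) auto
      moreover have "(1 + norm ?y) powr a \<le> (1 + norm x) powr a * (1 + norm z) powr \<bar>a\<bar>"
        by (rule order_trans[OF powr_norm_add_le mult_left_mono[OF one_plus_norm_powr_mono[OF A_le]]]) simp
      ultimately show ?thesis
        by (intro mult_right_mono mult_mono mult_left_mono) (use 1(2) in auto)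
    qed
    finally have "norm (g (?y + v) - g ?y - (\<Sum>i\<in>UNIV. (v $ i) *\<^sub>R partial i g ?y)) * norm (h z)
      \<le> CARD('n)\<^sup>2 * C * ((1 + norm x) powr a * (1 + norm z) powr \<bar>a\<bar>) * 2 powr \<bar>a\<bar> * (norm v)\<^sup>2 * norm (h z)"
      by (rule mult_right_mono) simp
    moreover have "g (x + v + A z) * h z - g (x + A z) * h z - (\<Sum>i\<in>UNIV. (v $ i) *\<^sub>R (partial i g (x + A z) * h z)) =
       (g (?y + v) - g ?y - (\<Sum>i\<in>UNIV. (v $ i) *\<^sub>R partial i g ?y)) * h z"
      by (simp add: left_diff_distrib sum_distrib_right add_ac)
    ultimately show ?thesis
      by (simp only: norm_mult) (simp add: mult_ac)
  qed
  show ?thesis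
    unfolding mollify_def
    by (rule has_derivative_integral[OF integrable_mollify_slowly_increasing[OF g]
          integrable_mollify_slowly_increasing[OF g'] integrable_mult_right[OF schwartz_integrable_weighted[OF h], of ?K], OF *])
qed

lemma iter_partial_mollify:
  assumes g: "g \<in> slowly_increasing"
  shows "iter_partial js (mollify A h g) = mollify A h (iter_partial js g)"
proof (induction js)
  case (Cons j js)
  from partial_eqI[OF has_derivative_mollify[OF slowly_increasing_iter_partial[OF g, of js]], of j]
  show ?case by (intro ext) (simp add: Cons axis_def if_distrib[where f="\<lambda>z. z *\<^sub>R _"] cong: if_cong)
qed simp

lemma smooth_mollify:
  assumes g: "g \<in> slowly_increasing"
  shows "smooth (mollify A h g)"
  by (rule smoothI_iter[OF iter_partial_mollify[OF g]])
    (use has_derivative_mollify[OF slowly_increasing_iter_partial[OF g]] in \<open>auto simp: differentiable_def\<close>)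

lemma schwartz_mollify:
  assumes g: "g \<in> schwartz"
  shows "mollify A h g \<in> schwartz"
proof -
  have "poly_bounded a (mollify A h (iter_partial js g))" for a js
  proof -
    obtain C where "0 \<le> C" "\<And>x. norm (iter_partial js g x) \<le> C * (1 + norm x) powr a"
      using poly_boundedE schwartz_iff g by metis
    then show ?thesis
      by (intro poly_boundedI[of _ "C * moment \<bar>a\<bar> h"] norm_mollify_le smooth_borel_measurable
          schwartz_smooth schwartz_iter_partial g)
  qed
  then show ?thesis
    using schwartz_imp_slowly_increasing[OF g] by (simp add: schwartz_iff smooth_mollify iter_partial_mollify)
qed

text \<open>As \<open>h\<close> has integral 1, \<open>g x\<close> is the average of the constant
  \<open>g x\<close>, and the mean value estimate for \<open>g (x + A z) - g x\<close> can be
  integrated. Its last factor, at most \<open>q (1 + |z|)\<close>, raises the order of the moment by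
  1.\<close>

lemma norm_mollify_diff_le:
  fixes C q :: real
  assumes g: "g \<in> slowly_increasing"
    and C: "\<And>j x. norm (partial j g x) \<le> C * (1 + norm x) powr a"
    and q: "\<And>z. norm (A z) \<le> q * norm z" "0 \<le> q"
    and h1: "(LINT z|lborel. h z) = 1"
  shows "norm (mollify A h g x - g x) \<le> q * CARD('n) * C * moment (\<bar>a\<bar> + 1) h * (1 + norm x) powr a"
proof -
  have "0 \<le> C"
    using order_trans[OF norm_ge_zero C[of undefined 0]] by simp
  let ?K = "q * CARD('n) * C * (1 + norm x) powr a"
  have h': "integrable lborel (\<lambda>z. g x * h z)"
    by (intro integrable_mult_right schwartz_integrable h)
  note I = integrable_mollify_slowly_increasing[OF g, of x]
  have "mollify A h g x - g x = (LINT z|lborel. g (x + A z) * h z) - (LINT z|lborel. g x * h z)"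
    by (simp add: mollify_def h1)
  also have "\<dots> = (LINT z|lborel. g (x + A z) * h z - g x * h z)"
    using I h' by simp
  also have "norm \<dots> \<le> (LINT z|lborel. ?K * ((1 + norm z) powr (\<bar>a\<bar> + 1) * norm (h z)))"
  proof (intro Bochner_Integration.integral_norm_bound_integral)
    fix z
    have "norm (g (x + A z) - g x) \<le> CARD('n) * C * (1 + norm x) powr a * (1 + norm (A z)) powr \<bar>a\<bar> * norm (A z)"
      using C slowly_increasing_smooth[OF g] by (intro norm_diff_le_partial) (auto simp: smooth_differentiable)
    also have "\<dots> \<le> CARD('n) * C * (1 + norm x) powr a * (1 + norm z) powr \<bar>a\<bar> * (q * (1 + norm z))"
    proof (intro mult_mono mult_left_mono one_plus_norm_powr_mono A_le)
      show "norm (A z) \<le> q * (1 + norm z)"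
        by (rule order_trans[OF q(1) mult_left_mono[OF _ q(2)]]) simp
    qed (use \<open>0 \<le> C\<close> in auto)
    also have "\<dots> = ?K * (1 + norm z) powr (\<bar>a\<bar> + 1)"
      by (simp add: powr_add mult_ac)
    finally show "norm (g (x + A z) * h z - g x * h z) \<le> ?K * ((1 + norm z) powr (\<bar>a\<bar> + 1) * norm (h z))"
      unfolding left_diff_distrib[symmetric] norm_mult
      by (metis (no_types, lifting) mult.assoc mult_right_mono norm_ge_zero)
  qed (intro Bochner_Integration.integrable_diff I h' integrable_mult_right schwartz_integrable_weighted h)+
  finally show ?thesis
    by (simp only: moment_def integral_mult_right_zero) (simp add: mult_ac)
qed

end

subsection \<open>The inverse Fourier transform of a Schwartz function\<close>

text \<open>
  By translation invariance of \<open>lborel\<close> the integral of \<open>g (x + t e\<^sub>j) - g x\<close> vanishes; divide by \<open>t\<close>.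
\<close>

lemma integral_partial_eq_0:
  fixes g :: "'n::finite cfun"
  assumes g: "g \<in> schwartz"
  shows "(LINT x|lborel. partial j g x) = 0"
proof -
  let ?a = "- 2 * real CARD('n)"
  have g': "iter_partial js g \<in> schwartz" for js
    using g by (rule schwartz_iter_partial)
  have P: "integrable lborel (partial j g)"
    using schwartz_integrable[OF g'[of "[j]"]] by simp
  have I: "integrable lborel g"
    using g by (rule schwartz_integrable)
  obtain C where C: "0 \<le> C"
    "\<And>js x. length js \<le> 2 \<Longrightarrow> norm (iter_partial js g x) \<le> C * (1 + norm x) powr ?a"
    by (rule schwartz_uniform[OF g]) (rule that)
  define B where "B x = CARD('n)\<^sup>2 * C * (1 + norm x) powr ?a * 2 powr \<bar>?a\<bar>" for x :: "real ^ 'n"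
  have B: "integrable lborel B"
    unfolding B_def by (intro integrable_mult_left integrable_mult_right integrable_one_plus_norm_powr) simp
  have shift: "integrable lborel (\<lambda>x. g (x + v))" "(LINT x|lborel. g (x + v)) = (LINT x|lborel. g x)" for v
  proof -
    show "integrable lborel (\<lambda>x. g (x + v))" "(LINT x|lborel. g (x + v)) = (LINT x|lborel. g x)"
      using integrable_affine[OF I, of "\<lambda>_. 1" v] integral_affine[OF I, of "\<lambda>_. 1" v]
      by (simp_all add: add.commute)
  qed
  have le: "norm (LINT x|lborel. partial j g x) \<le> (LINT x|lborel. B x) * t" if "0 < t" "t \<le> 1" for t
  proof -
    let ?v = "t *\<^sub>R axis j 1 :: real ^ 'n"
    have v: "norm ?v = t"
      using that by (simp add: norm_axis_1)
    have v': "(\<Sum>i\<in>UNIV. (?v $ i) *\<^sub>R partial i g x) = t *\<^sub>R partial j g x" for x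
      by (simp add: axis_def if_distrib[where f="\<lambda>z. z *\<^sub>R _"] if_distrib[where f="\<lambda>z. _ * z"] cong: if_cong)
    have "norm (g (x + ?v) - g x - t *\<^sub>R partial j g x) \<le> B x * t\<^sup>2" for x
    proof -
      have "norm (g (x + ?v) - g x - (\<Sum>i\<in>UNIV. (?v $ i) *\<^sub>R partial i g x))
        \<le> CARD('n)\<^sup>2 * C * (1 + norm x) powr ?a * (1 + norm ?v) powr \<bar>?a\<bar> * (norm ?v)\<^sup>2"
        using C(2)[of "[j, i]" for i j] schwartz_smooth[OF g] smooth_partial[OF schwartz_smooth[OF g]]
        by (intro norm_remainder_le_partial) (auto simp: smooth_differentiable)
      also have "\<dots> \<le> B x * t\<^sup>2"
        unfolding v B_def using that C(1)
        by (intro mult_right_mono mult_left_mono powr_mono2) auto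
      finally show ?thesis unfolding v' .
    qed
    then have "norm (LINT x|lborel. g (x + ?v) - g x - t *\<^sub>R partial j g x) \<le> (LINT x|lborel. B x * t\<^sup>2)"
      using shift I P B by (intro Bochner_Integration.integral_norm_bound_integral) auto
    also have "(LINT x|lborel. g (x + ?v) - g x - t *\<^sub>R partial j g x) = - (t *\<^sub>R (LINT x|lborel. partial j g x))"
      using shift[of ?v] I P by simp
    finally show ?thesis
      using that by (simp add: power2_eq_square)
  qed
  have "norm (LINT x|lborel. partial j g x) \<le> 0"
  proof (rule tendsto_lowerbound)
    show "((\<lambda>t. (LINT x|lborel. B x) * t) \<longlongrightarrow> 0) (at_right 0)"
      by (auto intro!: tendsto_eq_intros)
    show "\<forall>\<^sub>F t in at_right 0. norm (LINT x|lborel. partial j g x) \<le> (LINT x|lborel. B x) * t"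
      using eventually_at_right_less[of "0::real"] eventually_at_right_real[of 0 1, simplified]
      by eventually_elim (auto intro: le)
  qed simp
  then show ?thesis by simp
qed

lemma integrable_expi_mult:
  fixes \<phi> :: "'n::finite cfun"
  assumes "integrable lborel \<phi>"
  shows "integrable lborel (\<lambda>\<xi>. exp (\<i> * of_real (x \<bullet> \<xi>)) * \<phi> \<xi>)"
proof (rule Bochner_Integration.integrable_bound[OF assms])
  have "(\<lambda>\<xi>. exp (\<i> * of_real (x \<bullet> \<xi>)) :: complex) \<in> borel_measurable lborel"
    unfolding measurable_lborel2 by (intro borel_measurable_continuous_onI continuous_intros)
  then show "(\<lambda>\<xi>. exp (\<i> * of_real (x \<bullet> \<xi>)) * \<phi> \<xi>) \<in> borel_measurable lborel"
    using borel_measurable_integrable[OF assms] by (rule borel_measurable_times)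
qed (simp add: norm_mult)

lemma schwartz_coord_mult: "\<phi> \<in> schwartz \<Longrightarrow> (\<lambda>\<xi>. of_real (\<xi> $ i) * \<phi> \<xi>) \<in> schwartz"
  by (rule schwartz_mult_slowly_increasing[OF slowly_increasing_coord])

text \<open>With \<open>s = v \<bullet> \<xi>\<close> the remainder of the exponential satisfies
  \<open>|exp (i s) - 1 - i s| \<le> s^2 / 2\<close>, and \<open>|s| \<le> |v| |\<xi>|\<close>; so
  the quadratically weighted modulus of \<phi> serves as integrable constant.\<close>

lemma has_derivative_inv_fourier:
  fixes \<phi> :: "'n::finite cfun"
  assumes \<phi>: "\<phi> \<in> schwartz"
  shows "(inv_fourier \<phi> has_derivative
    (\<lambda>v. \<Sum>i\<in>UNIV. (v $ i) *\<^sub>R inv_fourier (\<lambda>\<xi>. \<i> * (of_real (\<xi> $ i) * \<phi> \<xi>)) x)) (at x)"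
proof -
  let ?E = "\<lambda>x \<xi>. exp (\<i> * of_real (x \<bullet> \<xi>)) :: complex"
  let ?P = "\<lambda>i \<xi>. ?E x \<xi> * (\<i> * (of_real (\<xi> $ i) * \<phi> \<xi>))"
  have "norm (?E (x + v) \<xi> * \<phi> \<xi> - ?E x \<xi> * \<phi> \<xi> - (\<Sum>i\<in>UNIV. (v $ i) *\<^sub>R ?P i \<xi>))
    \<le> (1 + norm \<xi>) powr 2 * norm (\<phi> \<xi>) * (norm v)\<^sup>2" for v \<xi>
  proof -
    have "(\<Sum>i\<in>UNIV. (v $ i) *\<^sub>R ?P i \<xi>) = ?E x \<xi> * \<phi> \<xi> * (\<i> * of_real (v \<bullet> \<xi>))"
      by (simp add: inner_vec_def scaleR_conv_of_real sum_distrib_left sum_distrib_right mult_ac)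
    then have "?E (x + v) \<xi> * \<phi> \<xi> - ?E x \<xi> * \<phi> \<xi> - (\<Sum>i\<in>UNIV. (v $ i) *\<^sub>R ?P i \<xi>) =
        ?E x \<xi> * \<phi> \<xi> * (?E v \<xi> - 1 - \<i> * of_real (v \<bullet> \<xi>))"
      by (simp add: inner_add_left distrib_left exp_add algebra_simps)
    also have "norm \<dots> = norm (\<phi> \<xi>) * norm (?E v \<xi> - 1 - \<i> * of_real (v \<bullet> \<xi>))"
      by (simp add: norm_mult)
    also have "\<dots> \<le> norm (\<phi> \<xi>) * ((1 + norm \<xi>) powr 2 * (norm v)\<^sup>2)"
    proof (rule mult_left_mono)
      have "norm (?E v \<xi> - 1 - \<i> * of_real (v \<bullet> \<xi>)) \<le> \<bar>v \<bullet> \<xi>\<bar>\<^sup>2 / 2"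
        using iexp_approx1[of "v \<bullet> \<xi>" 1] by (simp add: algebra_simps numeral_2_eq_2)
      also have "\<dots> \<le> (norm v * norm \<xi>)\<^sup>2"
        using power_mono[OF Cauchy_Schwarz_ineq2[of v \<xi>], of 2]
        by (intro order_trans[OF _ power_mono[OF Cauchy_Schwarz_ineq2[of v \<xi>], of 2]]) auto
      also have "\<dots> \<le> (1 + norm \<xi>) powr 2 * (norm v)\<^sup>2"
        by (simp add: power_mult_distrib mult.commute[of "(norm v)\<^sup>2"] mult_right_mono power_mono)
      finally show "norm (?E v \<xi> - 1 - \<i> * of_real (v \<bullet> \<xi>)) \<le> (1 + norm \<xi>) powr 2 * (norm v)\<^sup>2" .
    qed simp
    finally show ?thesis by (simp add: mult_ac)
  qed
  from has_derivative_integral[OF integrable_expi_mult[OF schwartz_integrable[OF \<phi>]]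
      integrable_expi_mult[OF schwartz_integrable[OF schwartz_cmult[OF schwartz_coord_mult[OF \<phi>]]]]
      schwartz_integrable_weighted[OF \<phi>, of 2] this]
  have "((\<lambda>x. LINT \<xi>|lborel. ?E x \<xi> * \<phi> \<xi>) has_derivative
    (\<lambda>v. \<Sum>i\<in>UNIV. (v $ i) *\<^sub>R (LINT \<xi>|lborel. ?P i \<xi>))) (at x)" .
  from has_derivative_mult_right[OF this, of "of_real ((2 * pi) powr - real CARD('n))"] show ?thesis
    unfolding inv_fourier_def by (simp only: sum_distrib_left mult_scaleR_right)
qed

lemma partial_inv_fourier:
  assumes "\<phi> \<in> schwartz"
  shows "partial j (inv_fourier \<phi>) = inv_fourier (\<lambda>\<xi>. \<i> * (of_real (\<xi> $ j) * \<phi> \<xi>))"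
proof
  show "partial j (inv_fourier \<phi>) x = inv_fourier (\<lambda>\<xi>. \<i> * (of_real (\<xi> $ j) * \<phi> \<xi>)) x" for x
    using partial_eqI[OF has_derivative_inv_fourier[OF assms], of j x]
    by (simp add: axis_def if_distrib[where f="\<lambda>z. z *\<^sub>R _"] cong: if_cong)
qed

text \<open>Integration by parts: the product of the character with \<phi> is a Schwartz function,
  so the integral of its partial derivative vanishes.\<close>

lemma coord_mult_inv_fourier:
  assumes \<phi>: "\<phi> \<in> schwartz"
  shows "of_real (x $ j) * inv_fourier \<phi> x = inv_fourier (\<lambda>\<xi>. \<i> * partial j \<phi> \<xi>) x"
proof -
  let ?E = "\<lambda>\<xi>. exp (\<i> * of_real (x \<bullet> \<xi>)) :: complex"
  have E: "?E \<in> slowly_increasing" by (rule slowly_increasing_expi)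
  have p: "partial j (\<lambda>\<xi>. ?E \<xi> * \<phi> \<xi>) = (\<lambda>\<xi>. \<i> * of_real (x $ j) * (?E \<xi> * \<phi> \<xi>) + ?E \<xi> * partial j \<phi> \<xi>)"
    using iter_partial_expi[of "[j]" x] slowly_increasing_smooth[OF E] schwartz_smooth[OF \<phi>]
    by (intro ext) (simp add: partial_mult smooth_differentiable mult_ac)
  have I: "integrable lborel (\<lambda>\<xi>. ?E \<xi> * \<phi> \<xi>)" "integrable lborel (\<lambda>\<xi>. ?E \<xi> * partial j \<phi> \<xi>)"
    using integrable_expi_mult[OF schwartz_integrable[OF \<phi>]]
      integrable_expi_mult[OF schwartz_integrable[OF schwartz_iter_partial[OF \<phi>, of "[j]"]]] by simp_all
  have "0 = (LINT \<xi>|lborel. partial j (\<lambda>\<xi>. ?E \<xi> * \<phi> \<xi>) \<xi>)"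
    using integral_partial_eq_0[OF schwartz_mult_slowly_increasing[OF E \<phi>], of j] by simp
  also have "\<dots> = \<i> * of_real (x $ j) * (LINT \<xi>|lborel. ?E \<xi> * \<phi> \<xi>) + (LINT \<xi>|lborel. ?E \<xi> * partial j \<phi> \<xi>)"
    unfolding p using I by simp
  finally have "\<i> * (LINT \<xi>|lborel. ?E \<xi> * partial j \<phi> \<xi>) = of_real (x $ j) * (LINT \<xi>|lborel. ?E \<xi> * \<phi> \<xi>)"
    by (simp add: eq_neg_iff_add_eq_0[symmetric] algebra_simps)
  then show ?thesis
    by (simp add: inv_fourier_def mult.left_commute[of _ \<i>])
qed

lemma inv_fourier_add:
  assumes "\<phi> \<in> schwartz" "\<eta> \<in> schwartz"
  shows "inv_fourier \<phi> x + inv_fourier \<eta> x = inv_fourier (\<lambda>\<xi>. \<phi> \<xi> + \<eta> \<xi>) x"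
  using integrable_expi_mult[OF schwartz_integrable[OF assms(1)], of x]
    integrable_expi_mult[OF schwartz_integrable[OF assms(2)], of x]
  by (simp add: inv_fourier_def distrib_left)

text \<open>On the Fourier side this is the operator 1 minus the Laplacian, each square
  \<open>x_j^2\<close> being produced by applying \<open>coord_mult_inv_fourier\<close> twice. The
  existential form is what allows iteration.\<close>

lemma norm_mult_inv_fourier:
  fixes \<phi> :: "'n::finite cfun"
  assumes "\<phi> \<in> schwartz"
  shows "\<exists>\<eta>\<in>schwartz. \<forall>x. of_real (1 + (norm x)\<^sup>2) * inv_fourier \<phi> x = inv_fourier \<eta> x"
proof -
  have sum: "\<exists>\<eta>\<in>schwartz. \<forall>x. inv_fourier \<phi> x + (\<Sum>j\<in>J. of_real ((x $ j)\<^sup>2) * inv_fourier \<phi> x) = inv_fourier \<eta> x"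
    if "finite J" for J
    using that
  proof (induction J rule: finite_induct)
    case (insert j J)
    then obtain \<eta> where \<eta>: "\<eta> \<in> schwartz"
      "\<And>x. inv_fourier \<phi> x + (\<Sum>j\<in>J. of_real ((x $ j)\<^sup>2) * inv_fourier \<phi> x) = inv_fourier \<eta> x"
      by blast
    define \<theta> where "\<theta> \<xi> = \<i> * partial j \<phi> \<xi>" for \<xi>
    have \<theta>: "\<theta> \<in> schwartz"
      unfolding \<theta>_def using schwartz_cmult[OF schwartz_iter_partial[OF assms, of "[j]"], of \<i>] by simp
    define \<kappa> where "\<kappa> \<xi> = \<i> * partial j \<theta> \<xi>" for \<xi>
    have \<kappa>: "\<kappa> \<in> schwartz"
      unfolding \<kappa>_def using schwartz_cmult[OF schwartz_iter_partial[OF \<theta>, of "[j]"], of \<i>] by simp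
    have "of_real ((x $ j)\<^sup>2) * inv_fourier \<phi> x = inv_fourier \<kappa> x" for x
      using coord_mult_inv_fourier[OF assms, of x j] coord_mult_inv_fourier[OF \<theta>, of x j]
      by (simp add: power2_eq_square mult.assoc \<theta>_def[abs_def] \<kappa>_def[abs_def])
    then have "inv_fourier \<phi> x + (\<Sum>j\<in>insert j J. of_real ((x $ j)\<^sup>2) * inv_fourier \<phi> x) = inv_fourier (\<lambda>\<xi>. \<kappa> \<xi> + \<eta> \<xi>) x" for x
      using insert \<eta>(2)[of x] inv_fourier_add[OF \<kappa> \<eta>(1), of x] by (simp add: algebra_simps)
    with schwartz_add[OF \<kappa> \<eta>(1)] show ?case by blast
  qed (use assms in auto)
  have "of_real (1 + (norm x)\<^sup>2) * inv_fourier \<phi> x = inv_fourier \<phi> x + (\<Sum>j\<in>UNIV. of_real ((x $ j)\<^sup>2) * inv_fourier \<phi> x)" for x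
    by (simp add: norm_vec_def L2_set_def sum_nonneg distrib_right sum_distrib_right)
  with sum[of UNIV] show ?thesis by simp
qed

lemma norm_inv_fourier_le:
  fixes \<phi> :: "'n::finite cfun"
  shows "norm (inv_fourier \<phi> x) \<le> (2 * pi) powr - real CARD('n) * (LINT \<xi>|lborel. norm (\<phi> \<xi>))"
proof -
  have "norm (LINT \<xi>|lborel. exp (\<i> * of_real (x \<bullet> \<xi>)) * \<phi> \<xi>) \<le> (LINT \<xi>|lborel. norm (exp (\<i> * of_real (x \<bullet> \<xi>)) * \<phi> \<xi>))"
    by (rule integral_norm_bound)
  then show ?thesis
    unfolding inv_fourier_def norm_mult by (intro mult_mono) (auto simp: norm_mult)
qed

text \<open>Derivatives of an inverse transform, and its products with powers of
  \<open>1 + |x|^2\<close>, are inverse transforms of other Schwartz functions, and each of these is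
  bounded by an L1 norm.\<close>

lemma schwartz_inv_fourier:
  fixes \<phi> :: "'n::finite cfun"
  assumes "\<phi> \<in> schwartz"
  shows "inv_fourier \<phi> \<in> schwartz"
proof -
  have iter: "\<exists>\<eta>\<in>schwartz. iter_partial js (inv_fourier \<phi>) = inv_fourier \<eta>" for js
  proof (induction js)
    case (Cons j js)
    then show ?case
      using partial_inv_fourier schwartz_cmult[OF schwartz_coord_mult] by (metis iter_partial.simps(2))
  qed (use assms in auto)
  have power: "\<exists>\<eta>\<in>schwartz. \<forall>x. of_real ((1 + (norm x)\<^sup>2) ^ m) * inv_fourier \<theta> x = inv_fourier \<eta> x"
    if "\<theta> \<in> schwartz" for m and \<theta> :: "'n cfun"
  proof (induction m)
    case (Suc m)
    then obtain \<eta> where \<eta>: "\<eta> \<in> schwartz" "\<And>x. of_real ((1 + (norm x)\<^sup>2) ^ m) * inv_fourier \<theta> x = inv_fourier \<eta> x"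
      by blast
    from norm_mult_inv_fourier[OF \<eta>(1)] show ?case
      by (simp add: mult.assoc \<eta>(2)[symmetric] del: of_real_add of_real_power)
  qed (use that in auto)
  have bounded: "poly_bounded a (inv_fourier \<theta>)" if \<theta>: "\<theta> \<in> schwartz" for a and \<theta> :: "'n cfun"
  proof -
    define m where "m = nat \<lceil>-a\<rceil>"
    obtain \<eta> where \<eta>: "\<And>x. of_real ((1 + (norm x)\<^sup>2) ^ m) * inv_fourier \<theta> x = inv_fourier \<eta> x"
      using power[OF \<theta>] by blast
    define K where "K = (2 * pi) powr - real CARD('n) * (LINT \<xi>|lborel. norm (\<eta> \<xi>))"
    have "norm (inv_fourier \<theta> x) \<le> (2 ^ m * K) * (1 + norm x) powr (- real m)" for x
    proof -
      \<comment> \<open>The right-hand side is twice the difference of the two sides of the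
        inequality derived from it.\<close>
      have "0 \<le> (1 - norm x)\<^sup>2 + 1 + 3 * (norm x)\<^sup>2"
        by (intro add_nonneg_nonneg) auto
      then have "1 + norm x \<le> 2 * (1 + (norm x)\<^sup>2)"
        by (simp add: power2_eq_square algebra_simps)
      then have "(1 + norm x) ^ m \<le> (2 * (1 + (norm x)\<^sup>2)) ^ m"
        by (intro power_mono) auto
      then have "(1 + norm x) ^ m * norm (inv_fourier \<theta> x) \<le> (2 * (1 + (norm x)\<^sup>2)) ^ m * norm (inv_fourier \<theta> x)"
        by (rule mult_right_mono) simp
      also have "\<dots> = 2 ^ m * norm (inv_fourier \<eta> x)"
        unfolding \<eta>[of x, symmetric] norm_mult norm_of_real power_mult_distrib
        by simp
      also have "\<dots> \<le> 2 ^ m * K"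
        unfolding K_def by (intro mult_left_mono norm_inv_fourier_le) simp
      finally show ?thesis
        by (simp add: powr_minus powr_realpow field_simps)
    qed
    then have "poly_bounded (- real m) (inv_fourier \<theta>)" by (rule poly_boundedI)
    then show ?thesis by (rule poly_bounded_mono) (simp add: m_def, linarith)
  qed
  have "inv_fourier \<eta> differentiable at x" if "\<eta> \<in> schwartz" for x and \<eta> :: "'n cfun"
    using has_derivative_inv_fourier[OF that] by (auto simp: differentiable_def)
  then have "smooth (inv_fourier \<phi>)"
    unfolding smooth_def by (metis iter)
  moreover have "poly_bounded a (iter_partial js (inv_fourier \<phi>))" for a js
    by (metis iter bounded)
  ultimately show ?thesis by (simp add: schwartz_iff)
qed

section \<open>The multiplication formula, dilations and the Gaussian\<close>

lemma integral_expi_swap: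
  fixes \<phi> \<psi> :: "'n::finite cfun"
  assumes \<phi>: "integrable lborel \<phi>" and \<psi>: "integrable lborel \<psi>"
  shows "(LINT \<xi>|lborel. \<psi> \<xi> * (LINT y|lborel. exp (\<i> * of_real (y \<bullet> \<xi>)) * \<phi> y)) =
    (LINT y|lborel. \<phi> y * (LINT \<xi>|lborel. exp (\<i> * of_real (y \<bullet> \<xi>)) * \<psi> \<xi>))"
proof -
  let ?F = "\<lambda>y \<xi>. exp (\<i> * of_real (y \<bullet> \<xi>)) * \<phi> y * \<psi> \<xi>"
  have "continuous_on UNIV (\<lambda>p :: (real ^ 'n) \<times> (real ^ 'n). exp (\<i> * of_real (fst p \<bullet> snd p)) :: complex)"
    by (intro continuous_intros)
  then have E: "(\<lambda>p :: (real ^ 'n) \<times> (real ^ 'n). exp (\<i> * of_real (fst p \<bullet> snd p)) :: complex) \<in> borel_measurable (lborel \<Otimes>\<^sub>M lborel)"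
    unfolding lborel_prod measurable_lborel2 by (rule borel_measurable_continuous_onI)
  have "(\<lambda>p. exp (\<i> * of_real (fst p \<bullet> snd p)) * \<phi> (fst p) * \<psi> (snd p)) \<in> borel_measurable (lborel \<Otimes>\<^sub>M lborel)"
    by (intro borel_measurable_times E measurable_compose[OF measurable_fst borel_measurable_integrable[OF \<phi>]]
        measurable_compose[OF measurable_snd borel_measurable_integrable[OF \<psi>]])
  then have M: "case_prod ?F \<in> borel_measurable (lborel \<Otimes>\<^sub>M lborel)"
    by (simp only: case_prod_unfold)
  have "integrable (lborel \<Otimes>\<^sub>M lborel) (case_prod ?F)"
  proof (rule lborel_pair.Fubini_integrable[OF M])
    have "integrable lborel (\<lambda>y. norm (\<phi> y) * (LINT \<xi>|lborel. norm (\<psi> \<xi>)))"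
      using \<phi> by (intro integrable_mult_left integrable_norm)
    then show "integrable lborel (\<lambda>y. LINT \<xi>|lborel. norm (case_prod ?F (y, \<xi>)))"
      by (simp add: norm_mult)
    have "integrable lborel (\<lambda>\<xi>. \<phi> y * (exp (\<i> * of_real (y \<bullet> \<xi>)) * \<psi> \<xi>))" for y
      by (intro integrable_mult_right integrable_expi_mult \<psi>)
    then show "AE y in lborel. integrable lborel (\<lambda>\<xi>. case_prod ?F (y, \<xi>))"
      by (simp add: mult_ac)
  qed
  from lborel_pair.Fubini_integral[OF this]
  have "(LINT \<xi>|lborel. LINT y|lborel. \<psi> \<xi> * (exp (\<i> * of_real (y \<bullet> \<xi>)) * \<phi> y)) =
    (LINT y|lborel. LINT \<xi>|lborel. \<phi> y * (exp (\<i> * of_real (y \<bullet> \<xi>)) * \<psi> \<xi>))"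
    by (simp only: mult_ac split: prod.split)
  then show ?thesis
    by (simp only: integral_mult_right_zero)
qed

text \<open>The outer character is absorbed into \<psi>, and Fubini moves the inner transform from
  \<phi> to \<psi>. For \<psi> a cut-off, the left side is the function to which a frequency cut-off
  applies the original distribution.\<close>

lemma fourier_mult_inv_fourier:
  fixes \<phi> \<psi> :: "'n::finite cfun"
  assumes \<phi>: "integrable lborel \<phi>" and \<psi>: "integrable lborel \<psi>"
  shows "fourier (\<lambda>\<xi>. \<psi> \<xi> * inv_fourier \<phi> \<xi>) = (\<lambda>x. LINT y|lborel. \<phi> y * inv_fourier \<psi> (y - x))"
proof
  fix x
  let ?c = "of_real ((2 * pi) powr - real CARD('n)) :: complex"
  let ?\<psi> = "\<lambda>\<xi>. exp (\<i> * of_real ((- x) \<bullet> \<xi>)) * \<psi> \<xi>"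
  have "fourier (\<lambda>\<xi>. \<psi> \<xi> * inv_fourier \<phi> \<xi>) x =
      (LINT \<xi>|lborel. ?c * (?\<psi> \<xi> * (LINT y|lborel. exp (\<i> * of_real (y \<bullet> \<xi>)) * \<phi> y)))"
    by (simp add: fourier_def inv_fourier_def inner_commute mult_ac)
  also have "\<dots> = ?c * (LINT y|lborel. \<phi> y * (LINT \<xi>|lborel. exp (\<i> * of_real (y \<bullet> \<xi>)) * ?\<psi> \<xi>))"
    by (simp only: integral_mult_right_zero integral_expi_swap[OF \<phi> integrable_expi_mult[OF \<psi>]])
  also have "\<dots> = (LINT y|lborel. ?c * (\<phi> y * (LINT \<xi>|lborel. exp (\<i> * of_real (y \<bullet> \<xi>)) * ?\<psi> \<xi>)))"
    by (simp only: integral_mult_right_zero)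
  also have "\<dots> = (LINT y|lborel. \<phi> y * inv_fourier \<psi> (y - x))"
  proof (intro Bochner_Integration.integral_cong refl)
    fix y
    have "(\<lambda>\<xi>. exp (\<i> * of_real (y \<bullet> \<xi>)) * ?\<psi> \<xi>) = (\<lambda>\<xi>. exp (\<i> * of_real ((y - x) \<bullet> \<xi>)) * \<psi> \<xi>)"
      by (simp add: fun_eq_iff inner_diff_left right_diff_distrib exp_diff exp_minus field_simps)
    then show "?c * (\<phi> y * (LINT \<xi>|lborel. exp (\<i> * of_real (y \<bullet> \<xi>)) * ?\<psi> \<xi>)) = \<phi> y * inv_fourier \<psi> (y - x)"
      by (simp add: inv_fourier_def)
  qed
  finally show "fourier (\<lambda>\<xi>. \<psi> \<xi> * inv_fourier \<phi> \<xi>) x = (LINT y|lborel. \<phi> y * inv_fourier \<psi> (y - x))" .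
qed

text \<open>Substitution in the Fourier integral. Evaluating at the dilated point keeps the inverse
  of the diagonal map out of the formula.\<close>

lemma inv_fourier_diagonal:
  fixes \<psi> :: "'n::finite cfun" and d :: "'n \<Rightarrow> real"
  assumes \<psi>: "integrable lborel \<psi>" and d: "\<And>i. 0 < d i"
  shows "(\<Prod>i\<in>UNIV. d i) *\<^sub>R inv_fourier (\<lambda>\<xi>. \<psi> (\<chi> i. d i * \<xi> $ i)) (\<chi> i. d i * x $ i) = inv_fourier \<psi> x"
proof -
  have d': "d i \<noteq> 0" "\<bar>d i\<bar> = d i" for i using d[of i] by auto
  have "(LINT \<xi>|lborel. exp (\<i> * of_real (x \<bullet> \<xi>)) * \<psi> \<xi>) =
    (\<Prod>i\<in>UNIV. d i) *\<^sub>R (LINT \<xi>|lborel. exp (\<i> * of_real (x \<bullet> (\<chi> i. d i * \<xi> $ i))) * \<psi> (\<chi> i. d i * \<xi> $ i))"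
    using integral_affine[OF integrable_expi_mult[OF \<psi>], of d x 0] d' by simp
  moreover have "x \<bullet> (\<chi> i. d i * \<xi> $ i) = (\<chi> i. d i * x $ i) \<bullet> \<xi>" for \<xi>
    by (simp add: inner_vec_def mult_ac)
  ultimately show ?thesis
    by (simp add: inv_fourier_def)
qed

text \<open>The Jacobian of the substitution is exactly the factor in
  \<open>inv_fourier_diagonal\<close>, so the dilation passes into the argument of \<open>F\<close>
  and the remaining kernel does not depend on \<open>d\<close>.\<close>

lemma integral_mult_inv_fourier_diagonal:
  fixes \<psi> F :: "'n::finite cfun" and d :: "'n \<Rightarrow> real"
  assumes \<psi>: "integrable lborel \<psi>" and d: "\<And>i. 0 < d i"
    and I: "integrable lborel (\<lambda>x. F x * inv_fourier (\<lambda>\<xi>. \<psi> (\<chi> i. d i * \<xi> $ i)) x)"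
  shows "(LINT x|lborel. F x * inv_fourier (\<lambda>\<xi>. \<psi> (\<chi> i. d i * \<xi> $ i)) x) =
    (LINT z|lborel. F (\<chi> i. d i * z $ i) * inv_fourier \<psi> z)"
proof -
  let ?h = "inv_fourier (\<lambda>\<xi>. \<psi> (\<chi> i. d i * \<xi> $ i))"
  have d': "d i \<noteq> 0" "\<bar>d i\<bar> = d i" for i using d[of i] by auto
  have "(LINT x|lborel. F x * ?h x) =
    (\<Prod>i\<in>UNIV. d i) *\<^sub>R (LINT z|lborel. F (\<chi> i. d i * z $ i) * ?h (\<chi> i. d i * z $ i))"
    using integral_affine[OF I, of d 0] d' by simp
  also have "\<dots> = (LINT z|lborel. F (\<chi> i. d i * z $ i) * ((\<Prod>i\<in>UNIV. d i) *\<^sub>R ?h (\<chi> i. d i * z $ i)))"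
    by (simp only: integral_scaleR_right[symmetric] mult_scaleR_right)
  finally show ?thesis
    by (simp only: inv_fourier_diagonal[OF \<psi> d])
qed

text \<open>The Gaussian factorizes over the coordinates; each factor is
  \<open>sqrt (2 * pi)\<close> times the standard normal density, whose characteristic function is
  \<open>exp (- s^2 / 2)\<close>.\<close>

lemma
  fixes \<xi> :: "real ^ 'n::finite"
  defines "E \<equiv> \<lambda>x :: real ^ 'n. complex_of_real (exp (- (norm x)\<^sup>2 / 2))"
  shows integrable_gaussian: "integrable lborel E"
    and integral_expi_gaussian: "(LINT x|lborel. exp (\<i> * of_real (x \<bullet> \<xi>)) * E x) = of_real (sqrt (2 * pi) ^ CARD('n)) * E \<xi>"
proof -
  let ?N = "\<lambda>t. complex_of_real (std_normal_density t)"
  have N: "integrable lborel ?N"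
    by (intro integrable_of_real integrable_normal_density) simp
  have iexp_N: "(LINT t|lborel. exp (\<i> * of_real (t * s)) * ?N t) = of_real (exp (- s\<^sup>2 / 2))" for s
  proof -
    have "(LINT t|lborel. exp (\<i> * of_real (t * s)) * ?N t) = char std_normal_distribution s"
      unfolding char_def
      by (subst integral_density) (auto simp: scaleR_conv_of_real mult_ac)
    then show ?thesis by (simp add: char_std_normal_distribution)
  qed
  have I: "integrable lborel (\<lambda>t. exp (\<i> * of_real (t * s)) * ?N t)" for s
    by (rule Bochner_Integration.integrable_bound[OF N]) (auto simp: norm_mult)
  have sq: "(norm x)\<^sup>2 = (\<Sum>i\<in>UNIV. (x $ i)\<^sup>2)" for x :: "real ^ 'n"
    by (simp add: norm_vec_def L2_set_def sum_nonneg)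
  have X: "exp (- (norm x)\<^sup>2 / 2) = (\<Prod>i\<in>UNIV. exp (- (x $ i)\<^sup>2 / 2))" for x :: "real ^ 'n"
    by (simp add: sq sum_negf sum_divide_distrib flip: exp_sum)
  have E': "E x = (\<Prod>i\<in>UNIV. of_real (exp (- (x $ i)\<^sup>2 / 2)))" for x
    unfolding E_def X by simp
  have E: "E x = of_real (sqrt (2 * pi) ^ CARD('n)) * (\<Prod>i\<in>UNIV. ?N (x $ i))" for x
    by (simp add: E' std_normal_density_def prod.distrib prod_dividef power_divide)
  show "integrable lborel E"
    unfolding E[abs_def] by (intro integrable_mult_right integrable_prod_coord N)
  have "exp (\<i> * of_real (x \<bullet> \<xi>)) * E x = of_real (sqrt (2 * pi) ^ CARD('n)) * (\<Prod>i\<in>UNIV. exp (\<i> * of_real (x $ i * \<xi> $ i)) * ?N (x $ i))" for x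
    by (simp add: E prod.distrib exp_sum[symmetric] inner_vec_def sum_distrib_left)
  then have "(LINT x|lborel. exp (\<i> * of_real (x \<bullet> \<xi>)) * E x) =
     of_real (sqrt (2 * pi) ^ CARD('n)) * (LINT x|lborel. (\<Prod>i\<in>UNIV. exp (\<i> * of_real ((x :: real ^ 'n) $ i * \<xi> $ i)) * ?N (x $ i)))"
    by simp
  also have "\<dots> = of_real (sqrt (2 * pi) ^ CARD('n)) * (\<Prod>i\<in>UNIV. of_real (exp (- (\<xi> $ i)\<^sup>2 / 2)))"
    by (subst integral_prod_coord[of "\<lambda>i t. exp (\<i> * of_real (t * \<xi> $ i)) * ?N t"])
      (use I iexp_N in auto)
  finally show "(LINT x|lborel. exp (\<i> * of_real (x \<bullet> \<xi>)) * E x) = of_real (sqrt (2 * pi) ^ CARD('n)) * E \<xi>"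
    by (simp only: E')
qed

text \<open>
  The inverse Fourier transform of \<open>\<lambda>\<xi>. \<psi> (2 ^ (- k) \<xi>)\<close> is tested against a Gaussian, and \<open>k\<close> tends to infinity.
\<close>

lemma integral_inv_fourier:
  fixes \<psi> :: "'n::finite cfun"
  assumes \<psi>: "\<psi> \<in> schwartz"
  shows "(LINT x|lborel. inv_fourier \<psi> x) = \<psi> 0"
proof -
  define E where "E x = complex_of_real (exp (- (norm x)\<^sup>2 / 2))" for x :: "real ^ 'n"
  define D where "D k x = (\<chi> i. (1 / 2) ^ k * x $ i)" for k :: nat and x :: "real ^ 'n"
  let ?C = "of_real (sqrt (2 * pi) ^ CARD('n)) :: complex"
  let ?c = "of_real ((2 * pi) powr - real CARD('n)) :: complex"
  have E: "integrable lborel E" "\<And>\<xi>. (LINT x|lborel. exp (\<i> * of_real (x \<bullet> \<xi>)) * E x) = ?C * E \<xi>"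
    unfolding E_def[abs_def] by (rule integrable_gaussian, rule integral_expi_gaussian)
  have E_cont: "continuous_on UNIV E"
    unfolding E_def by (intro continuous_intros) auto
  have E1: "norm (E x) \<le> 1" for x by (simp add: E_def)
  have D: "D k x = (1 / 2) ^ k *\<^sub>R x" for k x
    by (simp add: D_def vec_eq_iff)
  have D_lim: "(\<lambda>k. D k x) \<longlonglongrightarrow> 0" for x
    unfolding D by (auto intro!: tendsto_eq_intros LIMSEQ_power_zero)
  have ED_meas: "(\<lambda>x. E (D k x)) \<in> borel_measurable lborel" for k
    unfolding measurable_lborel2 D
    by (intro borel_measurable_continuous_onI continuous_on_compose2[OF E_cont] continuous_intros) auto
  have \<psi>D: "(\<lambda>\<xi>. \<psi> (D k \<xi>)) \<in> schwartz" for k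
    using schwartz_affine[OF \<psi>, of "\<lambda>i. (1 / 2) ^ k" 0] by (simp add: D_def)
  have h: "inv_fourier \<psi> \<in> schwartz" using \<psi> by (rule schwartz_inv_fourier)
  have h_meas: "inv_fourier \<psi> \<in> borel_measurable lborel"
    by (rule borel_measurable_integrable[OF schwartz_integrable[OF h]])
  \<comment> \<open>The dilation changes sides, from the Gaussian to \<psi>. As \<open>k\<close>
    grows, the left integrand loses the Gaussian while the right one loses \<psi>, up to their
    values at 0.\<close>
  have eq: "(LINT z|lborel. E (D k z) * inv_fourier \<psi> z) = (LINT \<xi>|lborel. ?c * ?C * (\<psi> (D k \<xi>) * E \<xi>))" for k
  proof -
    have hk: "inv_fourier (\<lambda>\<xi>. \<psi> (D k \<xi>)) \<in> schwartz"
      using \<psi>D by (rule schwartz_inv_fourier)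
    have I: "integrable lborel (\<lambda>x. E x * inv_fourier (\<lambda>\<xi>. \<psi> (D k \<xi>)) x)"
      by (rule Bochner_Integration.integrable_bound[OF schwartz_integrable[OF hk]
            borel_measurable_times[OF borel_measurable_integrable[OF E(1)]
              borel_measurable_integrable[OF schwartz_integrable[OF hk]]]])
        (simp add: norm_mult E1 mult_left_le_one_le)
    have "(LINT z|lborel. E (D k z) * inv_fourier \<psi> z) = (LINT x|lborel. E x * inv_fourier (\<lambda>\<xi>. \<psi> (D k \<xi>)) x)"
      unfolding D_def
      by (rule integral_mult_inv_fourier_diagonal[symmetric, OF schwartz_integrable[OF \<psi>]])
        (use I in \<open>auto simp: D_def\<close>)
    also have "\<dots> = (LINT x|lborel. ?c * (E x * (LINT \<xi>|lborel. exp (\<i> * of_real (x \<bullet> \<xi>)) * \<psi> (D k \<xi>))))"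
      by (simp add: inv_fourier_def mult_ac)
    also have "\<dots> = ?c * (LINT \<xi>|lborel. \<psi> (D k \<xi>) * (LINT x|lborel. exp (\<i> * of_real (x \<bullet> \<xi>)) * E x))"
      by (simp only: integral_mult_right_zero integral_expi_swap[OF E(1) schwartz_integrable[OF \<psi>D]])
    also have "\<dots> = (LINT \<xi>|lborel. ?c * (\<psi> (D k \<xi>) * (?C * E \<xi>)))"
      by (simp only: E(2) integral_mult_right_zero)
    finally show ?thesis by (simp only: mult_ac)
  qed
  have lim1: "(\<lambda>k. LINT z|lborel. E (D k z) * inv_fourier \<psi> z) \<longlonglongrightarrow> (LINT z|lborel. E 0 * inv_fourier \<psi> z)"
  proof (rule integral_dominated_convergence[where w="\<lambda>z. norm (inv_fourier \<psi> z)"])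
    have "(\<lambda>k. E (D k z)) \<longlonglongrightarrow> E 0" for z
      by (rule continuous_on_tendsto_compose[OF E_cont D_lim]) auto
    then show "AE z in lborel. (\<lambda>k. E (D k z) * inv_fourier \<psi> z) \<longlonglongrightarrow> E 0 * inv_fourier \<psi> z"
      by (intro AE_I2 tendsto_mult tendsto_const)
    show "AE z in lborel. norm (E (D k z) * inv_fourier \<psi> z) \<le> norm (inv_fourier \<psi> z)" for k
      using E1 by (auto simp: norm_mult mult_left_le_one_le)
    show "(\<lambda>z. E 0 * inv_fourier \<psi> z) \<in> borel_measurable lborel"
      by (rule borel_measurable_times[OF borel_measurable_const h_meas])
    show "(\<lambda>z. E (D k z) * inv_fourier \<psi> z) \<in> borel_measurable lborel" for k
      by (rule borel_measurable_times[OF ED_meas h_meas])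
  qed (rule integrable_norm[OF schwartz_integrable[OF h]])
  obtain K where K: "\<And>x. norm (\<psi> x) \<le> K * (1 + norm x) powr 0"
    using schwartz_poly_bounded[OF \<psi>, of 0] by (auto simp: poly_bounded_def)
  have lim2: "(\<lambda>k. LINT \<xi>|lborel. ?c * ?C * (\<psi> (D k \<xi>) * E \<xi>)) \<longlonglongrightarrow> (LINT \<xi>|lborel. ?c * ?C * (\<psi> 0 * E \<xi>))"
  proof (rule integral_dominated_convergence[where w="\<lambda>\<xi>. norm (?c * ?C) * (K * norm (E \<xi>))"])
    have "(\<lambda>k. \<psi> (D k z)) \<longlonglongrightarrow> \<psi> 0" for z
      by (rule continuous_on_tendsto_compose[OF smooth_continuous_on[OF schwartz_smooth[OF \<psi>], of UNIV] D_lim]) auto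
    then show "AE \<xi> in lborel. (\<lambda>k. ?c * ?C * (\<psi> (D k \<xi>) * E \<xi>)) \<longlonglongrightarrow> ?c * ?C * (\<psi> 0 * E \<xi>)"
      by (intro AE_I2 tendsto_mult tendsto_const)
    show "AE \<xi> in lborel. norm (?c * ?C * (\<psi> (D k \<xi>) * E \<xi>)) \<le> norm (?c * ?C) * (K * norm (E \<xi>))" for k
    proof (intro AE_I2)
      fix \<xi>
      have "norm (\<psi> (D k \<xi>)) * norm (E \<xi>) \<le> K * norm (E \<xi>)"
        using K[of "D k \<xi>"] by (intro mult_right_mono) auto
      then show "norm (?c * ?C * (\<psi> (D k \<xi>) * E \<xi>)) \<le> norm (?c * ?C) * (K * norm (E \<xi>))"
        unfolding norm_mult[of "?c * ?C"] norm_mult[of "\<psi> (D k \<xi>)"] by (rule mult_left_mono) simp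
    qed
    show "integrable lborel (\<lambda>\<xi>. norm (?c * ?C) * (K * norm (E \<xi>)))"
      by (intro integrable_mult_right integrable_norm E(1))
    show "(\<lambda>\<xi>. ?c * ?C * (\<psi> 0 * E \<xi>)) \<in> borel_measurable lborel"
      by (intro borel_measurable_times borel_measurable_const borel_measurable_integrable[OF E(1)])
    show "(\<lambda>\<xi>. ?c * ?C * (\<psi> (D k \<xi>) * E \<xi>)) \<in> borel_measurable lborel" for k
      by (intro borel_measurable_times borel_measurable_const borel_measurable_integrable[OF E(1)]
          borel_measurable_integrable[OF schwartz_integrable[OF \<psi>D]])
  qed
  have E_int: "(LINT \<xi>|lborel. E \<xi>) = ?C"
    using E(2)[of 0] by (simp add: E_def)
  \<comment> \<open>One factor \<open>?C\<close> comes from transforming the Gaussian, the other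
    from its total mass; together they cancel the normalization of
    \<open>inv_fourier\<close>.\<close>
  have cC: "?c * (?C * ?C) = 1"
  proof -
    have "sqrt (2 * pi) ^ CARD('n) * sqrt (2 * pi) ^ CARD('n) = (2 * pi) ^ CARD('n)"
      unfolding power_mult_distrib[symmetric] by simp
    moreover have "(2 * pi) powr - real CARD('n) * (2 * pi) ^ CARD('n) = 1"
      by (simp only: powr_minus powr_realpow pi_gt_zero mult_pos_pos zero_less_numeral) (simp add: field_simps)
    ultimately show ?thesis
      by (simp only: of_real_mult[symmetric]) simp
  qed
  have "(LINT \<xi>|lborel. ?c * ?C * (\<psi> 0 * E \<xi>)) = ?c * (?C * ?C) * \<psi> 0"
    unfolding integral_mult_right_zero E_int by (simp only: mult_ac)
  then have "(LINT \<xi>|lborel. ?c * ?C * (\<psi> 0 * E \<xi>)) = \<psi> 0"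
    by (simp only: cC mult_1)
  moreover have "(LINT z|lborel. E 0 * inv_fourier \<psi> z) = (LINT z|lborel. inv_fourier \<psi> z)"
    by (simp add: E_def)
  moreover have "(LINT z|lborel. E 0 * inv_fourier \<psi> z) = (LINT \<xi>|lborel. ?c * ?C * (\<psi> 0 * E \<xi>))"
    by (rule LIMSEQ_unique[OF lim1]) (simp only: eq lim2)
  ultimately show ?thesis by (simp only:)
qed

section \<open>Convolution with the kernel of a dilated cut-off\<close>

lemma
  fixes g h :: "'n::finite cfun"
  assumes g: "g \<in> slowly_increasing" and h: "h \<in> schwartz"
  shows integrable_convolution_left: "integrable lborel (\<lambda>y. g y * h (y - x))"
    and integrable_convolution_right: "integrable lborel (\<lambda>y. g y * h (x - y))"
    and integral_convolution_left: "(LINT y|lborel. g y * h (y - x)) = (LINT w|lborel. g (x + w) * h w)"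
    and integral_convolution_right: "(LINT y|lborel. g y * h (x - y)) = (LINT w|lborel. g (x - w) * h w)"
proof -
  have neg: "(\<chi> i. - (y $ i)) = - y" for y :: "real ^ 'n" by (simp add: vec_eq_iff)
  show I1: "integrable lborel (\<lambda>y. g y * h (y - x))"
    using schwartz_integrable[OF schwartz_mult_slowly_increasing[OF g schwartz_affine[OF h, of "\<lambda>_. 1" "- x"]]]
    by simp
  show I2: "integrable lborel (\<lambda>y. g y * h (x - y))"
    using schwartz_integrable[OF schwartz_mult_slowly_increasing[OF g schwartz_affine[OF h, of "\<lambda>_. -1" x]]]
    by (simp add: neg)
  show "(LINT y|lborel. g y * h (y - x)) = (LINT w|lborel. g (x + w) * h w)"
    using integral_affine[OF I1, of "\<lambda>_. 1" x] by simp
  show "(LINT y|lborel. g y * h (x - y)) = (LINT w|lborel. g (x - w) * h w)"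
    using integral_affine[OF I2, of "\<lambda>_. -1" x] by (simp add: neg)
qed

text \<open>Both orientations occur: \<open>x - y\<close> when a function is smoothed, and
  \<open>y - x\<close> when the smoothing of a distribution is transposed onto the test function.
  This is why one average shifts by \<open>- D z\<close> and the other by
  \<open>D z\<close>.\<close>

lemma
  fixes g \<psi> :: "'n::finite cfun" and d :: "'n \<Rightarrow> real"
  defines "D \<equiv> \<lambda>x :: real ^ 'n. \<chi> i. d i * x $ i"
  assumes g: "g \<in> slowly_increasing" and \<psi>: "\<psi> \<in> schwartz" and d: "\<And>i. 0 < d i"
  shows convolution_left_eq_mollify:
      "(LINT y|lborel. g y * inv_fourier (\<lambda>\<xi>. \<psi> (D \<xi>)) (y - x)) = mollify D (inv_fourier \<psi>) g x"
    and convolution_right_eq_mollify: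
      "(LINT y|lborel. g y * inv_fourier (\<lambda>\<xi>. \<psi> (D \<xi>)) (x - y)) = mollify (\<lambda>z. - D z) (inv_fourier \<psi>) g x"
proof -
  have d': "d i \<noteq> 0" for i using d[of i] by simp
  have "(\<lambda>\<xi>. \<psi> (D \<xi>)) \<in> schwartz"
    using schwartz_affine[OF \<psi> d', of 0] by (simp add: D_def)
  then have h: "inv_fourier (\<lambda>\<xi>. \<psi> (D \<xi>)) \<in> schwartz" by (rule schwartz_inv_fourier)
  have I1: "integrable lborel (\<lambda>w. g (x + w) * inv_fourier (\<lambda>\<xi>. \<psi> (D \<xi>)) w)"
    using integrable_affine[OF integrable_convolution_left[OF g h, of x], of "\<lambda>_. 1" x] by simp
  have I2: "integrable lborel (\<lambda>w. g (x - w) * inv_fourier (\<lambda>\<xi>. \<psi> (D \<xi>)) w)"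
  proof -
    have neg: "(\<chi> i. - (y $ i)) = - y" for y :: "real ^ 'n" by (simp add: vec_eq_iff)
    show ?thesis
      using integrable_affine[OF integrable_convolution_right[OF g h, of x], of "\<lambda>_. -1" x] by (simp add: neg)
  qed
  show "(LINT y|lborel. g y * inv_fourier (\<lambda>\<xi>. \<psi> (D \<xi>)) (y - x)) = mollify D (inv_fourier \<psi>) g x"
    unfolding integral_convolution_left[OF g h] mollify_def
    using integral_mult_inv_fourier_diagonal[OF schwartz_integrable[OF \<psi>] d I1[unfolded D_def]]
    by (simp add: D_def)
  show "(LINT y|lborel. g y * inv_fourier (\<lambda>\<xi>. \<psi> (D \<xi>)) (x - y)) = mollify (\<lambda>z. - D z) (inv_fourier \<psi>) g x"
    unfolding integral_convolution_right[OF g h] mollify_def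
    using integral_mult_inv_fourier_diagonal[OF schwartz_integrable[OF \<psi>] d I2[unfolded D_def]]
    by (simp add: D_def)
qed

subsection \<open>Tempered distributions\<close>

text \<open>The sum of suprema in the definition is traded for one common bound \<open>B\<close> of
  the weighted derivatives, the number of multi-indices going into the constant. In this form
  continuity can be applied as soon as pointwise estimates are known.\<close>

lemma temperedE:
  fixes u :: "'n::finite functional"
  assumes u: "u \<in> tempered"
  obtains C and N :: nat where "0 \<le> C"
    "\<And>\<phi> B. \<phi> \<in> schwartz \<Longrightarrow>
      (\<And>js x. length js \<le> N \<Longrightarrow> (1 + norm x) powr real N * norm (iter_partial js \<phi> x) \<le> B) \<Longrightarrow>
      norm (u \<phi>) \<le> C * B"
proof -
  obtain C N where C: "\<And>\<phi>. \<phi> \<in> schwartz \<Longrightarrow> norm (u \<phi>) \<le> C * (\<Sum>js | length js \<le> N.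
      SUP x. (1 + norm x) ^ N * norm (iter_partial js \<phi> x))"
    using u unfolding tempered_def by blast
  let ?J = "{js :: 'n list. length js \<le> N}"
  show ?thesis
  proof (rule that[of "\<bar>C\<bar> * card ?J" N])
    fix \<phi> :: "'n cfun" and B
    assume \<phi>: "\<phi> \<in> schwartz"
      and "\<And>js x. length js \<le> N \<Longrightarrow> (1 + norm x) powr real N * norm (iter_partial js \<phi> x) \<le> B"
    then have B: "(1 + norm x) ^ N * norm (iter_partial js \<phi> x) \<le> B" if "length js \<le> N" for js x
      using that by (simp add: powr_realpow)
    let ?S = "\<lambda>js. SUP x. (1 + norm x) ^ N * norm (iter_partial js \<phi> x)"
    have S: "0 \<le> ?S js" "?S js \<le> B" if "js \<in> ?J" for js
    proof -
      have "bdd_above (range (\<lambda>x. (1 + norm x) ^ N * norm (iter_partial js \<phi> x)))"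
        using B that by (intro bdd_aboveI[of _ B]) auto
      then show "0 \<le> ?S js"
        by (intro cSUP_upper2[of _ _ 0]) auto
      show "?S js \<le> B"
        using B that by (intro cSUP_least) auto
    qed
    have "norm (u \<phi>) \<le> C * (\<Sum>js\<in>?J. ?S js)"
      using C[OF \<phi>] .
    also have "\<dots> \<le> \<bar>C\<bar> * (\<Sum>js\<in>?J. ?S js)"
      by (intro mult_right_mono sum_nonneg S) auto
    also have "\<dots> \<le> \<bar>C\<bar> * (of_nat (card ?J) * B)"
      by (intro mult_left_mono sum_bounded_above S) auto
    finally show "norm (u \<phi>) \<le> \<bar>C\<bar> * real (card ?J) * B" by simp
  qed simp
qed

lemma tempered_add: "u \<in> tempered \<Longrightarrow> \<phi> \<in> schwartz \<Longrightarrow> \<eta> \<in> schwartz \<Longrightarrow> u (\<lambda>x. \<phi> x + \<eta> x) = u \<phi> + u \<eta>"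
  by (simp add: tempered_def linear_on_funs_def)

lemma tempered_cmult: "u \<in> tempered \<Longrightarrow> \<phi> \<in> schwartz \<Longrightarrow> u (\<lambda>x. c * \<phi> x) = c * u \<phi>"
  by (simp add: tempered_def linear_on_funs_def)

lemma tempered_diff: "u \<in> tempered \<Longrightarrow> \<phi> \<in> schwartz \<Longrightarrow> \<eta> \<in> schwartz \<Longrightarrow> u (\<lambda>x. \<phi> x - \<eta> x) = u \<phi> - u \<eta>"
  using tempered_add[of u \<phi> "\<lambda>x. -1 * \<eta> x"] tempered_cmult[of u \<eta> "-1"] schwartz_cmult[of \<eta> "-1"] by simp

lemma schwartz_zero: "(\<lambda>x. 0) \<in> schwartz"
  using schwartz_sum[of "{}"] by simp

lemma tempered_sum:
  assumes u: "u \<in> tempered" and "finite I" "\<And>i. i \<in> I \<Longrightarrow> F i \<in> schwartz"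
  shows "u (\<lambda>x. \<Sum>i\<in>I. F i x) = (\<Sum>i\<in>I. u (F i))"
  using assms(2,3)
proof (induction I rule: finite_induct)
  case empty
  show ?case using tempered_cmult[OF u schwartz_zero, of 0] by simp
next
  case (insert i I)
  then show ?case by (simp add: tempered_add[OF u] schwartz_sum)
qed

lemma iter_partial_sum:
  assumes "finite I" "\<And>i. i \<in> I \<Longrightarrow> F i \<in> schwartz"
  shows "iter_partial js (\<lambda>x. \<Sum>i\<in>I. F i x) = (\<lambda>x. \<Sum>i\<in>I. iter_partial js (F i) x)"
  using assms
proof (induction I rule: finite_induct)
  case empty
  show ?case by (simp add: iter_partial_const)
next
  case (insert i I)
  then show ?case by (simp add: iter_partial_add schwartz_smooth schwartz_sum)
qed

subsection \<open>Interchanging a tempered distribution with an integral\<close>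

text \<open>On each cell the integral differs from the volume times the value at the tag by at most
  \<open>e\<close> times the volume, and the volumes of the cells add up.\<close>

lemma tagged_division_integral_bound:
  fixes F :: "'a::euclidean_space \<Rightarrow> complex"
  assumes F: "continuous_on (cbox a b) F" and p: "p tagged_division_of cbox a b"
    and le: "\<And>t K y. (t, K) \<in> p \<Longrightarrow> y \<in> K \<Longrightarrow> norm (F y - F t) \<le> e" and "0 \<le> e"
  shows "norm (integral (cbox a b) F - (\<Sum>q\<in>p. measure lborel (snd q) *\<^sub>R F (fst q))) \<le> e * measure lborel (cbox a b)"
proof -
  have p_fin: "finite p" using p by blast
  have "norm (integral K F - measure lborel K *\<^sub>R F t) \<le> e * measure lborel K" if "(t, K) \<in> p" for t K
  proof -
    obtain c d where K: "K = cbox c d" using p \<open>(t, K) \<in> p\<close> by blast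
    have "K \<subseteq> cbox a b" using p \<open>(t, K) \<in> p\<close> by blast
    then have "F integrable_on K"
      unfolding K by (intro integrable_continuous continuous_on_subset[OF F])
    then have "((\<lambda>y. F y - F t) has_integral (integral K F - measure lborel K *\<^sub>R F t)) K"
      unfolding K by (intro has_integral_diff integrable_integral has_integral_const)
    then show ?thesis
      unfolding K by (rule has_integral_bound[OF \<open>0 \<le> e\<close>]) (use le that K in auto)
  qed
  then have "norm (\<Sum>q\<in>p. integral (snd q) F - measure lborel (snd q) *\<^sub>R F (fst q)) \<le> (\<Sum>q\<in>p. e * measure lborel (snd q))"
    by (intro sum_norm_le) auto
  also have "\<dots> = e * measure lborel (cbox a b)"
    using additive_content_tagged_division[OF p] by (simp add: sum_distrib_left[symmetric] case_prod_unfold)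
  finally show ?thesis
    using integral_combine_tagged_division_topdown[OF integrable_continuous[OF F] p]
    by (simp add: sum_subtractf case_prod_unfold)
qed

lemma
  fixes F :: "'a::euclidean_space \<Rightarrow> complex"
  assumes F: "continuous_on UNIV F" and 0: "\<And>x. x \<notin> cbox a b \<Longrightarrow> F x = 0"
  shows integrable_compact_support: "integrable lborel F"
    and integral_compact_support: "(LINT x|lborel. F x) = integral (cbox a b) F"
proof -
  have "integrable lborel (\<lambda>x. indicator (cbox a b) x *\<^sub>R F x)"
    by (intro borel_integrable_compact continuous_on_subset[OF F]) auto
  also have "(\<lambda>x. indicator (cbox a b) x *\<^sub>R F x) = F"
    using 0 by (auto simp: fun_eq_iff indicator_def)
  finally show I: "integrable lborel F" .
  have "(LINT x|lborel. F x) = integral UNIV F"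
    using has_integral_integral_lborel[OF I] by (simp add: integral_unique)
  also have "\<dots> = integral UNIV (\<lambda>x. if x \<in> cbox a b then F x else 0)"
    using 0 by (intro arg_cong[of _ _ "integral UNIV"]) auto
  also have "\<dots> = integral (cbox a b) F"
    by (rule integral_restrict_UNIV)
  finally show "(LINT x|lborel. F x) = integral (cbox a b) F" .
qed

lemma test_functions_cboxE:
  fixes \<phi> :: "'n::finite cfun"
  assumes "\<phi> \<in> test_functions"
  obtains a b where "\<And>x. x \<notin> cbox a b \<Longrightarrow> \<phi> x = 0"
proof -
  obtain a b where ab: "closure {x. \<phi> x \<noteq> 0} \<subseteq> cbox a b"
    using bounded_subset_cbox_symmetric[OF compact_imp_bounded[OF test_functions_compact_support[OF assms]]] by blast
  show ?thesis
  proof (rule that)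
    fix x assume "x \<notin> cbox a b"
    with ab have "x \<notin> closure {x. \<phi> x \<noteq> 0}" by blast
    from iter_partial_outside_support[OF this, of "[]"] show "\<phi> x = 0" by simp
  qed
qed

lemma schwartz_reflect:
  assumes "h \<in> schwartz"
  shows "(\<lambda>x. h (y - x)) \<in> schwartz"
proof -
  have "(\<chi> i. - (x $ i)) = - x" for x :: "real ^ 'a" by (simp add: vec_eq_iff)
  then show ?thesis
    using schwartz_affine[OF assms, of "\<lambda>_. -1" y] by simp
qed

text \<open>\<open>s\<close> is the sign \<open>(-1) ^ length js\<close>. It depends neither on
  \<open>g\<close> nor on \<open>y\<close>, so it can be pulled out of sums and integrals over
  translates and disappears under the norm.\<close>

lemma iter_partial_reflectE:
  fixes js :: "'n::finite list"
  obtains s where "norm s = 1"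
    "\<And>g y. smooth g \<Longrightarrow> iter_partial js (\<lambda>x. g (y - x)) = (\<lambda>x. s * iter_partial js g (y - x))"
proof (rule that)
  show "norm (complex_of_real (prod_list (map (\<lambda>_. -1) js))) = 1"
    by (induction js) (auto simp: norm_mult)
  have "(\<chi> i. - (x $ i)) = - x" for x :: "real ^ 'n" by (simp add: vec_eq_iff)
  then show "iter_partial js (\<lambda>x. g (y - x)) =
      (\<lambda>x. complex_of_real (prod_list (map (\<lambda>_. -1) js)) * iter_partial js g (y - x))"
    if "smooth g" for g y
    using iter_partial_affine[OF that, of js y "\<lambda>_. -1"] by simp
qed

text \<open>By Peetre's inequality the weight at \<open>x\<close> is at most the weight at
  \<open>t\<close> times the weight at \<open>t - x\<close>, and the decay of \<open>h\<close>
  cancels the latter. The second bound combines this with the mean value estimate, which costs one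
  more derivative of \<open>h\<close>.\<close>

lemma schwartz_translation_bound:
  fixes h :: "'n::finite cfun" and N :: nat
  assumes h: "h \<in> schwartz"
  obtains C where "0 \<le> C"
    "\<And>js x t. length js \<le> N \<Longrightarrow>
      (1 + norm x) powr real N * norm (iter_partial js h (t - x)) \<le> C * (1 + norm t) powr real N"
    "\<And>js x y t. length js \<le> N \<Longrightarrow>
      (1 + norm x) powr real N * norm (iter_partial js h (y - x) - iter_partial js h (t - x))
      \<le> C * (1 + norm t) powr real N * (1 + norm (y - t)) powr real N * norm (y - t)"
proof -
  show ?thesis using h
  proof (rule schwartz_uniform[where N="Suc N" and a="- real N"])
    fix C assume "0 \<le> C" and
      C: "\<And>js x. length js \<le> Suc N \<Longrightarrow> norm (iter_partial js h x) \<le> C * (1 + norm x) powr - real N"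
    have weight: "(1 + norm x) powr real N * (1 + norm (t - x)) powr - real N \<le> (1 + norm t) powr real N" for x t :: "real ^ 'n"
    proof -
      have "(1 + norm x) powr real N \<le> (1 + norm (x - t)) powr real N * (1 + norm t) powr real N"
        using powr_norm_add_le[of "x - t" t "real N"] by simp
      then have "(1 + norm x) powr real N * (1 + norm (t - x)) powr - real N \<le>
          (1 + norm (x - t)) powr real N * (1 + norm t) powr real N * (1 + norm (t - x)) powr - real N"
        by (rule mult_right_mono) simp
      also have "\<dots> = (1 + norm t) powr real N"
        by (simp add: norm_minus_commute[of t] powr_minus)
      finally show ?thesis .
    qed
    \<comment> \<open>Large enough for both estimates: \<open>C\<close> serves the first,
      \<open>CARD('n) * C\<close> from the mean value inequality the second.\<close>
    define D where "D = (CARD('n) + 1) * C"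
    have D: "C \<le> D" "CARD('n) * C \<le> D" using \<open>0 \<le> C\<close> by (auto simp: D_def algebra_simps)
    show ?thesis
    proof (rule that[of D])
      show "0 \<le> D" using D \<open>0 \<le> C\<close> by linarith
      fix js :: "'n list" and x t :: "real ^ 'n"
      assume js: "length js \<le> N"
      have "(1 + norm x) powr real N * norm (iter_partial js h (t - x)) \<le>
          (1 + norm x) powr real N * (C * (1 + norm (t - x)) powr - real N)"
        by (intro mult_left_mono C) (use js in auto)
      also have "\<dots> = C * ((1 + norm x) powr real N * (1 + norm (t - x)) powr - real N)"
        by simp
      also have "\<dots> \<le> D * (1 + norm t) powr real N"
        by (intro mult_mono weight D) (use \<open>0 \<le> C\<close> D in auto)
      finally show "(1 + norm x) powr real N * norm (iter_partial js h (t - x)) \<le> D * (1 + norm t) powr real N" .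
      fix y :: "real ^ 'n"
      have "norm (iter_partial js h ((t - x) + (y - t)) - iter_partial js h (t - x)) \<le>
          CARD('n) * C * (1 + norm (t - x)) powr - real N * (1 + norm (y - t)) powr \<bar>- real N\<bar> * norm (y - t)"
        using C[of "j # js" for j] js schwartz_smooth[OF h]
        by (intro norm_diff_le_partial) (auto simp: smooth_iter_differentiable)
      then have "norm (iter_partial js h (y - x) - iter_partial js h (t - x)) \<le>
          CARD('n) * C * (1 + norm (t - x)) powr - real N * (1 + norm (y - t)) powr real N * norm (y - t)"
        by simp
      then have "(1 + norm x) powr real N * norm (iter_partial js h (y - x) - iter_partial js h (t - x)) \<le>
          (1 + norm x) powr real N * (CARD('n) * C * (1 + norm (t - x)) powr - real N * (1 + norm (y - t)) powr real N * norm (y - t))"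
        by (rule mult_left_mono) simp
      also have "\<dots> = CARD('n) * C * ((1 + norm x) powr real N * (1 + norm (t - x)) powr - real N) *
          ((1 + norm (y - t)) powr real N * norm (y - t))"
        by (simp only: mult_ac)
      also have "\<dots> \<le> D * (1 + norm t) powr real N * ((1 + norm (y - t)) powr real N * norm (y - t))"
        by (intro mult_right_mono mult_mono weight D) (use \<open>0 \<le> C\<close> D in auto)
      finally show "(1 + norm x) powr real N * norm (iter_partial js h (y - x) - iter_partial js h (t - x))
        \<le> D * (1 + norm t) powr real N * (1 + norm (y - t)) powr real N * norm (y - t)"
        by (simp only: mult_ac)
    qed
  qed
qed

text \<open>The seminorm controlling \<open>u\<close> separates two translates of \<open>h\<close>
  by at most a constant times \<open>|y - t|\<close> when \<open>y\<close> is near \<open>t\<close>.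
  Continuity is what makes this function eligible as the value of \<open>fun_of\<close>.\<close>

lemma tempered_reflect_continuous:
  fixes u :: "'n::finite functional"
  assumes u: "u \<in> tempered" and h: "h \<in> schwartz"
  shows "continuous_on UNIV (\<lambda>y. u (\<lambda>x. h (y - x)))"
  using u
proof (rule temperedE)
  fix Cu :: real and N :: nat
  assume Cu: "0 \<le> Cu" and bound: "\<And>\<phi> B. \<phi> \<in> schwartz \<Longrightarrow>
      (\<And>js x. length js \<le> N \<Longrightarrow> (1 + norm x) powr real N * norm (iter_partial js \<phi> x) \<le> B) \<Longrightarrow>
      norm (u \<phi>) \<le> Cu * B"
  show ?thesis using h
  proof (rule schwartz_translation_bound[where N=N])
    fix C :: real
    assume C: "0 \<le> C"
      "\<And>js x y t. length js \<le> N \<Longrightarrow>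
        (1 + norm x) powr real N * norm (iter_partial js h (y - x) - iter_partial js h (t - x))
        \<le> C * (1 + norm t) powr real N * (1 + norm (y - t)) powr real N * norm (y - t)"
    have le: "norm (u (\<lambda>x. h (y - x)) - u (\<lambda>x. h (t - x))) \<le>
        Cu * (C * (1 + norm t) powr real N * (1 + norm (y - t)) powr real N * norm (y - t))" for y t
      unfolding tempered_diff[OF u schwartz_reflect[OF h] schwartz_reflect[OF h], symmetric]
    proof (rule bound[OF schwartz_diff[OF schwartz_reflect[OF h] schwartz_reflect[OF h]]])
      fix js :: "'n list" and x :: "real ^ 'n" assume js: "length js \<le> N"
      obtain s where s: "norm s = 1" "\<And>g y. smooth g \<Longrightarrow> iter_partial js (\<lambda>x. g (y - x)) = (\<lambda>x. s * iter_partial js g (y - x))"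
        by (rule iter_partial_reflectE[of js]) (rule that)
      have "iter_partial js (\<lambda>x. h (y - x) - h (t - x)) x = s * (iter_partial js h (y - x) - iter_partial js h (t - x))"
        by (simp add: iter_partial_diff schwartz_smooth schwartz_reflect[OF h] s(2)[OF schwartz_smooth[OF h]] right_diff_distrib)
      then show "(1 + norm x) powr real N * norm (iter_partial js (\<lambda>x. h (y - x) - h (t - x)) x)
        \<le> C * (1 + norm t) powr real N * (1 + norm (y - t)) powr real N * norm (y - t)"
        using C(2)[OF js, of x y t] by (simp add: norm_mult s(1))
    qed
    have "isCont (\<lambda>y. u (\<lambda>x. h (y - x))) t" for t
    proof -
      have "((\<lambda>y. Cu * (C * (1 + norm t) powr real N * (1 + norm (y - t)) powr real N * norm (y - t))) \<longlongrightarrow>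
          Cu * (C * (1 + norm t) powr real N * (1 + norm (t - t)) powr real N * norm (t - t))) (at t)"
        by (intro tendsto_intros) auto
      then have "((\<lambda>y. Cu * (C * (1 + norm t) powr real N * (1 + norm (y - t)) powr real N * norm (y - t))) \<longlongrightarrow> 0) (at t)"
        by simp
      then have "((\<lambda>y. u (\<lambda>x. h (y - x)) - u (\<lambda>x. h (t - x))) \<longlongrightarrow> 0) (at t)"
        by (rule Lim_null_comparison[rotated]) (use le in \<open>auto intro!: always_eventually\<close>)
      then show ?thesis
        unfolding isCont_def by (rule LIM_zero_cancel)
    qed
    then show ?thesis
      by (intro continuous_at_imp_continuous_on) auto
  qed
qed

text \<open>Uniform continuity, on a compact set, of the map from \<open>y\<close> to the function
  \<open>\<phi> y * h (y - x)\<close> of \<open>x\<close>, measured in one Schwartz seminorm. A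
  single \<open>d\<close> serves all \<open>js\<close> and all \<open>x\<close>, so it can later be
  the mesh of a Riemann sum.\<close>

lemma translation_modulus:
  fixes h \<phi> :: "'n::finite cfun" and N :: nat
  assumes h: "h \<in> schwartz" and \<phi>: "continuous_on B \<phi>" and B: "compact B" and "0 < e"
  obtains d where "0 < d"
    "\<And>js x y t. length js \<le> N \<Longrightarrow> y \<in> B \<Longrightarrow> t \<in> B \<Longrightarrow> dist y t < d \<Longrightarrow>
      (1 + norm x) powr real N * norm (\<phi> y * iter_partial js h (y - x) - \<phi> t * iter_partial js h (t - x)) \<le> e"
  using h
proof (rule schwartz_translation_bound[where N=N])
  fix C :: real
  assume "0 \<le> C" and C1: "\<And>js x t. length js \<le> N \<Longrightarrow>
      (1 + norm x) powr real N * norm (iter_partial js h (t - x)) \<le> C * (1 + norm t) powr real N"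
    and C2: "\<And>js x y t. length js \<le> N \<Longrightarrow>
      (1 + norm x) powr real N * norm (iter_partial js h (y - x) - iter_partial js h (t - x))
      \<le> C * (1 + norm t) powr real N * (1 + norm (y - t)) powr real N * norm (y - t)"
  obtain R where R: "0 < R" "\<And>y. y \<in> B \<Longrightarrow> norm y \<le> R"
    using compact_imp_bounded[OF B] by (auto simp: bounded_pos)
  obtain K where K: "0 < K" "\<And>y. y \<in> B \<Longrightarrow> norm (\<phi> y) \<le> K"
    using compact_imp_bounded[OF compact_continuous_image[OF \<phi> B]] by (auto simp: bounded_pos)
  define A where "A = C * (1 + R) powr real N"
  define P where "P = K * (A * 2 powr real N)"
  have "0 \<le> A" "0 \<le> P" using \<open>0 \<le> C\<close> K R by (auto simp: A_def P_def)
  obtain d1 where d1: "0 < d1" "\<And>y t. y \<in> B \<Longrightarrow> t \<in> B \<Longrightarrow> dist y t < d1 \<Longrightarrow> dist (\<phi> y) (\<phi> t) < e / (2 * (A + 1))"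
    using compact_uniformly_continuous[OF \<phi> B] \<open>0 < e\<close> \<open>0 \<le> A\<close> unfolding uniformly_continuous_on_def
    by (metis (no_types, lifting) add_nonneg_pos divide_pos_pos dist_commute mult_pos_pos zero_less_numeral zero_less_one)
  \<comment> \<open>\<open>d1\<close> and the third entry each leave an error of at most
    \<open>e / 2\<close>; the bound 1 keeps \<open>1 + |y - t|\<close> below 2. Adding 1 to
    \<open>A\<close> and \<open>P\<close> avoids division by zero.\<close>
  define d where "d = min 1 (min d1 (e / (2 * (P + 1))))"
  show ?thesis
  proof (rule that[of d])
    show "0 < d" using d1(1) \<open>0 < e\<close> \<open>0 \<le> P\<close> by (simp add: d_def)
    fix js :: "'n list" and x y t assume js: "length js \<le> N" and B: "y \<in> B" "t \<in> B" and "dist y t < d"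
    then have y: "norm (y - t) \<le> 1" "norm (y - t) \<le> e / (2 * (P + 1))" "dist y t < d1"
      by (auto simp: d_def dist_norm)
    have \<phi>': "norm (\<phi> y - \<phi> t) \<le> e / (2 * (A + 1))"
      using d1(2)[OF B y(3)] by (simp add: dist_norm)
    have t: "(1 + norm t) powr real N \<le> (1 + R) powr real N"
      using R(2)[OF B(2)] by (intro powr_mono2) auto
    let ?w = "(1 + norm x) powr real N" and ?D = "\<lambda>y. iter_partial js h (y - x)"
    have "?w * norm (?D t) \<le> A"
      unfolding A_def by (rule order_trans[OF C1[OF js] mult_left_mono[OF t \<open>0 \<le> C\<close>]])
    then have 1: "norm (\<phi> y - \<phi> t) * (?w * norm (?D t)) \<le> e / (2 * (A + 1)) * A"
      using \<phi>' \<open>0 \<le> A\<close> \<open>0 < e\<close> by (intro mult_mono) auto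
    have "?w * norm (?D y - ?D t) \<le> C * (1 + norm t) powr real N * (1 + norm (y - t)) powr real N * norm (y - t)"
      by (rule C2[OF js])
    also have "\<dots> \<le> A * 2 powr real N * norm (y - t)"
      unfolding A_def using y(1) \<open>0 \<le> C\<close>
      by (intro mult_right_mono mult_mono mult_left_mono t powr_mono2) auto
    finally have "norm (\<phi> y) * (?w * norm (?D y - ?D t)) \<le> K * (A * 2 powr real N * norm (y - t))"
      by (rule mult_mono[OF K(2)[OF B(1)]]) (use K in auto)
    also have "\<dots> = P * norm (y - t)"
      by (simp add: P_def)
    also have "\<dots> \<le> P * (e / (2 * (P + 1)))"
      by (intro mult_left_mono y \<open>0 \<le> P\<close>)
    finally have 2: "norm (\<phi> y) * (?w * norm (?D y - ?D t)) \<le> P * (e / (2 * (P + 1)))" .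
    have half: "Q * (e / (2 * (Q + 1))) \<le> e / 2" if "0 \<le> Q" for Q
      using that \<open>0 < e\<close> by (simp add: field_simps)
    \<comment> \<open>The two sources of variation are separated: first the translate changes, then
      the coefficient.\<close>
    have "\<phi> y * ?D y - \<phi> t * ?D t = \<phi> y * (?D y - ?D t) + (\<phi> y - \<phi> t) * ?D t"
      by (simp add: algebra_simps)
    then have "norm (\<phi> y * ?D y - \<phi> t * ?D t) \<le> norm (\<phi> y) * norm (?D y - ?D t) + norm (\<phi> y - \<phi> t) * norm (?D t)"
      by (metis norm_mult norm_triangle_ineq)
    then have "?w * norm (\<phi> y * ?D y - \<phi> t * ?D t) \<le> ?w * (norm (\<phi> y) * norm (?D y - ?D t) + norm (\<phi> y - \<phi> t) * norm (?D t))"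
      by (rule mult_left_mono) simp
    also have "\<dots> = norm (\<phi> y) * (?w * norm (?D y - ?D t)) + norm (\<phi> y - \<phi> t) * (?w * norm (?D t))"
      by (simp only: distrib_left mult_ac)
    also have "\<dots> \<le> P * (e / (2 * (P + 1))) + A * (e / (2 * (A + 1)))"
      using 1 2 by (intro add_mono) (simp_all only: mult_ac)
    also have "\<dots> \<le> e"
      using half[OF \<open>0 \<le> P\<close>] half[OF \<open>0 \<le> A\<close>] by linarith
    finally show "?w * norm (\<phi> y * ?D y - \<phi> t * ?D t) \<le> e" .
  qed
qed

text \<open>Both sides are compared with the same Riemann sum over a fine tagged division.\<close>

lemma tempered_integral:
  fixes u :: "'n::finite functional"
  assumes u: "u \<in> tempered" and h: "h \<in> schwartz" and \<phi>: "\<phi> \<in> test_functions"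
  shows "(\<lambda>x. LINT y|lborel. \<phi> y * h (y - x)) \<in> schwartz"
    and "u (\<lambda>x. LINT y|lborel. \<phi> y * h (y - x)) = (LINT y|lborel. \<phi> y * u (\<lambda>x. h (y - x)))"
proof -
  define \<theta> where "\<theta> x = (LINT y|lborel. \<phi> y * h (y - x))" for x
  define v where "v y = u (\<lambda>x. h (y - x))" for y
  have \<phi>S: "\<phi> \<in> schwartz" using \<phi> by (rule test_functions_in_schwartz)
  have \<phi>_cont: "continuous_on S \<phi>" for S
    by (intro smooth_continuous_on test_functions_smooth \<phi>)
  let ?m = "mollify (\<lambda>z. z) \<phi>"
  have m: "?m h \<in> schwartz" using h by (intro schwartz_mollify \<phi>S) auto
  \<comment> \<open>The roles are exchanged: \<phi> is taken as the kernel and \<open>h\<close> as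
    the averaged function, so the results on \<open>mollify\<close> give smoothness, decay and
    differentiation under the integral.\<close>
  have \<theta>: "\<theta> = (\<lambda>x. ?m h (0 - x))"
    by (simp add: \<theta>_def mollify_def fun_eq_iff mult.commute)
  show "(\<lambda>x. LINT y|lborel. \<phi> y * h (y - x)) \<in> schwartz"
    using schwartz_reflect[OF m, of 0] unfolding \<theta>[symmetric] \<theta>_def[abs_def] .
  then have \<theta>S: "\<theta> \<in> schwartz" by (simp add: \<theta>_def[abs_def])
  note hS = schwartz_reflect[OF h]
  obtain a b where ab: "\<And>x. x \<notin> cbox a b \<Longrightarrow> \<phi> x = 0"
    using test_functions_cboxE[OF \<phi>] by blast
  have "u \<theta> = (LINT y|lborel. \<phi> y * v y)"
    using u
  proof (rule temperedE)
    fix Cu :: real and N :: nat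
    assume Cu: "0 \<le> Cu" and bound: "\<And>\<phi> B. \<phi> \<in> schwartz \<Longrightarrow>
        (\<And>js x. length js \<le> N \<Longrightarrow> (1 + norm x) powr real N * norm (iter_partial js \<phi> x) \<le> B) \<Longrightarrow>
        norm (u \<phi>) \<le> Cu * B"
    have v_cont: "continuous_on S (\<lambda>y. \<phi> y * v y)" for S
      unfolding v_def
      by (intro continuous_on_mult \<phi>_cont continuous_on_subset[OF tempered_reflect_continuous[OF u h]]) auto
    have "norm (u \<theta> - (LINT y|lborel. \<phi> y * v y)) \<le> 2 * Cu * measure lborel (cbox a b) * e" if "0 < e" for e
    proof (rule translation_modulus[OF h \<phi>_cont[of "cbox a b"] compact_cbox that, where N=N])
      fix d :: real
      assume "0 < d" and d: "\<And>js x y t. length js \<le> N \<Longrightarrow> y \<in> cbox a b \<Longrightarrow> t \<in> cbox a b \<Longrightarrow> dist y t < d \<Longrightarrow>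
        (1 + norm x) powr real N * norm (\<phi> y * iter_partial js h (y - x) - \<phi> t * iter_partial js h (t - x)) \<le> e"
      obtain p where p: "p tagged_division_of cbox a b" "(\<lambda>x. ball x d) fine p"
        using fine_division_exists[OF gauge_ball[OF \<open>0 < d\<close>]] by blast
      have p_fin: "finite p" using p(1) by blast
      have near: "y \<in> cbox a b" "t \<in> cbox a b" "dist y t < d" if "(t, K) \<in> p" "y \<in> K" for t K y
        using tagged_division_ofD(2,3)[OF p(1) that(1)] fineD[OF p(2) that(1)] that(2)
        by (auto simp: dist_commute)
      \<comment> \<open>The Riemann sum is a finite combination of translates of \<open>h\<close>,
        so \<open>u\<close> can be applied to it by linearity alone.\<close>
      define s where "s x = (\<Sum>q\<in>p. complex_of_real (measure lborel (snd q)) * \<phi> (fst q) * h (fst q - x))" for x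
      have termS: "(\<lambda>x. complex_of_real (measure lborel (snd q)) * \<phi> (fst q) * h (fst q - x)) \<in> schwartz" for q
        by (intro schwartz_cmult hS)
      have sS: "s \<in> schwartz"
        unfolding s_def by (intro schwartz_sum p_fin termS)
      have us: "u s = (\<Sum>q\<in>p. measure lborel (snd q) *\<^sub>R (\<phi> (fst q) * v (fst q)))"
        unfolding s_def[abs_def] tempered_sum[OF u p_fin termS] tempered_cmult[OF u hS] v_def
        by (simp add: scaleR_conv_of_real mult.assoc)
      have "norm (\<phi> y * v y - \<phi> t * v t) \<le> Cu * e" if "(t, K) \<in> p" "y \<in> K" for t K y
      proof -
        have "\<phi> y * v y - \<phi> t * v t = u (\<lambda>x. \<phi> y * h (y - x) - \<phi> t * h (t - x))"
          unfolding v_def tempered_diff[OF u schwartz_cmult[OF hS] schwartz_cmult[OF hS]] tempered_cmult[OF u hS] ..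
        also have "norm \<dots> \<le> Cu * e"
        proof (rule bound[OF schwartz_diff[OF schwartz_cmult[OF hS] schwartz_cmult[OF hS]]])
          fix js :: "'n list" and x :: "real ^ 'n" assume js: "length js \<le> N"
          obtain c where c: "norm c = 1" "\<And>g y. smooth g \<Longrightarrow> iter_partial js (\<lambda>x. g (y - x)) = (\<lambda>x. c * iter_partial js g (y - x))"
            by (rule iter_partial_reflectE[of js]) (rule that)
          have "iter_partial js (\<lambda>x. \<phi> y * h (y - x) - \<phi> t * h (t - x)) x =
              c * (\<phi> y * iter_partial js h (y - x) - \<phi> t * iter_partial js h (t - x))"
            by (simp add: iter_partial_diff iter_partial_cmult smooth_cmult schwartz_smooth hS c(2)[OF schwartz_smooth[OF h]] algebra_simps)
          then show "(1 + norm x) powr real N * norm (iter_partial js (\<lambda>x. \<phi> y * h (y - x) - \<phi> t * h (t - x)) x) \<le> e"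
            using d[OF js near[OF that], of x] by (simp add: norm_mult c(1))
        qed
        finally show ?thesis .
      qed
      from tagged_division_integral_bound[OF v_cont p(1) this]
      have 1: "norm ((LINT y|lborel. \<phi> y * v y) - u s) \<le> Cu * e * measure lborel (cbox a b)"
        using Cu \<open>0 < e\<close> ab us by (subst integral_compact_support[OF v_cont, of a b]) auto
      have "u \<theta> - u s = u (\<lambda>x. \<theta> x - s x)"
        by (rule tempered_diff[OF u \<theta>S sS, symmetric])
      also have "norm \<dots> \<le> Cu * (e * measure lborel (cbox a b))"
      proof (rule bound[OF schwartz_diff[OF \<theta>S sS]])
        fix js :: "'n list" and x :: "real ^ 'n" assume js: "length js \<le> N"
        let ?w = "(1 + norm x) powr real N"
        obtain c where c: "norm c = 1" "\<And>g y. smooth g \<Longrightarrow> iter_partial js (\<lambda>x. g (y - x)) = (\<lambda>x. c * iter_partial js g (y - x))"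
          by (rule iter_partial_reflectE[of js]) (rule that)
        let ?F = "\<lambda>y. \<phi> y * iter_partial js h (y - x)"
        have F_cont: "continuous_on S ?F" for S
          by (intro continuous_on_mult \<phi>_cont smooth_continuous_on schwartz_smooth schwartz_iter_partial h
              continuous_on_compose2[OF smooth_continuous_on[OF schwartz_smooth[OF schwartz_iter_partial[OF h]], of UNIV]]
              continuous_intros) auto
        have "iter_partial js (?m h) = ?m (iter_partial js h)"
          by (rule iter_partial_mollify[OF _ _ \<phi>S schwartz_imp_slowly_increasing[OF h]]) auto
        then have "iter_partial js \<theta> x = c * (LINT y|lborel. ?F y)"
          unfolding \<theta> c(2)[OF schwartz_smooth[OF m]] by (simp add: mollify_def mult.commute)
        also have "(LINT y|lborel. ?F y) = integral (cbox a b) ?F"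
          by (rule integral_compact_support[OF F_cont]) (use ab in auto)
        finally have \<theta>': "iter_partial js \<theta> x = c * integral (cbox a b) ?F" .
        have s': "iter_partial js s x = c * (\<Sum>q\<in>p. measure lborel (snd q) *\<^sub>R ?F (fst q))"
          unfolding s_def[abs_def] iter_partial_sum[OF p_fin termS] iter_partial_cmult[OF schwartz_smooth[OF hS]]
            c(2)[OF schwartz_smooth[OF h]]
          by (simp add: sum_distrib_left scaleR_conv_of_real mult_ac)
        have "iter_partial js (\<lambda>x. \<theta> x - s x) x = c * (integral (cbox a b) ?F - (\<Sum>q\<in>p. measure lborel (snd q) *\<^sub>R ?F (fst q)))"
          using \<theta>' s' by (simp add: iter_partial_diff schwartz_smooth \<theta>S sS right_diff_distrib)
        then have "norm (iter_partial js (\<lambda>x. \<theta> x - s x) x) = norm (integral (cbox a b) ?F - (\<Sum>q\<in>p. measure lborel (snd q) *\<^sub>R ?F (fst q)))"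
          by (simp only: norm_mult c(1) mult_1)
        \<comment> \<open>For fixed \<open>x\<close> the weight is a constant, so the weighted
          modulus becomes an ordinary oscillation bound with \<open>e / ?w\<close>.\<close>
        also have "\<dots> \<le> e / ?w * measure lborel (cbox a b)"
        proof (rule tagged_division_integral_bound[OF F_cont p(1)])
          fix t K y assume "(t, K) \<in> p" "y \<in> K"
          from d[OF js near[OF this], of x] show "norm (?F y - ?F t) \<le> e / ?w"
            by (simp add: field_simps)
        qed (use \<open>0 < e\<close> in simp)
        finally show "?w * norm (iter_partial js (\<lambda>x. \<theta> x - s x) x) \<le> e * measure lborel (cbox a b)"
          by (simp add: field_simps)
      qed
      finally have 2: "norm (u \<theta> - u s) \<le> Cu * (e * measure lborel (cbox a b))" .
      have "norm (u \<theta> - (LINT y|lborel. \<phi> y * v y)) \<le> norm (u \<theta> - u s) + norm ((LINT y|lborel. \<phi> y * v y) - u s)"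
        using norm_triangle_ineq4[of "u \<theta> - u s" "(LINT y|lborel. \<phi> y * v y) - u s"] by simp
      also have "\<dots> \<le> 2 * Cu * measure lborel (cbox a b) * e"
        using 1 2 by (simp add: mult_ac)
      finally show "norm (u \<theta> - (LINT y|lborel. \<phi> y * v y)) \<le> 2 * Cu * measure lborel (cbox a b) * e" .
    qed
    moreover have "((\<lambda>e. 2 * Cu * measure lborel (cbox a b) * e) \<longlongrightarrow> 0) (at_right 0)"
      by (auto intro!: tendsto_eq_intros)
    ultimately have "norm (u \<theta> - (LINT y|lborel. \<phi> y * v y)) \<le> 0"
      by (intro tendsto_lowerbound[where F="at_right (0::real)"])
        (auto intro: eventually_mono[OF eventually_at_right_less[of "0::real"]])
    then show ?thesis by simp
  qed
  then show "u (\<lambda>x. LINT y|lborel. \<phi> y * h (y - x)) = (LINT y|lborel. \<phi> y * u (\<lambda>x. h (y - x)))"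
    by (simp add: \<theta>_def[abs_def] v_def)
qed

subsection \<open>Bump functions and the uniqueness of continuous representatives\<close>

text \<open>With \<open>s = 1 / t\<close>, differentiating \<open>p(s) exp(-s)\<close> in
  \<open>t\<close> gives \<open>s^2 (p(s) - p'(s)) exp(-s)\<close>. So these are the polynomials in
  \<open>1 / t\<close> that occur in the derivatives of \<open>exp (- 1 / t)\<close>.\<close>

fun flat_poly :: "nat \<Rightarrow> real poly" where
  "flat_poly 0 = 1"
| "flat_poly (Suc n) = [:0, 0, 1:] * (flat_poly n - pderiv (flat_poly n))"

definition flat :: "nat \<Rightarrow> real \<Rightarrow> real" where
  "flat n t = (if t \<le> 0 then 0 else poly (flat_poly n) (1 / t) * exp (- 1 / t))"

lemma tendsto_poly_times_exp_minus:
  fixes p :: "real poly"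
  shows "((\<lambda>s. s ^ k * poly p s * exp (- s)) \<longlongrightarrow> 0) at_top"
proof (induction p arbitrary: k)
  case (pCons a p)
  have "((\<lambda>s::real. a * (s ^ k / exp s) + s ^ Suc k * poly p s * exp (- s)) \<longlongrightarrow> a * 0 + 0) at_top"
    by (intro tendsto_add tendsto_mult tendsto_const tendsto_power_div_exp_0 pCons.IH)
  then show ?case
    by (simp add: exp_minus field_simps)
qed simp

lemma DERIV_flat: "(flat n has_real_derivative flat (Suc n) t) (at t)"
proof (cases t "0 :: real" rule: linorder_cases)
  case less
  have "((\<lambda>_. 0) has_real_derivative 0) (at t)" by simp
  then have "(flat n has_real_derivative 0) (at t)"
    by (rule has_field_derivative_transform_within_open[of _ _ _ "{..<0}"]) (use less in \<open>auto simp: flat_def\<close>)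
  then show ?thesis using less by (simp add: flat_def)
next
  case greater
  have "((\<lambda>t. poly (flat_poly n) (1 / t) * exp (- 1 / t)) has_real_derivative flat (Suc n) t) (at t)"
    using greater
    by (auto intro!: derivative_eq_intros DERIV_chain2[OF poly_DERIV] simp: flat_def field_simps power2_eq_square)
  then show ?thesis
    by (rule has_field_derivative_transform_within_open[of _ _ _ "{0<..}"]) (use greater in \<open>auto simp: flat_def\<close>)
next
  case equal
  have "((\<lambda>h. flat n h / h) \<longlongrightarrow> 0) (at_left 0)"
    by (rule tendsto_eventually) (auto simp: flat_def eventually_at_filter)
  \<comment> \<open>Substituting \<open>h = 1 / s\<close> turns the difference quotient at 0 into
    \<open>s\<close> times a polynomial in \<open>s\<close> times \<open>exp (- s)\<close>, which
    tends to 0 at infinity.\<close>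
  moreover have "((\<lambda>h. flat n h / h) \<longlongrightarrow> 0) (at_right 0)"
    unfolding filterlim_at_right_to_top
  proof (rule Lim_transform_eventually[OF tendsto_poly_times_exp_minus[of 1 "flat_poly n"]])
    show "\<forall>\<^sub>F s in at_top. s ^ 1 * poly (flat_poly n) s * exp (- s) = flat n (inverse s) / inverse s"
      using eventually_gt_at_top[of 0] by eventually_elim (simp add: flat_def field_simps)
  qed
  ultimately have "((\<lambda>h. flat n h / h) \<longlongrightarrow> 0) (at 0)"
    by (rule filterlim_split_at)
  then show ?thesis
    by (simp add: equal DERIV_def flat_def)
qed

lemma smooth_sum:
  "finite I \<Longrightarrow> (\<And>i. i \<in> I \<Longrightarrow> smooth (F i)) \<Longrightarrow> smooth (\<lambda>x. \<Sum>i\<in>I. F i x)"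
  by (induction I rule: finite_induct) (auto simp: smooth_const smooth_add)

lemma bump_function_exists:
  obtains \<beta> :: "real ^ 'n::finite \<Rightarrow> real" where "smooth (\<lambda>x. of_real (\<beta> x))" "\<And>x. 0 \<le> \<beta> x"
    "\<And>x. norm x \<le> 1 \<Longrightarrow> \<beta> x = 1" "\<And>x. 2 \<le> norm x \<Longrightarrow> \<beta> x = 0"
proof -
  define q where "q x = (norm x)\<^sup>2 - 1" for x :: "real ^ 'n"
  define c where "c = flat 0 1"
  have c: "0 < c" by (simp add: c_def flat_def)
  have flat0: "0 \<le> flat 0 t" "0 < flat 0 t \<longleftrightarrow> 0 < t" for t by (auto simp: flat_def)
  \<comment> \<open>The inner \<open>flat 0 (q x)\<close> vanishes on the unit ball and is at least
    \<open>c = flat 0 1\<close> once \<open>q x \<ge> 1\<close>, in particular for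
    \<open>|x| \<ge> 2\<close>. Subtracting it from \<open>c\<close> and applying
    \<open>flat 0\<close> again gives a constant on the unit ball and 0 far out.\<close>
  define \<beta> where "\<beta> x = flat 0 (c - flat 0 (q x)) / flat 0 c" for x
  have "complex_of_real (q x) = (\<Sum>i\<in>UNIV. of_real (x $ i) * of_real (x $ i)) - 1" for x
    by (simp add: q_def norm_vec_def L2_set_def sum_nonneg power2_eq_square)
  then have q: "smooth (\<lambda>x. of_real (q x))"
    using smooth_diff[OF smooth_sum[OF _ smooth_mult[OF smooth_coord smooth_coord]] smooth_const[of 1], of UNIV "\<lambda>i. i" "\<lambda>i. i"]
    by simp
  have "smooth (\<lambda>x. of_real (flat 0 (q x)))"
    by (rule smooth_compose_real[where G=flat, OF q DERIV_flat])
  then have "smooth (\<lambda>x. of_real (c - flat 0 (q x)))"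
    using smooth_diff[OF smooth_const[of "of_real c"]] by simp
  then have "smooth (\<lambda>x. of_real (flat 0 (c - flat 0 (q x))))"
    by (rule smooth_compose_real[where G=flat, OF _ DERIV_flat])
  from smooth_cmult[OF this, of "of_real (1 / flat 0 c)"]
  have \<beta>: "smooth (\<lambda>x. of_real (\<beta> x))"
    by (simp add: \<beta>_def)
  show ?thesis
  proof (rule that[OF \<beta>])
    show "0 \<le> \<beta> x" for x by (simp add: \<beta>_def flat0)
    show "\<beta> x = 1" if "norm x \<le> 1" for x
    proof -
      have "q x \<le> 0" using that power_mono[OF that, of 2] by (simp add: q_def)
      then have "flat 0 (q x) = 0" by (simp add: flat_def)
      then show ?thesis using c flat0(2)[of c] by (simp add: \<beta>_def)
    qed
    show "\<beta> x = 0" if "2 \<le> norm x" for x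
    proof -
      have "1 \<le> q x" using power_mono[OF that, of 2] by (simp add: q_def)
      then have "c \<le> flat 0 (q x)" by (simp add: c_def flat_def)
      then show ?thesis by (simp add: \<beta>_def flat_def[of 0 "c - _"])
    qed
  qed
qed

text \<open>If there were no cut-offs, every \<open>z\<close> would satisfy the description in
  \<open>pi_product\<close>, and the common value would be undetermined.\<close>

lemma pi_cutoffs_nonempty: "pi_cutoffs \<noteq> ({} :: 'n::finite cfun set)"
proof (rule bump_function_exists[where 'n='n])
  fix \<beta> :: "real ^ 'n \<Rightarrow> real"
  assume \<beta>: "smooth (\<lambda>x. of_real (\<beta> x))" "\<And>x. norm x \<le> 1 \<Longrightarrow> \<beta> x = 1" "\<And>x. 2 \<le> norm x \<Longrightarrow> \<beta> x = 0"
  have "(\<lambda>x. of_real (\<beta> x)) \<in> test_functions"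
    by (rule test_functionsI[OF \<beta>(1) compact_cball[of 0 2]]) (use \<beta>(3) in auto)
  moreover have "\<forall>\<^sub>F \<xi> in nhds 0. \<xi> \<in> ball (0 :: real ^ 'n) 1"
    by (intro eventually_nhds_in_open) auto
  then have "\<forall>\<^sub>F \<xi> in nhds 0. complex_of_real (\<beta> \<xi>) = 1"
    by eventually_elim (auto simp: \<beta>(2))
  ultimately show ?thesis by (auto simp: pi_cutoffs_def)
qed

lemma integrable_mult_test_function:
  fixes g :: "'n::finite cfun"
  assumes g: "continuous_on UNIV g" and \<phi>: "\<phi> \<in> test_functions"
  shows "integrable lborel (\<lambda>x. g x * \<phi> x)"
  using \<phi>
proof (rule test_functions_cboxE)
  fix a b assume ab: "\<And>x. x \<notin> cbox a b \<Longrightarrow> \<phi> x = 0"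
  show ?thesis
    by (rule integrable_compact_support[OF continuous_on_mult[OF g
            smooth_continuous_on[OF test_functions_smooth[OF \<phi>]]], of a b])
      (simp add: ab)
qed

text \<open>A nonnegative bump is placed where \<open>g\<close> stays within
  \<open>|g x0| / 2\<close> of \<open>g x0\<close>. The vanishing integral then gives
  \<open>|g x0| INT \<eta> \<le> |g x0| / 2 INT \<eta>\<close>, although \<eta> has positive
  integral.\<close>

lemma continuous_eq_0_if_integrals_eq_0:
  fixes g :: "'n::finite cfun"
  assumes g: "continuous_on UNIV g" and 0: "\<And>\<phi>. \<phi> \<in> test_functions \<Longrightarrow> (LINT x|lborel. g x * \<phi> x) = 0"
  shows "g x0 = 0"
proof (rule bump_function_exists[where 'n='n], rule ccontr)
  fix \<beta> :: "real ^ 'n \<Rightarrow> real"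
  assume \<beta>: "smooth (\<lambda>x. of_real (\<beta> x))" "\<And>x. 0 \<le> \<beta> x" "\<And>x. norm x \<le> 1 \<Longrightarrow> \<beta> x = 1" "\<And>x. 2 \<le> norm x \<Longrightarrow> \<beta> x = 0"
  assume "g x0 \<noteq> 0"
  define e where "e = norm (g x0) / 2"
  have "0 < e" using \<open>g x0 \<noteq> 0\<close> by (simp add: e_def)
  have "isCont g x0" using g by (simp add: continuous_on_eq_continuous_at)
  then obtain r where "0 < r" and r: "\<And>x. dist x x0 < r \<Longrightarrow> dist (g x) (g x0) < e"
    using \<open>0 < e\<close> unfolding continuous_at_eps_delta by blast
  \<comment> \<open>The scale \<open>2 / r\<close> turns the radii 1 and 2 of the bump into
    \<open>r / 2\<close> and \<open>r\<close>.\<close>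
  define \<eta> where "\<eta> x = \<beta> ((2 / r) *\<^sub>R (x - x0))" for x
  have \<eta>_eq: "(\<lambda>x. complex_of_real (\<eta> x)) = (\<lambda>x. of_real (\<beta> (- ((2 / r) *\<^sub>R x0) + (\<chi> i. 2 / r * x $ i))))"
    by (intro ext) (simp add: \<eta>_def, rule arg_cong[where f=\<beta>], simp add: vec_eq_iff algebra_simps)
  have \<eta>_smooth: "smooth (\<lambda>x. of_real (\<eta> x))"
    unfolding \<eta>_eq by (rule smooth_affine[OF \<beta>(1)])
  have \<eta>0: "\<eta> x = 0" if "r \<le> dist x x0" for x
    using that \<open>0 < r\<close> unfolding \<eta>_def by (intro \<beta>(4)) (simp add: dist_norm le_divide_eq)
  have \<eta>1: "\<eta> x = 1" if "dist x x0 \<le> r / 2" for x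
    using that \<open>0 < r\<close> unfolding \<eta>_def by (intro \<beta>(3)) (simp add: dist_norm divide_le_eq)
  have \<eta>_nonneg: "0 \<le> \<eta> x" for x by (simp add: \<eta>_def \<beta>(2))
  have \<eta>: "(\<lambda>x. complex_of_real (\<eta> x)) \<in> test_functions"
    by (rule test_functionsI[OF \<eta>_smooth compact_cball[of x0 r]]) (use \<eta>0 in \<open>auto simp: dist_commute\<close>)
  have I: "integrable lborel (\<lambda>x. complex_of_real (\<eta> x))"
    by (rule schwartz_integrable[OF test_functions_in_schwartz[OF \<eta>]])
  then have I': "integrable lborel \<eta>"
    using integrable_bounded_linear[OF bounded_linear_Re I] by simp
  have "norm (g x0) * (LINT x|lborel. \<eta> x) = norm (LINT x|lborel. g x0 * of_real (\<eta> x))"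
    using \<eta>_nonneg by (simp add: norm_mult integral_nonneg_AE)
  also have "\<dots> = norm (LINT x|lborel. g x0 * of_real (\<eta> x) - g x * of_real (\<eta> x))"
    using 0[OF \<eta>] integrable_mult_test_function[OF g \<eta>] I by simp
  also have "\<dots> \<le> (LINT x|lborel. e * \<eta> x)"
  proof (intro Bochner_Integration.integral_norm_bound_integral)
    fix x
    have "norm (g x0 - g x) * \<eta> x \<le> e * \<eta> x"
    proof (cases "dist x x0 < r")
      case True
      then show ?thesis
        using r[OF True] \<eta>_nonneg by (intro mult_right_mono) (auto simp: dist_norm norm_minus_commute)
    qed (simp add: \<eta>0)
    then show "norm (g x0 * of_real (\<eta> x) - g x * of_real (\<eta> x)) \<le> e * \<eta> x"
      using \<eta>_nonneg by (simp add: norm_mult flip: left_diff_distrib)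
  qed (use I I' integrable_mult_test_function[OF g \<eta>] in auto)
  finally have "norm (g x0) * (LINT x|lborel. \<eta> x) \<le> norm (g x0) / 2 * (LINT x|lborel. \<eta> x)"
    by (simp add: e_def)
  then have "(LINT x|lborel. \<eta> x) \<le> 0"
    using \<open>g x0 \<noteq> 0\<close> by (simp add: mult_le_0_iff)
  moreover have "measure lborel (ball x0 (r / 2)) \<le> (LINT x|lborel. \<eta> x)"
  proof -
    have "integrable lborel (indicator (ball x0 (r / 2)) :: _ \<Rightarrow> real)"
      by (rule integrable_real_indicator[OF _ emeasure_bounded_finite]) auto
    moreover have "indicator (ball x0 (r / 2)) x \<le> \<eta> x" for x
      by (simp add: indicator_def \<eta>1 \<eta>_nonneg dist_commute)
    ultimately have "(LINT x|lborel. indicator (ball x0 (r / 2)) x) \<le> (LINT x|lborel. \<eta> x)"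
      by (intro integral_mono I')
    then show ?thesis by simp
  qed
  moreover have "0 < measure lborel (ball x0 (r / 2))"
    using \<open>0 < r\<close> by (intro content_ball_pos) simp
  ultimately show False by linarith
qed

lemma fun_of_eqI:
  fixes g :: "'n::finite cfun"
  assumes g: "continuous_on UNIV g" and eq: "distr_eq u (of_fun g)"
  shows "fun_of u = g"
  unfolding fun_of_def
proof (rule the_equality)
  fix g' :: "'n cfun" assume g': "continuous_on UNIV g' \<and> distr_eq u (of_fun g')"
  have "g' x - g x = 0" for x
  proof (rule continuous_eq_0_if_integrals_eq_0)
    show "continuous_on UNIV (\<lambda>x. g' x - g x)" using g g' by (intro continuous_on_diff) auto
    fix \<phi> :: "'n cfun" assume \<phi>: "\<phi> \<in> test_functions"
    have "of_fun g' \<phi> = of_fun g \<phi>" using eq g' \<phi> by (simp add: distr_eq_def)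
    then show "(LINT x|lborel. (g' x - g x) * \<phi> x) = 0"
      using integrable_mult_test_function[OF g \<phi>] integrable_mult_test_function[OF conjunct1[OF g'] \<phi>]
      by (simp add: of_fun_def left_diff_distrib)
  qed
  then show "g' = g" by (simp add: fun_eq_iff)
qed (use g eq in simp)

subsection \<open>Functions as distributions\<close>

lemma SUP_norm_iter_partial:
  fixes \<phi> :: "'n::finite cfun"
  assumes \<phi>: "\<phi> \<in> schwartz"
  shows "(1 + norm x) ^ N * norm (iter_partial js \<phi> x) \<le> (SUP x. (1 + norm x) ^ N * norm (iter_partial js \<phi> x))"
proof (rule cSUP_upper)
  obtain C where "\<And>x. (1 + norm x) ^ N * norm (iter_partial js \<phi> x) \<le> C"
    using \<phi> unfolding schwartz_def by blast
  then show "bdd_above (range (\<lambda>x. (1 + norm x) ^ N * norm (iter_partial js \<phi> x)))"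
    by (intro bdd_aboveI[of _ C]) auto
qed simp

lemma norm_iter_partial_le_sum:
  fixes \<phi> :: "'n::finite cfun"
  assumes \<phi>: "\<phi> \<in> schwartz" and js: "length js \<le> N"
  shows "(1 + norm x) ^ m * norm (iter_partial js \<phi> x) \<le>
    (\<Sum>js | length js \<le> N. SUP x. (1 + norm x) ^ m * norm (iter_partial js \<phi> x))"
proof -
  have "(1 + norm x) ^ m * norm (iter_partial js \<phi> x) \<le> (SUP x. (1 + norm x) ^ m * norm (iter_partial js \<phi> x))"
    using \<phi> by (rule SUP_norm_iter_partial)
  also have "\<dots> \<le> (\<Sum>js | length js \<le> N. SUP x. (1 + norm x) ^ m * norm (iter_partial js \<phi> x))"
  proof (rule member_le_sum)
    fix ks
    have "0 \<le> (1 + norm x) ^ m * norm (iter_partial ks \<phi> x)" by simp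
    also have "\<dots> \<le> (SUP x. (1 + norm x) ^ m * norm (iter_partial ks \<phi> x))"
      using \<phi> by (rule SUP_norm_iter_partial)
    finally show "0 \<le> (SUP x. (1 + norm x) ^ m * norm (iter_partial ks \<phi> x))" .
  qed (use js in auto)
  finally show ?thesis .
qed

text \<open>On a compact set \<open>K\<close> the estimate has order 0, with the integral of
  \<open>|g|\<close> over \<open>K\<close> as its constant.\<close>

lemma of_fun_in_distributions:
  fixes g :: "'n::finite cfun"
  assumes g: "continuous_on UNIV g"
  shows "of_fun g \<in> distributions"
  unfolding distributions_def
proof (intro CollectI conjI allI impI)
  note I = integrable_mult_test_function[OF g]
  show "linear_on_funs test_functions (of_fun g)"
    unfolding linear_on_funs_def
  proof (intro conjI ballI allI)
    show "of_fun g (\<lambda>x. \<phi> x + \<eta> x) = of_fun g \<phi> + of_fun g \<eta>"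
      if "\<phi> \<in> test_functions" "\<eta> \<in> test_functions" for \<phi> \<eta>
      using I[OF that(1)] I[OF that(2)] by (simp add: of_fun_def distrib_left)
    show "of_fun g (\<lambda>x. c * \<phi> x) = c * of_fun g \<phi>" for c \<phi>
      by (simp add: of_fun_def mult.left_commute[of _ c])
  qed
  fix K :: "(real ^ 'n) set" assume K: "compact K"
  have IK: "integrable lborel (\<lambda>x. indicator K x *\<^sub>R norm (g x))"
    by (intro borel_integrable_compact K continuous_intros continuous_on_subset[OF g]) auto
  have "norm (of_fun g \<phi>) \<le> (LINT x|lborel. indicator K x *\<^sub>R norm (g x)) * (\<Sum>js | length js \<le> 0. SUP x. norm (iter_partial js \<phi> x))"
    if \<phi>: "\<phi> \<in> test_functions" and supp: "closure {x. \<phi> x \<noteq> 0} \<subseteq> K" for \<phi>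
  proof -
    let ?S = "\<Sum>js | length js \<le> 0. SUP x. norm (iter_partial js \<phi> x)"
    have "norm (of_fun g \<phi>) \<le> (LINT x|lborel. indicator K x *\<^sub>R norm (g x) * ?S)"
      unfolding of_fun_def
    proof (intro Bochner_Integration.integral_norm_bound_integral I[OF \<phi>] integrable_mult_left IK)
      fix x
      have "norm (\<phi> x) \<le> ?S"
        using norm_iter_partial_le_sum[OF test_functions_in_schwartz[OF \<phi>], of "[]" 0 x 0] by simp
      moreover have "\<phi> x = 0" if "x \<notin> K"
        using iter_partial_outside_support[of x \<phi> "[]"] that supp by auto
      ultimately show "norm (g x * \<phi> x) \<le> indicator K x *\<^sub>R norm (g x) * ?S"
        by (cases "x \<in> K") (auto simp: norm_mult intro!: mult_left_mono)
    qed
    then show ?thesis by simp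
  qed
  then show "\<exists>C N. \<forall>\<phi>\<in>test_functions. closure {x. \<phi> x \<noteq> 0} \<subseteq> K \<longrightarrow>
      norm (of_fun g \<phi>) \<le> C * (\<Sum>js | length js \<le> N. SUP x. norm (iter_partial js \<phi> x))"
    by blast
qed

lemma of_fun_in_tempered:
  fixes f :: "'n::finite cfun"
  assumes f: "f \<in> slowly_increasing"
  shows "of_fun f \<in> tempered"
  unfolding tempered_def
proof (intro CollectI conjI)
  have I: "integrable lborel (\<lambda>x. f x * \<phi> x)" if "\<phi> \<in> schwartz" for \<phi>
    by (rule schwartz_integrable[OF schwartz_mult_slowly_increasing[OF f that]])
  show "linear_on_funs schwartz (of_fun f)"
    unfolding linear_on_funs_def
  proof (intro conjI ballI allI)
    show "of_fun f (\<lambda>x. \<phi> x + \<eta> x) = of_fun f \<phi> + of_fun f \<eta>"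
      if "\<phi> \<in> schwartz" "\<eta> \<in> schwartz" for \<phi> \<eta>
      using I[OF that(1)] I[OF that(2)] by (simp add: of_fun_def distrib_left)
    show "of_fun f (\<lambda>x. c * \<phi> x) = c * of_fun f \<phi>" for c \<phi>
      by (simp add: of_fun_def mult.left_commute[of _ c])
  qed
  show "\<exists>C N. \<forall>\<phi>\<in>schwartz. norm (of_fun f \<phi>) \<le>
      C * (\<Sum>js | length js \<le> N. SUP x. (1 + norm x) ^ N * norm (iter_partial js \<phi> x))"
    using slowly_increasing_uniform[OF f, of 0]
  proof cases
    case (1 a C)
    \<comment> \<open>The weight of order \<open>N\<close> must outweigh the growth \<open>a\<close>
      of \<open>f\<close> and still leave the decay \<open>2 * CARD('n)\<close> that makes the
      integral converge.\<close>
    define N where "N = nat \<lceil>a + 2 * real CARD('n)\<rceil>"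
    have N: "a - real N \<le> - 2 * real CARD('n)" unfolding N_def by linarith
    let ?W = "LINT x|lborel. (1 + norm (x :: real ^ 'n)) powr (a - real N)"
    have "norm (of_fun f \<phi>) \<le> C * ?W * (\<Sum>js | length js \<le> N. SUP x. (1 + norm x) ^ N * norm (iter_partial js \<phi> x))"
      if \<phi>: "\<phi> \<in> schwartz" for \<phi>
    proof -
      let ?S = "\<Sum>js | length js \<le> N. SUP x. (1 + norm x) ^ N * norm (iter_partial js \<phi> x)"
      have "norm (of_fun f \<phi>) \<le> (LINT x|lborel. C * (1 + norm (x :: real ^ 'n)) powr (a - real N) * ?S)"
        unfolding of_fun_def
      proof (intro Bochner_Integration.integral_norm_bound_integral I[OF \<phi>] integrable_mult_left integrable_mult_right
          integrable_one_plus_norm_powr N)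
        fix x :: "real ^ 'n"
        have "(1 + norm x) ^ N * norm (\<phi> x) \<le> ?S"
          using norm_iter_partial_le_sum[OF \<phi>, of "[]" N x N] by simp
        then have \<phi>x: "norm (\<phi> x) \<le> ?S / (1 + norm x) ^ N"
          by (simp add: pos_le_divide_eq mult.commute)
        have "norm (f x * \<phi> x) \<le> (C * (1 + norm x) powr a) * (?S / (1 + norm x) ^ N)"
          unfolding norm_mult using 1(2) 1(3)[of "[]" x] by (intro mult_mono \<phi>x) auto
        then show "norm (f x * \<phi> x) \<le> C * (1 + norm x) powr (a - real N) * ?S"
          by (simp add: powr_diff powr_realpow)
      qed
      then show ?thesis by simp
    qed
    then show ?thesis by blast
  qed
qed

lemma length_splits_list: "length (splits js) = 2 ^ length js"
  by (induction js) auto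

text \<open>Leibniz' rule has \<open>2 ^ length js\<close> summands. The bounds are taken at one
  point \<open>x\<close>, so that a growing factor has to be estimated only where the other one is
  supported.\<close>

lemma norm_iter_partial_mult_le:
  assumes "smooth f" "smooth g" "length js \<le> N" "0 \<le> F" "0 \<le> G"
    and F: "\<And>ks. length ks \<le> N \<Longrightarrow> norm (iter_partial ks f x) \<le> F"
    and G: "\<And>ks. length ks \<le> N \<Longrightarrow> norm (iter_partial ks g x) \<le> G"
  shows "norm (iter_partial js (\<lambda>x. f x * g x) x) \<le> 2 ^ N * (F * G)"
proof -
  have each: "norm (iter_partial (fst p) f x * iter_partial (snd p) g x) \<le> F * G" if "p \<in> set (splits js)" for p
  proof -
    have "length (fst p) \<le> N" "length (snd p) \<le> N"
      using length_splits[of "fst p" "snd p" js] that assms(3) by auto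
    then show ?thesis
      unfolding norm_mult using assms by (intro mult_mono F G) auto
  qed
  have sum_le: "norm (\<Sum>p\<leftarrow>ps. H p) \<le> length ps * B" if "\<And>p. p \<in> set ps \<Longrightarrow> norm (H p) \<le> B"
    for ps and H :: "'a list \<times> 'a list \<Rightarrow> complex" and B :: real
    using that
  proof (induction ps)
    case (Cons p ps)
    have "norm (H p + (\<Sum>p\<leftarrow>ps. H p)) \<le> B + length ps * B"
      by (intro norm_triangle_le add_mono) (use Cons in auto)
    then show ?case by (simp add: algebra_simps)
  qed simp
  have "norm (\<Sum>p\<leftarrow>splits js. iter_partial (fst p) f x * iter_partial (snd p) g x) \<le> length (splits js) * (F * G)"
    by (rule sum_le[OF each])
  also have "\<dots> \<le> 2 ^ N * (F * G)"
    unfolding length_splits_list using assms by (intro mult_right_mono) auto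
  finally show ?thesis by (simp add: iter_partial_mult assms)
qed

lemma fun_mult_in_distributions:
  fixes f :: "'n::finite cfun"
  assumes f: "f \<in> slowly_increasing" and u: "u \<in> tempered"
  shows "fun_mult f u \<in> distributions"
  unfolding distributions_def
proof (intro CollectI conjI allI impI)
  have fS: "(\<lambda>x. f x * \<phi> x) \<in> schwartz" if "\<phi> \<in> test_functions" for \<phi>
    by (rule schwartz_mult_slowly_increasing[OF f test_functions_in_schwartz[OF that]])
  show "linear_on_funs test_functions (fun_mult f u)"
    unfolding linear_on_funs_def fun_mult_def
  proof (intro conjI ballI allI)
    show "u (\<lambda>x. f x * (\<phi> x + \<eta> x)) = u (\<lambda>x. f x * \<phi> x) + u (\<lambda>x. f x * \<eta> x)"
      if "\<phi> \<in> test_functions" "\<eta> \<in> test_functions" for \<phi> \<eta>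
      unfolding distrib_left by (rule tempered_add[OF u fS fS]) (use that in auto)
    show "u (\<lambda>x. f x * (c * \<phi> x)) = c * u (\<lambda>x. f x * \<phi> x)" if "\<phi> \<in> test_functions" for c \<phi>
      using tempered_cmult[OF u fS[OF that], of c] by (simp add: mult.left_commute)
  qed
  fix K :: "(real ^ 'n) set" assume "compact K"
  obtain R where R: "0 < R" "\<And>x. x \<in> K \<Longrightarrow> norm x \<le> R"
    using compact_imp_bounded[OF \<open>compact K\<close>] by (auto simp: bounded_pos)
  show "\<exists>C N. \<forall>\<phi>\<in>test_functions. closure {x. \<phi> x \<noteq> 0} \<subseteq> K \<longrightarrow>
      norm (fun_mult f u \<phi>) \<le> C * (\<Sum>js | length js \<le> N. SUP x. norm (iter_partial js \<phi> x))"
    using u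
  proof (rule temperedE)
    fix Cu and N :: nat
    assume Cu: "0 \<le> Cu" and bound: "\<And>\<phi> B. \<phi> \<in> schwartz \<Longrightarrow>
        (\<And>js x. length js \<le> N \<Longrightarrow> (1 + norm x) powr real N * norm (iter_partial js \<phi> x) \<le> B) \<Longrightarrow>
        norm (u \<phi>) \<le> Cu * B"
    show ?thesis using slowly_increasing_uniform[OF f, of N]
    proof cases
      case (1 a C)
      \<comment> \<open>The factors bound, on \<open>K\<close>, the weight of the seminorm, the
        number of Leibniz summands and the derivatives of \<open>f\<close>.\<close>
      define D where "D = (1 + R) powr real N * (2 ^ N * (C * (1 + R) powr a))"
      have "norm (fun_mult f u \<phi>) \<le> (Cu * D) * (\<Sum>js | length js \<le> N. SUP x. norm (iter_partial js \<phi> x))"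
        if \<phi>: "\<phi> \<in> test_functions" and supp: "closure {x. \<phi> x \<noteq> 0} \<subseteq> K" for \<phi>
      proof -
        let ?S = "\<Sum>js | length js \<le> N. SUP x. norm (iter_partial js \<phi> x)"
        have S: "norm (iter_partial js \<phi> x) \<le> ?S" if "length js \<le> N" for js x
          using norm_iter_partial_le_sum[OF test_functions_in_schwartz[OF \<phi>] that, of x 0] by simp
        have "0 \<le> ?S" using order_trans[OF norm_ge_zero S[of "[]" 0]] by simp
        have "norm (u (\<lambda>x. f x * \<phi> x)) \<le> Cu * (D * ?S)"
        proof (rule bound[OF fS[OF \<phi>]])
          fix js :: "'n list" and x :: "real ^ 'n" assume js: "length js \<le> N"
          show "(1 + norm x) powr real N * norm (iter_partial js (\<lambda>x. f x * \<phi> x) x) \<le> D * ?S"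
          proof (cases "x \<in> K")
            case True
            have "norm (iter_partial ks f x) \<le> C * (1 + R) powr a" if "length ks \<le> N" for ks
              by (rule order_trans[OF 1(3)[OF that]]) (use 1 R(2)[OF True] in \<open>auto intro!: mult_left_mono powr_mono2\<close>)
            then have "norm (iter_partial js (\<lambda>x. f x * \<phi> x) x) \<le> 2 ^ N * (C * (1 + R) powr a * ?S)"
              using 1(2) \<open>0 \<le> ?S\<close> S
              by (intro norm_iter_partial_mult_le slowly_increasing_smooth f test_functions_smooth \<phi> js) auto
            then have "(1 + norm x) powr real N * norm (iter_partial js (\<lambda>x. f x * \<phi> x) x) \<le>
                (1 + R) powr real N * (2 ^ N * (C * (1 + R) powr a * ?S))"
              using R(2)[OF True] by (intro mult_mono powr_mono2) auto
            then show ?thesis by (simp add: D_def mult_ac)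
          next
            case False
            have "iter_partial js (\<lambda>x. f x * \<phi> x) x = 0"
            proof (rule iter_partial_eq_0[OF _ _ False])
              show "closed K" using \<open>compact K\<close> by (rule compact_imp_closed)
              show "f y * \<phi> y = 0" if "y \<notin> K" for y
                using iter_partial_outside_support[of y \<phi> "[]"] that supp by auto
            qed
            then show ?thesis using \<open>0 \<le> ?S\<close> 1(2) R(1) by (simp add: D_def)
          qed
        qed
        then show ?thesis by (simp add: fun_mult_def mult.assoc)
      qed
      then show ?thesis by blast
    qed
  qed
qed

subsection \<open>Frequency cut-offs\<close>

context
  fixes M :: "'n::finite \<Rightarrow> real" and \<psi> :: "'n cfun"
  assumes M: "weight M" and \<psi>: "\<psi> \<in> schwartz" and \<psi>0: "\<psi> 0 = 1"
begin

definition scaling :: "nat \<Rightarrow> real ^ 'n \<Rightarrow> real ^ 'n" where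
  "scaling k z = (\<chi> i. 2 powr (- (real k * M i)) * z $ i)"

lemma dilate_eq: "dilate M k \<psi> = (\<lambda>\<xi>. \<psi> (scaling k \<xi>))"
  by (simp add: dilate_def scaling_def)

lemma dilate_schwartz: "dilate M k \<psi> \<in> schwartz"
  unfolding dilate_def using schwartz_affine[OF \<psi>, of "\<lambda>i. 2 powr (- (real k * M i))" 0] by simp

lemma scaling_le: "norm (scaling k z) \<le> (1 / 2) ^ k * norm z"
proof -
  have "norm (scaling k z) \<le> norm ((1 / 2) ^ k *\<^sub>R z)"
  proof (rule norm_le_componentwise_cart)
    fix i
    have "1 \<le> M i" using M by (simp add: weight_def)
    then have "2 powr (- (real k * M i)) \<le> 2 powr (- real k)"
      using mult_left_mono[of 1 "M i" "real k"] by (intro powr_mono) auto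
    also have "\<dots> = (1 / 2) ^ k"
      by (simp add: powr_minus powr_realpow power_divide inverse_eq_divide)
    finally show "norm (scaling k z $ i) \<le> norm (((1 / 2) ^ k *\<^sub>R z) $ i)"
      by (simp add: scaling_def abs_mult mult_right_mono)
  qed
  then show ?thesis by simp
qed

lemma scaling_le_norm: "norm (scaling k z) \<le> norm z"
  by (rule order_trans[OF scaling_le]) (simp add: mult_left_le_one_le power_le_one)

lemma scaling_measurable: "scaling k \<in> borel_measurable borel" "(\<lambda>z. - scaling k z) \<in> borel_measurable borel"
proof -
  have "continuous_on UNIV (scaling k)"
    unfolding scaling_def by (intro continuous_intros)
  then show "scaling k \<in> borel_measurable borel" "(\<lambda>z. - scaling k z) \<in> borel_measurable borel"
    by (auto intro!: borel_measurable_continuous_onI continuous_on_minus)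
qed

text \<open>On \<phi> the cut-off is \<open>v\<close> applied to a superposition of translates of
  the kernel, and \<open>tempered_integral\<close> exchanges \<open>v\<close> with the
  superposition. The density found in this way is continuous, hence the one that
  \<open>fun_of\<close> selects.\<close>

lemma fun_of_freq_cutoff:
  assumes v: "v \<in> tempered"
  shows "fun_of (freq_cutoff M \<psi> k v) = (\<lambda>y. v (\<lambda>x. inv_fourier (dilate M k \<psi>) (y - x)))"
proof (rule fun_of_eqI)
  note h = schwartz_inv_fourier[OF dilate_schwartz[of k]]
  show "continuous_on UNIV (\<lambda>y. v (\<lambda>x. inv_fourier (dilate M k \<psi>) (y - x)))"
    using v h by (rule tempered_reflect_continuous)
  show "distr_eq (freq_cutoff M \<psi> k v) (of_fun (\<lambda>y. v (\<lambda>x. inv_fourier (dilate M k \<psi>) (y - x))))"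
    unfolding distr_eq_def
  proof
    fix \<phi> :: "'n cfun" assume \<phi>: "\<phi> \<in> test_functions"
    have "freq_cutoff M \<psi> k v \<phi> = v (fourier (\<lambda>\<xi>. dilate M k \<psi> \<xi> * inv_fourier \<phi> \<xi>))"
      by (simp add: freq_cutoff_def inv_fourier_tempered_def fun_mult_def fourier_tempered_def)
    also have "\<dots> = v (\<lambda>x. LINT y|lborel. \<phi> y * inv_fourier (dilate M k \<psi>) (y - x))"
      using schwartz_integrable[OF test_functions_in_schwartz[OF \<phi>]] schwartz_integrable[OF dilate_schwartz[of k]]
      by (simp only: fourier_mult_inv_fourier)
    also have "\<dots> = (LINT y|lborel. \<phi> y * v (\<lambda>x. inv_fourier (dilate M k \<psi>) (y - x)))"
      using v h \<phi> by (rule tempered_integral)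
    finally show "freq_cutoff M \<psi> k v \<phi> = of_fun (\<lambda>y. v (\<lambda>x. inv_fourier (dilate M k \<psi>) (y - x))) \<phi>"
      by (simp add: of_fun_def mult.commute)
  qed
qed

lemma fun_of_freq_cutoff_of_fun:
  assumes f: "f \<in> slowly_increasing"
  shows "fun_of (freq_cutoff M \<psi> k (of_fun f)) = mollify (\<lambda>z. - scaling k z) (inv_fourier \<psi>) f"
  using convolution_right_eq_mollify[OF f \<psi>, of "\<lambda>i. 2 powr (- (real k * M i))"]
  unfolding fun_of_freq_cutoff[OF of_fun_in_tempered[OF f]]
  by (simp add: of_fun_def dilate_eq scaling_def[abs_def] fun_eq_iff)

lemma smooth_mollify_scaling:
  assumes "f \<in> slowly_increasing"
  shows "smooth (mollify (\<lambda>z. - scaling k z) (inv_fourier \<psi>) f)"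
  by (rule smooth_mollify[OF scaling_measurable(2) _ schwartz_inv_fourier[OF \<psi>] assms])
    (simp add: scaling_le_norm)

text \<open>The smoothed \<open>f\<close> is smooth, so its product with \<phi> is a test function.
  This puts the pairing into the form required by \<open>tempered_integral\<close>, which returns
  \<open>u\<close> to the outside.\<close>

lemma cutoff_product_eq:
  assumes f: "f \<in> slowly_increasing" and u: "u \<in> tempered" and \<phi>: "\<phi> \<in> test_functions"
  shows "cutoff_product M \<psi> (of_fun f) u k \<phi> =
    u (mollify (scaling k) (inv_fourier \<psi>) (\<lambda>x. mollify (\<lambda>z. - scaling k z) (inv_fourier \<psi>) f x * \<phi> x))"
proof -
  let ?f = "mollify (\<lambda>z. - scaling k z) (inv_fourier \<psi>) f"
  have f\<phi>: "(\<lambda>x. ?f x * \<phi> x) \<in> test_functions"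
    by (rule test_functions_mult[OF smooth_mollify_scaling[OF f] \<phi>])
  have "cutoff_product M \<psi> (of_fun f) u k \<phi> =
      (LINT y|lborel. (?f y * \<phi> y) * u (\<lambda>x. inv_fourier (dilate M k \<psi>) (y - x)))"
    unfolding cutoff_product_def fun_of_freq_cutoff_of_fun[OF f] fun_of_freq_cutoff[OF u]
    by (simp add: of_fun_def mult_ac)
  also have "\<dots> = u (\<lambda>x. LINT y|lborel. (?f y * \<phi> y) * inv_fourier (dilate M k \<psi>) (y - x))"
    using u schwartz_inv_fourier[OF dilate_schwartz[of k]] f\<phi> by (rule tempered_integral(2)[symmetric])
  also have "\<dots> = u (mollify (scaling k) (inv_fourier \<psi>) (\<lambda>x. ?f x * \<phi> x))"
    using convolution_left_eq_mollify[OF schwartz_imp_slowly_increasing[OF test_functions_in_schwartz[OF f\<phi>]] \<psi>,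
        of "\<lambda>i. 2 powr (- (real k * M i))"]
    by (simp add: dilate_eq scaling_def[abs_def])
  finally show ?thesis .
qed

lemma cutoff_product_in_distributions:
  assumes f: "f \<in> slowly_increasing" and u: "u \<in> tempered"
  shows "cutoff_product M \<psi> (of_fun f) u k \<in> distributions"
  unfolding cutoff_product_def fun_of_freq_cutoff_of_fun[OF f] fun_of_freq_cutoff[OF u]
  by (intro of_fun_in_distributions continuous_on_mult smooth_continuous_on smooth_mollify_scaling f
      tempered_reflect_continuous[OF u schwartz_inv_fourier[OF dilate_schwartz]])

text \<open>With \<open>S\<close> the average along \<open>scaling k\<close> and \<open>f_k\<close>
  the smoothed \<open>f\<close>, the error is \<open>S ((f_k - f) \<phi>)\<close> plus
  \<open>S (f \<phi>) - f \<phi>\<close>. In the first part the factor \<open>f_k - f\<close> is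
  small on the support of \<phi>, and averaging preserves decay; the second is the mean value
  estimate for a Schwartz function. Averages commute with derivatives, and the mean value estimate
  uses one further derivative, hence the bounds up to order \<open>Suc N\<close>.\<close>

lemma mollified_product_bound:
  fixes N :: nat
  assumes f: "f \<in> slowly_increasing" and \<phi>: "\<phi> \<in> test_functions"
  defines "\<theta> \<equiv> \<lambda>k. mollify (scaling k) (inv_fourier \<psi>) (\<lambda>x. mollify (\<lambda>z. - scaling k z) (inv_fourier \<psi>) f x * \<phi> x)"
  shows "\<exists>B. \<forall>k js x. length js \<le> N \<longrightarrow>
    (1 + norm x) powr real N * norm (iter_partial js (\<lambda>x. \<theta> k x - f x * \<phi> x) x) \<le> B * (1 / 2) ^ k"
proof -
  let ?h = "inv_fourier \<psi>"
  define fk where "fk k = mollify (\<lambda>z. - scaling k z) ?h f" for k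
  note h = schwartz_inv_fourier[OF \<psi>]
  have h1: "(LINT z|lborel. ?h z) = 1" using integral_inv_fourier[OF \<psi>] \<psi>0 by simp
  have \<phi>S: "\<phi> \<in> schwartz" by (rule test_functions_in_schwartz[OF \<phi>])
  have g: "(\<lambda>x. f x * \<phi> x) \<in> schwartz" by (rule schwartz_mult_slowly_increasing[OF f \<phi>S])
  have q: "0 \<le> (1 / 2 :: real) ^ k" for k by simp
  have neg: "norm (- scaling k z) \<le> norm z" "norm (- scaling k z) \<le> (1 / 2) ^ k * norm z" for k z
    using scaling_le_norm scaling_le by simp_all
  have fk_smooth: "smooth (fk k)" for k
    unfolding fk_def by (rule smooth_mollify_scaling[OF f])
  have d: "(\<lambda>x. (fk k x - f x) * \<phi> x) \<in> test_functions" for k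
    by (intro test_functions_mult smooth_diff fk_smooth slowly_increasing_smooth f \<phi>)
  obtain R where R: "0 < R" "\<And>x. x \<in> closure {x. \<phi> x \<noteq> 0} \<Longrightarrow> norm x \<le> R"
    using compact_imp_bounded[OF test_functions_compact_support[OF \<phi>]] by (auto simp: bounded_pos)
  obtain S where S: "0 \<le> S" "\<And>js x. length js \<le> N \<Longrightarrow> norm (iter_partial js \<phi> x) \<le> S * (1 + norm x) powr 0"
    by (rule schwartz_uniform[OF \<phi>S]) (rule that)
  obtain G where G: "0 \<le> G" "\<And>js x. length js \<le> Suc N \<Longrightarrow>
      norm (iter_partial js (\<lambda>x. f x * \<phi> x) x) \<le> G * (1 + norm x) powr - real N"
    by (rule schwartz_uniform[OF g]) (rule that)
  obtain a F where F: "0 \<le> a" "0 \<le> F"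
    "\<And>js x. length js \<le> Suc N \<Longrightarrow> norm (iter_partial js f x) \<le> F * (1 + norm x) powr a"
    by (rule slowly_increasing_uniform[OF f]) (rule that)
  \<comment> \<open>The constant of \<open>norm_mollify_diff_le\<close> for derivatives of
    \<open>f\<close>, the weight being estimated on the support of \<phi>, where
    \<open>norm x \<le> R\<close>.\<close>
  define P where "P = CARD('n) * F * moment (\<bar>a\<bar> + 1) ?h * (1 + R) powr a"
  have "0 \<le> P" using F by (simp add: P_def moment_nonneg)
  \<comment> \<open>\<open>2 ^ N\<close> counts Leibniz summands, and
    \<open>(1 + R) powr real N\<close> converts the bounded support into decay of order
    \<open>N\<close>, the form that survives averaging.\<close>
  define Q where "Q = 2 ^ N * (P * S) * (1 + R) powr real N"
  have "0 \<le> Q" using S \<open>0 \<le> P\<close> by (simp add: Q_def)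
  have D: "norm (iter_partial js (\<lambda>x. (fk k x - f x) * \<phi> x) x) \<le> (1 / 2) ^ k * Q * (1 + norm x) powr - real N"
    if js: "length js \<le> N" for js k x
  proof (cases "x \<in> closure {x. \<phi> x \<noteq> 0}")
    case True
    have "norm (iter_partial ks (\<lambda>x. fk k x - f x) x) \<le> (1 / 2) ^ k * P" if ks: "length ks \<le> N" for ks
    proof -
      have "iter_partial ks (\<lambda>x. fk k x - f x) x = mollify (\<lambda>z. - scaling k z) ?h (iter_partial ks f) x - iter_partial ks f x"
        using iter_partial_mollify[OF scaling_measurable(2) neg(1) h f, of ks k] fk_smooth[of k] slowly_increasing_smooth[OF f]
        by (simp add: iter_partial_diff fk_def)
      also have "norm \<dots> \<le> (1 / 2) ^ k * CARD('n) * F * moment (\<bar>a\<bar> + 1) ?h * (1 + norm x) powr a"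
        using F(3)[of "j # ks" for j] ks
        by (intro norm_mollify_diff_le[OF scaling_measurable(2) neg(1) h slowly_increasing_iter_partial[OF f] _ neg(2) q h1]) auto
      also have "\<dots> \<le> (1 / 2) ^ k * CARD('n) * F * moment (\<bar>a\<bar> + 1) ?h * (1 + R) powr a"
        using R(2)[OF True] F by (intro mult_left_mono powr_mono2) (auto simp: moment_nonneg)
      finally show ?thesis by (simp add: P_def mult_ac)
    qed
    then have "norm (iter_partial js (\<lambda>x. (fk k x - f x) * \<phi> x) x) \<le> 2 ^ N * ((1 / 2) ^ k * P * S)"
      using \<open>0 \<le> P\<close> S
      by (intro norm_iter_partial_mult_le smooth_diff fk_smooth slowly_increasing_smooth f test_functions_smooth \<phi> js) auto
    also have "\<dots> = (1 / 2) ^ k * (2 ^ N * (P * S)) * 1" by simp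
    also have "\<dots> \<le> (1 / 2) ^ k * (2 ^ N * (P * S)) * ((1 + R) powr real N * (1 + norm x) powr - real N)"
    proof (rule mult_left_mono)
      have "(1 + norm x) powr real N \<le> (1 + R) powr real N"
        using R(2)[OF True] by (intro powr_mono2) auto
      then show "1 \<le> (1 + R) powr real N * (1 + norm x) powr - real N"
        by (simp add: powr_minus field_simps)
    qed (use \<open>0 \<le> P\<close> S in simp)
    finally show ?thesis by (simp add: Q_def mult_ac)
  next
    case False
    have "iter_partial js (\<lambda>x. (fk k x - f x) * \<phi> x) x = 0"
    proof (rule iter_partial_eq_0[OF closed_closure _ False])
      show "(fk k y - f y) * \<phi> y = 0" if "y \<notin> closure {x. \<phi> x \<noteq> 0}" for y
        using iter_partial_outside_support[OF that, of "[]"] by simp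
    qed
    then show ?thesis using \<open>0 \<le> Q\<close> by simp
  qed
  \<comment> \<open>One summand for each part of the error; the second moment carries the additional
    exponent 1 of \<open>norm_mollify_diff_le\<close>.\<close>
  define B where "B = Q * moment (real N) ?h + CARD('n) * G * moment (real N + 1) ?h"
  have "(1 + norm x) powr real N * norm (iter_partial js (\<lambda>x. \<theta> k x - f x * \<phi> x) x) \<le> B * (1 / 2) ^ k"
    if js: "length js \<le> N" for k js x
  proof -
    let ?S = "mollify (scaling k) ?h"
    note S_props = scaling_measurable(1)[of k] scaling_le_norm[of k] h
    have dS: "(\<lambda>x. (fk k x - f x) * \<phi> x) \<in> schwartz" by (rule test_functions_in_schwartz[OF d])
    have I: "integrable lborel (\<lambda>z. g' (x + scaling k z) * ?h z)" if "g' \<in> schwartz" for g' x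
      by (rule integrable_mollify_slowly_increasing[OF S_props schwartz_imp_slowly_increasing[OF that]])
    have "\<theta> k = ?S (\<lambda>x. fk k x * \<phi> x)"
      by (simp only: \<theta>_def fk_def)
    then have "\<theta> k x = ?S (\<lambda>x. (fk k x - f x) * \<phi> x) x + ?S (\<lambda>x. f x * \<phi> x) x" for x
      using I[OF dS, of x] I[OF g, of x]
      unfolding mollify_def by (simp flip: Bochner_Integration.integral_add add: algebra_simps)
    then have "(\<lambda>x. \<theta> k x - f x * \<phi> x) = (\<lambda>x. ?S (\<lambda>x. (fk k x - f x) * \<phi> x) x + (?S (\<lambda>x. f x * \<phi> x) x - f x * \<phi> x))"
      by (simp add: fun_eq_iff)
    then have "iter_partial js (\<lambda>x. \<theta> k x - f x * \<phi> x) x =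
        ?S (iter_partial js (\<lambda>x. (fk k x - f x) * \<phi> x)) x +
        (?S (iter_partial js (\<lambda>x. f x * \<phi> x)) x - iter_partial js (\<lambda>x. f x * \<phi> x) x)"
      using schwartz_mollify[OF S_props dS] schwartz_mollify[OF S_props g] g
      by (simp add: iter_partial_add iter_partial_diff smooth_diff schwartz_smooth
          iter_partial_mollify[OF S_props schwartz_imp_slowly_increasing[OF dS]]
          iter_partial_mollify[OF S_props schwartz_imp_slowly_increasing[OF g]])
    also have "norm \<dots> \<le> (1 / 2) ^ k * Q * moment \<bar>- real N\<bar> ?h * (1 + norm x) powr - real N +
        (1 / 2) ^ k * CARD('n) * G * moment (\<bar>- real N\<bar> + 1) ?h * (1 + norm x) powr - real N"
    proof (intro norm_triangle_le add_mono)
      show "norm (?S (iter_partial js (\<lambda>x. (fk k x - f x) * \<phi> x)) x) \<le>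
          (1 / 2) ^ k * Q * moment \<bar>- real N\<bar> ?h * (1 + norm x) powr - real N"
        using D[OF js] \<open>0 \<le> Q\<close>
        by (intro norm_mollify_le[OF S_props] smooth_borel_measurable schwartz_smooth schwartz_iter_partial dS) auto
      show "norm (?S (iter_partial js (\<lambda>x. f x * \<phi> x)) x - iter_partial js (\<lambda>x. f x * \<phi> x) x) \<le>
          (1 / 2) ^ k * CARD('n) * G * moment (\<bar>- real N\<bar> + 1) ?h * (1 + norm x) powr - real N"
        using G(2)[of "j # js" for j] js
        by (intro norm_mollify_diff_le[OF S_props schwartz_imp_slowly_increasing[OF schwartz_iter_partial[OF g]] _ scaling_le q h1]) auto
    qed
    also have "\<dots> = B * (1 / 2) ^ k * (1 + norm x) powr - real N"
      by (simp add: B_def algebra_simps)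
    finally have "norm (iter_partial js (\<lambda>x. \<theta> k x - f x * \<phi> x) x) \<le> B * (1 / 2) ^ k * (1 + norm x) powr - real N" .
    then show ?thesis by (simp add: powr_minus field_simps)
  qed
  then show ?thesis by blast
qed

lemma converges_cutoff_product:
  assumes f: "f \<in> slowly_increasing" and u: "u \<in> tempered"
  shows "converges_distr (cutoff_product M \<psi> (of_fun f) u) (fun_mult f u)"
  unfolding converges_distr_def
proof (intro conjI allI ballI)
  show "cutoff_product M \<psi> (of_fun f) u k \<in> distributions" for k
    using f u by (rule cutoff_product_in_distributions)
  show "fun_mult f u \<in> distributions"
    using f u by (rule fun_mult_in_distributions)
  fix \<phi> :: "'n cfun" assume \<phi>: "\<phi> \<in> test_functions"
  define \<theta> where "\<theta> k = mollify (scaling k) (inv_fourier \<psi>) (\<lambda>x. mollify (\<lambda>z. - scaling k z) (inv_fourier \<psi>) f x * \<phi> x)" for k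
  have g: "(\<lambda>x. f x * \<phi> x) \<in> schwartz"
    by (rule schwartz_mult_slowly_increasing[OF f test_functions_in_schwartz[OF \<phi>]])
  have \<theta>: "\<theta> k \<in> schwartz" for k
    unfolding \<theta>_def
    by (rule schwartz_mollify[OF scaling_measurable(1) scaling_le_norm schwartz_inv_fourier[OF \<psi>]
          test_functions_in_schwartz[OF test_functions_mult[OF smooth_mollify_scaling[OF f] \<phi>]]])
  show "(\<lambda>k. cutoff_product M \<psi> (of_fun f) u k \<phi>) \<longlonglongrightarrow> fun_mult f u \<phi>"
    using u
  proof (rule temperedE)
    fix C and N :: nat
    assume bound: "\<And>\<phi> B. \<phi> \<in> schwartz \<Longrightarrow>
        (\<And>js x. length js \<le> N \<Longrightarrow> (1 + norm x) powr real N * norm (iter_partial js \<phi> x) \<le> B) \<Longrightarrow>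
        norm (u \<phi>) \<le> C * B"
    obtain B where B: "\<And>k js x. length js \<le> N \<Longrightarrow>
        (1 + norm x) powr real N * norm (iter_partial js (\<lambda>x. \<theta> k x - f x * \<phi> x) x) \<le> B * (1 / 2) ^ k"
      using mollified_product_bound[OF f \<phi>, of N] unfolding \<theta>_def by blast
    have "norm (u (\<theta> k) - u (\<lambda>x. f x * \<phi> x)) \<le> C * (B * (1 / 2) ^ k)" for k
      unfolding tempered_diff[OF u \<theta> g, symmetric]
      by (rule bound[OF schwartz_diff[OF \<theta> g] B])
    then have le: "\<forall>\<^sub>F k in sequentially. norm (u (\<theta> k) - u (\<lambda>x. f x * \<phi> x)) \<le> C * (B * (1 / 2) ^ k)"
      by (intro always_eventually allI)
    have "(\<lambda>k. C * (B * (1 / 2) ^ k)) \<longlonglongrightarrow> 0"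
      by (auto intro!: tendsto_eq_intros LIMSEQ_power_zero)
    with le have "(\<lambda>k. u (\<theta> k) - u (\<lambda>x. f x * \<phi> x)) \<longlonglongrightarrow> 0"
      by (rule Lim_null_comparison)
    then show ?thesis
      unfolding cutoff_product_eq[OF f u \<phi>] fun_mult_def \<theta>_def[symmetric] by (rule LIM_zero_cancel)
  qed
qed

end

theorem proposition3p6:
  fixes M :: "'n::finite \<Rightarrow> real"
    and \<psi> f :: "(real ^ 'n) \<Rightarrow> complex"
    and u :: "((real ^ 'n) \<Rightarrow> complex) \<Rightarrow> complex"
  assumes "weight M"
    and "\<psi> \<in> schwartz" and "\<psi> 0 = 1"
    and "f \<in> slowly_increasing"
    and "u \<in> tempered"
  shows "converges_distr (cutoff_product M \<psi> (of_fun f) u) (fun_mult f u) \<and>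
    pi_defined M (of_fun f) u \<and>
    distr_eq (pi_product M (of_fun f) u) (fun_mult f u)"
proof -
  \<comment> \<open>A function equal to 1 near 0 has the value 1 at 0 itself, so the general
    convergence result applies. Its limit does not mention \<psi>, which gives independence of the
    cut-off.\<close>
  have conv: "converges_distr (cutoff_product M \<psi> (of_fun f) u) (fun_mult f u)" if "\<psi> \<in> pi_cutoffs" for \<psi>
    using that assms test_functions_in_schwartz
    by (intro converges_cutoff_product) (auto simp: pi_cutoffs_def dest: eventually_nhds_x_imp_x)
  have pi_psi: "pi_psi M \<psi> (of_fun f) u \<phi> = fun_mult f u \<phi>" if "\<psi> \<in> pi_cutoffs" "\<phi> \<in> test_functions" for \<psi> \<phi>
    using conv[OF that(1)] that(2) unfolding pi_psi_def converges_distr_def by (auto intro: limI)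
  have "pi_defined M (of_fun f) u"
    unfolding pi_defined_def pi_psi_exists_def
    using assms conv of_fun_in_tempered by (auto simp: distr_eq_def pi_psi)
  moreover have "pi_product M (of_fun f) u \<phi> = fun_mult f u \<phi>" if "\<phi> \<in> test_functions" for \<phi>
  proof -
    obtain \<psi> :: "'n cfun" where "\<psi> \<in> pi_cutoffs" using pi_cutoffs_nonempty by blast
    then show ?thesis
      unfolding pi_product_def using that by (intro the_equality) (auto simp: pi_psi)
  qed
  ultimately show ?thesis
    using assms by (simp add: converges_cutoff_product distr_eq_def)
qed

end
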